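(* Let $X$ be a separable infinite-dimensional Banach space not containing an isomorphic copy of $\ell_1$. Let $\rho=\rho_X$, $\theta=\theta_X$, $\varphi=\varphi_X$, $\psi=\psi_X$ be the functions on $[0,1]$ defined in the context. Then: (1) Each of the functions $\rho(t)/t$, $\theta(t)/t$, $\varphi(t)/t$ and $\psi(t)/t$ is monotone increasing (non-decreasing) on $(0,1)$. (2) $\theta$ is $4$-equivalent to $\rho^*$ and $\psi$ is $4$-equivalent to $\varphi^*$. (3) $\rho$ is $8$-equivalent to $\theta^*$ and $\varphi$ is $8$-equivalent to $\psi^*$. (4) If $0<t\le 1$ then $$\mathrm{Cz}(X,t)\le 1+\frac{1}{\psi(t/4)}$$ (where $1/0=\infty$).
   Context: For a separable infinite-dimensional Banach space $X$ and $0\le\sigma\le1$, $\rho_X(\sigma)$ is the least constant such that $\limsup_{n\to\infty}\|x+x_n\|\le 1+\rho_X(\sigma)$ whenever $x\in X$, $\|x\|=1$, $(x_n)$ is a sequence in $X$ with $x_n\to0$ weakly and $\limsup\|x_n\|\le\sigma$. For $0\le\tau\le1$, $\theta_X(\tau)$ is the greatest constant such that $\liminf_{n\to\infty}\|x^*+x_n^*\|\ge 1+\theta_X(\tau)$ whenever $x^*,x_n^*\in X^*$, $\|x^*\|=1$, $x_n^*\to0$ weak$^*$ and $\liminf\|x_n^*\|\ge\tau$. Put $\varphi_X(\sigma)=\inf\{\rho_Y(\sigma): d(X,Y)\le2\}$ and $\psi_X(\tau)=\sup\{\theta_Y(\tau): d(X,Y)\le 2\}$, where $Y$ ranges over Banach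 spaces isomorphic to $X$ and $d$ is the Banach–Mazur distance. For increasing functions $f,g$ on $[0,1]$ with $f(0)=g(0)=0$ and $C\ge1$: $f$ $C$-dominates $g$ if $f(\tau)\ge g(\tau/C)$ for all $0\le\tau\le1$; $f$ and $g$ are $C$-equivalent if each $C$-dominates the other. The dual Young function is $f^*(s)=\sup\{st-f(t):0\le t\le1\}$ for $0\le s\le1$. Convex Szlenk index: for a weak$^*$-compact $K\subset X^*$ and $\epsilon>0$, $\iota_\epsilon K$ is $K$ minus the union of all weak$^*$-open $V\subset X^*$ with norm-diameter of $V\cap K$ at most $\epsilon$. For $K$ weak$^*$-compact convex, $\hat\iota_\epsilon K$ is the weak$^*$-closed convex hull of $\iota_\epsilon K$. $\mathrm{Cz}(X,\epsilon)$ is the least $n\in\mathbb N$ with $\hat\iota_\epsilon^{\,n}B_{X^*}=\emptyset$ ($n$-fold iteration, $B_{X^*}$ the closed unit ball of $X^*$), and $\mathrm{Cz}(X,\epsilon)=\infty$ if there is no such $n$. *)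

theory Defs
  imports "HOL-Analysis.Analysis"
begin

text \<open>
  The functions \<open>\<phi>\<^sub>X\<close>, \<open>\<psi>\<^sub>X\<close> range over all Banach spaces \<open>Y\<close> isomorphic to \<open>X\<close>, and types cannot be
  quantified over inside a definition. We therefore represent a (real) Banach space by a complete
  norm \<open>N\<close> on a real vector space. Since an isomorphism \<open>T : Y \<rightarrow> X\<close> makes \<open>Y\<close> isometric to the vector
  space of \<open>X\<close> with the norm \<open>x \<mapsto> \<parallel>T\<inverse> x\<parallel>\<close>, all such \<open>Y\<close> are obtained, up to isometry, as complete
  norms on the vector space underlying \<open>X\<close>.
\<close>

definition is_norm :: "('a::real_vector \<Rightarrow> real) \<Rightarrow> bool" where
  "is_norm N \<longleftrightarrow> (\<forall>x. N x = 0 \<longleftrightarrow> x = 0) \<and> (\<forall>x y. N (x + y) \<le> N x + N y) \<and>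
     (\<forall>c x. N (c *\<^sub>R x) = \<bar>c\<bar> * N x)"

definition banach_norm :: "('a::real_vector \<Rightarrow> real) \<Rightarrow> bool" where
  "banach_norm N \<longleftrightarrow> is_norm N \<and> Metric_space.mcomplete UNIV (\<lambda>x y. N (x - y))"

definition bounded_lin ::
    "('a::real_vector \<Rightarrow> real) \<Rightarrow> ('b::real_vector \<Rightarrow> real) \<Rightarrow> ('a \<Rightarrow> 'b) \<Rightarrow> bool" where
  "bounded_lin M N T \<longleftrightarrow> linear T \<and> (\<exists>C. \<forall>x. N (T x) \<le> C * M x)"

definition opnorm ::
    "('a::real_vector \<Rightarrow> real) \<Rightarrow> ('b::real_vector \<Rightarrow> real) \<Rightarrow> ('a \<Rightarrow> 'b) \<Rightarrow> real" where
  "opnorm M N T = (SUP x\<in>{x. M x \<le> 1}. N (T x))"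

text \<open>The multiplicative Banach--Mazur distance; it is \<open>\<infinity>\<close> for non-isomorphic spaces.\<close>

definition banach_mazur ::
    "('a::real_vector \<Rightarrow> real) \<Rightarrow> ('b::real_vector \<Rightarrow> real) \<Rightarrow> ereal" where
  "banach_mazur M N =
     (INF T\<in>{T. bij T \<and> bounded_lin M N T \<and> bounded_lin N M (inv T)}.
        ereal (opnorm M N T * opnorm N M (inv T)))"

definition dual :: "('a::real_vector \<Rightarrow> real) \<Rightarrow> ('a \<Rightarrow> real) set" where
  "dual N = {f. bounded_lin N abs f}"

definition dual_norm :: "('a::real_vector \<Rightarrow> real) \<Rightarrow> ('a \<Rightarrow> real) \<Rightarrow> real" where
  "dual_norm N f = opnorm N abs f"

definition weakly_null :: "('a::real_vector \<Rightarrow> real) \<Rightarrow> (nat \<Rightarrow> 'a) \<Rightarrow> bool" where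
  "weakly_null N xs \<longleftrightarrow> (\<forall>f\<in>dual N. (\<lambda>n. f (xs n)) \<longlonglongrightarrow> 0)"

definition weak_star_null :: "('a::real_vector \<Rightarrow> real) \<Rightarrow> (nat \<Rightarrow> 'a \<Rightarrow> real) \<Rightarrow> bool" where
  "weak_star_null N fs \<longleftrightarrow> (\<forall>n. fs n \<in> dual N) \<and> (\<forall>x. (\<lambda>n. fs n x) \<longlonglongrightarrow> 0)"

definition rho :: "('a::real_vector \<Rightarrow> real) \<Rightarrow> real \<Rightarrow> real" where
  "rho N \<sigma> = Inf {c. \<forall>x xs. N x = 1 \<longrightarrow> weakly_null N xs \<longrightarrow>
       limsup (\<lambda>n. ereal (N (xs n))) \<le> ereal \<sigma> \<longrightarrow>
       limsup (\<lambda>n. ereal (N (x + xs n))) \<le> ereal (1 + c)}"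

definition theta :: "('a::real_vector \<Rightarrow> real) \<Rightarrow> real \<Rightarrow> real" where
  "theta N \<tau> = Sup {c. \<forall>f fs. f \<in> dual N \<longrightarrow> dual_norm N f = 1 \<longrightarrow> weak_star_null N fs \<longrightarrow>
       ereal \<tau> \<le> liminf (\<lambda>n. ereal (dual_norm N (fs n))) \<longrightarrow>
       ereal (1 + c) \<le> liminf (\<lambda>n. ereal (dual_norm N (\<lambda>x. f x + fs n x)))}"

definition phi :: "('a::real_vector \<Rightarrow> real) \<Rightarrow> real \<Rightarrow> real" where
  "phi M \<sigma> = (INF N\<in>{N :: 'a \<Rightarrow> real. banach_norm N \<and> banach_mazur M N \<le> 2}. rho N \<sigma>)"

definition psi :: "('a::real_vector \<Rightarrow> real) \<Rightarrow> real \<Rightarrow> real" where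
  "psi M \<tau> = (SUP N\<in>{N :: 'a \<Rightarrow> real. banach_norm N \<and> banach_mazur M N \<le> 2}. theta N \<tau>)"

definition dominates :: "real \<Rightarrow> (real \<Rightarrow> real) \<Rightarrow> (real \<Rightarrow> real) \<Rightarrow> bool" where
  "dominates C f g \<longleftrightarrow> (\<forall>\<tau>\<in>{0..1}. f \<tau> \<ge> g (\<tau> / C))"

definition equivalent :: "real \<Rightarrow> (real \<Rightarrow> real) \<Rightarrow> (real \<Rightarrow> real) \<Rightarrow> bool" where
  "equivalent C f g \<longleftrightarrow> dominates C f g \<and> dominates C g f"

definition dual_young :: "(real \<Rightarrow> real) \<Rightarrow> real \<Rightarrow> real" where
  "dual_young f s = (SUP t\<in>{0..1}. s * t - f t)"

text \<open>The topology of the type \<open>'a \<Rightarrow> real\<close> is the product topology, i.e. that of pointwise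
  convergence, so its restriction to the dual is the weak* topology.\<close>

definition weak_star :: "('a::real_vector \<Rightarrow> real) \<Rightarrow> ('a \<Rightarrow> real) topology" where
  "weak_star N = top_of_set (dual N)"

definition dual_ball :: "('a::real_vector \<Rightarrow> real) \<Rightarrow> ('a \<Rightarrow> real) set" where
  "dual_ball N = {f \<in> dual N. dual_norm N f \<le> 1}"

definition szlenk_deriv ::
    "('a::real_vector \<Rightarrow> real) \<Rightarrow> real \<Rightarrow> ('a \<Rightarrow> real) set \<Rightarrow> ('a \<Rightarrow> real) set" where
  "szlenk_deriv N \<epsilon> K = K - \<Union>{V. openin (weak_star N) V \<and>
       (\<forall>f\<in>V \<inter> K. \<forall>g\<in>V \<inter> K. dual_norm N (\<lambda>x. f x - g x) \<le> \<epsilon>)}"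

text \<open>Function spaces are not an instance of \<open>real_vector\<close> in the library, so \<open>convex\<close> does not apply.\<close>

definition fun_convex :: "('a \<Rightarrow> real) set \<Rightarrow> bool" where
  "fun_convex S \<longleftrightarrow>
     (\<forall>f\<in>S. \<forall>g\<in>S. \<forall>u\<ge>0. \<forall>v\<ge>0. u + v = 1 \<longrightarrow> (\<lambda>x. u * f x + v * g x) \<in> S)"

definition convex_szlenk_deriv ::
    "('a::real_vector \<Rightarrow> real) \<Rightarrow> real \<Rightarrow> ('a \<Rightarrow> real) set \<Rightarrow> ('a \<Rightarrow> real) set" where
  "convex_szlenk_deriv N \<epsilon> K =
     (\<lambda>C. closedin (weak_star N) C \<and> fun_convex C) hull (szlenk_deriv N \<epsilon> K)"

definition Cz :: "('a::real_vector \<Rightarrow> real) \<Rightarrow> real \<Rightarrow> enat" where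
  "Cz N \<epsilon> = (if \<exists>n. (convex_szlenk_deriv N \<epsilon> ^^ n) (dual_ball N) = {}
     then enat (LEAST n. (convex_szlenk_deriv N \<epsilon> ^^ n) (dual_ball N) = {}) else \<infinity>)"

definition ell1 :: "(nat \<Rightarrow> real) set" where
  "ell1 = {a. summable (\<lambda>n. \<bar>a n\<bar>)}"

text \<open>An isomorphic copy of \<open>\<ell>\<^sub>1\<close> is the range of a linear map on \<open>\<ell>\<^sub>1\<close> that is bounded and bounded
  below.\<close>

definition contains_ell1 :: "('a::real_vector \<Rightarrow> real) \<Rightarrow> bool" where
  "contains_ell1 N \<longleftrightarrow> (\<exists>T :: (nat \<Rightarrow> real) \<Rightarrow> 'a.
     (\<forall>a\<in>ell1. \<forall>b\<in>ell1. T (\<lambda>n. a n + b n) = T a + T b) \<and>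
     (\<forall>c. \<forall>a\<in>ell1. T (\<lambda>n. c * a n) = c *\<^sub>R T a) \<and>
     (\<exists>c>0. \<exists>C. \<forall>a\<in>ell1. c * (\<Sum>n. \<bar>a n\<bar>) \<le> N (T a) \<and> N (T a) \<le> C * (\<Sum>n. \<bar>a n\<bar>)))"

end

theory Submission
  imports Defs "HOL-Complex_Analysis.Great_Picard"
begin

text \<open>
  Every norm \<open>N\<close> at Banach--Mazur distance at most 2 is isometric to a norm \<open>M\<close> with
  \<open>\<parallel>x\<parallel> \<le> M x \<le> (2 + \<delta>) \<parallel>x\<parallel>\<close>, so it suffices to treat equivalent norms. Both \<open>\<rho>\<close> and \<open>\<theta>\<close> have increasing
  slopes because \<open>x + \<lambda> y\<close> is a convex combination of \<open>x\<close> and \<open>x + y\<close>. Two inequalities tie them together.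

  \<^item> \<open>\<theta> \<tau> \<ge> \<tau> t / 4 - \<rho> t\<close>: pick almost norming vectors for a weak* null sequence, make them weakly Cauchy by
    Rosenthal's \<open>\<ell>\<^sub>1\<close> theorem, and halve the differences of a sparse subsequence to get a weakly null sequence
    on which the functionals are still at least about \<open>\<tau> / 2\<close>.
  \<^item> \<open>\<rho> (\<theta> u / (2 u)) \<le> \<theta> u / 2\<close>: take a weak* limit of functionals norming \<open>x + x\<^sub>n\<close> and split each
    functional into the limit and a weak* null part.

  All equivalences follow formally from these inequalities, which survive taking the infimum of the \<open>\<rho>\<close>'s and
  the supremum of the \<open>\<theta>\<close>'s. For the Szlenk index, each derivation lowers the radius of a dual ball of \<open>M\<close>
  by \<open>\<theta>\<close>.
\<close>

section \<open>Rosenthal's \<open>\<ell>\<^sub>1\<close> theorem\<close>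

text \<open>The constant 4 is the product of two losses. Successive differences are forced, since a
  weakly Cauchy sequence need not have a weak limit in the space, and halving them costs a factor 2.
  The other factor comes from bounding a functional on a vector by a product of norms:
  \<open>(1 + c) * (1 + r)\<close> exceeds 1 by up to \<open>2 * (c + r)\<close> when
  \<open>r \<le> 1\<close>. The 8 contains a further factor 2, spent when the comparison with
  \<open>dual_young\<close> is inverted through the slope of the function. Increasing slopes do here
  what convexity does in classical Young duality. The quarter in \<open>\<psi> (t / 4)\<close> also
  has two sources: a functional surviving the derivation at level \<open>t\<close> has companions
  only beyond distance \<open>t / 2\<close>, and comparing the two dual norms costs another 2. The
  infimum in the Banach--Mazur distance need not be attained, so renormings come only with ratios
  above 2, while the Szlenk bound is stated for exactly 2. The remedy is an integer strictly above
  \<open>1 / \<psi> (t / 4)\<close>, which leaves room, together with left continuity of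
  \<open>theta\<close>, which converts that room into a slightly larger ratio.\<close>

text \<open>A diagonal argument for properties in which only the part of \<open>L\<close> beyond
  \<open>s\<close> counts: points once chosen are kept, and the reservoir is thinned for all subsets
  of the points chosen so far.\<close>

lemma infinite_fusion:
  fixes Q :: "nat set \<Rightarrow> nat set \<Rightarrow> bool" and M :: "nat set"
  assumes inf: "infinite M"
    and her: "\<And>L L' s. Q L s \<Longrightarrow> {n\<in>L'. \<forall>x\<in>s. x < n} \<subseteq> L \<Longrightarrow> Q L' s"
    and ref: "\<And>L s. L \<subseteq> M \<Longrightarrow> infinite L \<Longrightarrow> finite s \<Longrightarrow> \<exists>L'\<subseteq>L. infinite L' \<and> Q L' s"
  shows "\<exists>L\<subseteq>M. infinite L \<and> (\<forall>s\<subseteq>L. finite s \<longrightarrow> Q L s)"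
proof -
  have ref_all: "\<exists>L'\<subseteq>L. infinite L' \<and> (\<forall>s\<in>S. Q L' s)"
    if "finite S" "\<And>s. s \<in> S \<Longrightarrow> finite s" "L \<subseteq> M" "infinite L" for S L
    using that
  proof (induction S rule: finite_induct)
    case empty
    then show ?case by blast
  next
    case (insert s S)
    then obtain L1 where L1: "L1 \<subseteq> L" "infinite L1" "\<forall>s\<in>S. Q L1 s" by auto
    with insert obtain L2 where L2: "L2 \<subseteq> L1" "infinite L2" "Q L2 s"
      using ref[of L1 s] by auto
    have "Q L2 r" if "r \<in> S" for r
      using that L1(3) L2(1) by (blast intro: her)
    moreover have "L2 \<subseteq> L" using L1 L2 by blast
    ultimately show ?case using L2 by blast
  qed
  \<comment> \<open>A stage consists of the finite set \<open>A\<close> already chosen and a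
    reservoir \<open>L\<close> above it for which every subset of \<open>A\<close> is
    settled.\<close>
  define P where "P = (\<lambda>(A, L). finite A \<and> A \<subseteq> M \<and> L \<subseteq> M \<and> infinite L \<and>
    (\<forall>a\<in>A. \<forall>l\<in>L. a < l) \<and> (\<forall>s\<subseteq>A. Q L s))"
  define R where "R = (\<lambda>(A :: nat set, L :: nat set) (A', L').
    \<exists>n\<in>L. A' = insert n A \<and> L' \<subseteq> L \<and> (\<forall>l\<in>L'. n < l))"
  obtain L0 where L0: "L0 \<subseteq> M" "infinite L0" "Q L0 {}"
    using ref[of M "{}"] inf by auto
  have start: "P ({}, L0)" using L0 by (auto simp: P_def)
  have step: "\<exists>y. P y \<and> R x y" if "P x" for x
  proof -
    obtain A L where x: "x = (A, L)" by force
    define n where "n = (LEAST n. n \<in> L)"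
    have Px: "finite A" "A \<subseteq> M" "L \<subseteq> M" "infinite L" "\<forall>a\<in>A. \<forall>l\<in>L. a < l"
      using that by (auto simp: P_def x)
    have nL: "n \<in> L" unfolding n_def using Px(4) by (metis LeastI ex_in_conv finite.emptyI)
    have "L - {..n} \<subseteq> M" "infinite (L - {..n})" using Px by auto
    then obtain L' where L': "L' \<subseteq> L - {..n}" "infinite L'" "\<forall>s\<in>Pow (insert n A). Q L' s"
      using ref_all[of "Pow (insert n A)" "L - {..n}"] Px(1) finite_subset[of _ "insert n A"]
      by auto
    have "P (insert n A, L')" using Px nL L' by (force simp: P_def)
    moreover have "R x (insert n A, L')" using nL L'(1) by (auto simp: R_def x intro!: bexI[of _ n])
    ultimately show ?thesis by blast
  qed
  have "\<exists>F. \<forall>k. (P (F k) \<and> (k = 0 \<longrightarrow> F k = ({}, L0))) \<and> R (F k) (F (Suc k))"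
    by (rule dependent_nat_choice) (use start step in auto)
  then obtain F where F: "F 0 = ({}, L0)" "\<And>k. P (F k)" "\<And>k. R (F k) (F (Suc k))"
    by auto
  define A where "A k = fst (F k)" for k
  define L where "L k = snd (F k)" for k
  have A0: "A 0 = {}" using F(1) by (simp add: A_def)
  have PAL: "finite (A k)" "A k \<subseteq> M" "L k \<subseteq> M" "infinite (L k)" "\<And>s. s \<subseteq> A k \<Longrightarrow> Q (L k) s"
    "\<And>a l. a \<in> A k \<Longrightarrow> l \<in> L k \<Longrightarrow> a < l" for k
    using F(2)[of k] by (auto simp: P_def A_def L_def split: prod.splits)
  have "\<exists>n. n \<in> L k \<and> A (Suc k) = insert n (A k) \<and> L (Suc k) \<subseteq> L k \<and> (\<forall>l\<in>L (Suc k). n < l)" for k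
    using F(3)[of k] by (auto simp: R_def A_def L_def split: prod.splits)
  then obtain n where n: "n k \<in> L k" "A (Suc k) = insert (n k) (A k)" "L (Suc k) \<subseteq> L k"
      "\<And>l. l \<in> L (Suc k) \<Longrightarrow> n k < l" for k
    by metis
  define N where "N = range n"
  have L_anti: "L j \<subseteq> L i" if "i \<le> j" for i j
    using lift_Suc_antimono_le[of L, OF n(3) that] .
  have n_mono: "strict_mono n"
    using n(1,3,4) by (intro strict_mono_Suc_iff[THEN iffD2] allI) auto
  have A_eq: "A k = n ` {..<k}" for k
    by (induction k) (auto simp: A0 n(2) lessThan_Suc)
  have nL: "n j \<in> L k" if "k \<le> j" for j k using n(1) L_anti[OF that] by auto
  have "Q N s" if s: "s \<subseteq> N" "finite s" for s
  proof -
    \<comment> \<open>Stop right after the largest element of \<open>s\<close>: all later points of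
      \<open>N\<close> come from the reservoir of that stage, so heredity moves \<open>Q\<close>
      from the reservoir to \<open>N\<close>.\<close>
    have "\<exists>k. s \<subseteq> A k \<and> {m\<in>N. \<forall>x\<in>s. x < m} \<subseteq> L k"
    proof (cases "s = {}")
      case True
      then show ?thesis using nL[OF le0] by (intro exI[of _ 0]) (auto simp: N_def)
    next
      case False
      then have "Max s \<in> N" using Max_in[OF s(2)] s(1) by blast
      then obtain k where k: "Max s = n k" by (auto simp: N_def)
      have "s \<subseteq> A (Suc k)"
      proof
        fix x assume x: "x \<in> s"
        then obtain i where i: "x = n i" using s by (auto simp: N_def)
        have "n i \<le> n k" using x s k i Max_ge by metis
        then show "x \<in> A (Suc k)"
          using n_mono by (auto simp: A_eq i strict_mono_less_eq less_Suc_eq_le)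
      qed
      moreover have "{m\<in>N. \<forall>x\<in>s. x < m} \<subseteq> L (Suc k)"
      proof
        fix m assume m: "m \<in> {m\<in>N. \<forall>x\<in>s. x < m}"
        then obtain j where j: "m = n j" by (auto simp: N_def)
        have "n k < n j" using m Max_in[OF s(2) False] by (auto simp: j k)
        then show "m \<in> L (Suc k)" using n_mono nL j by (auto simp: strict_mono_less Suc_le_eq)
      qed
      ultimately show ?thesis by blast
    qed
    then obtain k where "s \<subseteq> A k" "{m\<in>N. \<forall>x\<in>s. x < m} \<subseteq> L k" by blast
    then show ?thesis by (intro her[OF PAL(5)])
  qed
  moreover have "N \<subseteq> M" using n(1) PAL(3) by (auto simp: N_def)
  moreover have "infinite N"
    using n_mono by (simp add: N_def range_inj_infinite strict_mono_imp_inj_on)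
  ultimately show ?thesis by blast
qed

text \<open>Combinatorial forcing: fusion decides every finite set, and a rejected set has only finitely many accepted
  one-point extensions, so fusion also propagates rejection from the empty set.\<close>

lemma Galvin_Nash_Williams:
  fixes F :: "nat set \<Rightarrow> bool"
  shows "\<exists>M. infinite M \<and> ((\<forall>s\<subseteq>M. finite s \<longrightarrow> \<not> F s) \<or>
    (\<forall>L\<subseteq>M. infinite L \<longrightarrow> (\<exists>k. F (L \<inter> {..<k}))))"
proof -
  \<comment> \<open>Acceptance of \<open>s\<close>: every infinite continuation inside
    \<open>M\<close> runs into \<open>F\<close> at a finite stage. Rejection means that no infinite
    subset of \<open>M\<close> accepts \<open>s\<close>, so each \<open>s\<close> is settled after
    thinning.\<close>
  define acc where "acc M s \<longleftrightarrow> (\<forall>L\<subseteq>M. infinite L \<longrightarrow> (\<forall>x\<in>s. \<forall>y\<in>L. x < y) \<longrightarrow>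
    (\<exists>k. F (s \<union> (L \<inter> {..<k}))))" for M s
  define rej where "rej M s \<longleftrightarrow> (\<forall>L\<subseteq>M. infinite L \<longrightarrow> \<not> acc L s)" for M s
  have acc_mono: "acc L' s" if "acc L s" "{n\<in>L'. \<forall>x\<in>s. x < n} \<subseteq> L" for L L' s
    unfolding acc_def
  proof (intro allI impI)
    fix H assume H: "H \<subseteq> L'" "infinite H" "\<forall>x\<in>s. \<forall>y\<in>H. x < y"
    then have "H \<subseteq> L" using that(2) by auto
    then show "\<exists>k. F (s \<union> H \<inter> {..<k})" using that(1) H by (auto simp: acc_def)
  qed
  have acc_tail: "acc L s" if "acc {n\<in>L. \<forall>x\<in>s. x < n} s" for L s
    using that by (rule acc_mono) auto
  have "\<exists>M. M \<subseteq> UNIV \<and> infinite M \<and> (\<forall>s\<subseteq>M. finite s \<longrightarrow> acc M s \<or> rej M s)"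
  proof (rule infinite_fusion)
    fix L L' s :: "nat set"
    assume Q: "acc L s \<or> rej L s" and sub: "{n\<in>L'. \<forall>x\<in>s. x < n} \<subseteq> L"
    from Q show "acc L' s \<or> rej L' s"
    proof
      assume r: "rej L s"
      show ?thesis
      proof (cases "finite s")
        case True
        have "\<not> acc H s" if H: "H \<subseteq> L'" "infinite H" for H
        proof
          assume "acc H s"
          define H' where "H' = {n\<in>H. \<forall>x\<in>s. x < n}"
          have "H - H' \<subseteq> (\<Union>x\<in>s. {..x})" by (auto simp: H'_def not_less)
          then have "finite (H - H')" using True by (meson finite_UN finite_atMost finite_subset)
          then have "infinite (H - (H - H'))" using H(2) by (rule Diff_infinite_finite)
          moreover have "H - (H - H') = H'" by (auto simp: H'_def)
          ultimately have "infinite H'" by simp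
          moreover have "H' \<subseteq> L" using sub H by (auto simp: H'_def)
          moreover have "acc H' s" using \<open>acc H s\<close> by (rule acc_mono) (auto simp: H'_def)
          ultimately show False using r by (auto simp: rej_def)
        qed
        then show ?thesis by (auto simp: rej_def)
      next
        case False
        \<comment> \<open>No number lies above an infinite \<open>s\<close>, so acceptance is
          vacuous; heredity has to be shown for such \<open>s\<close> as well.\<close>
        have "acc L' s" unfolding acc_def
        proof (intro allI impI)
          fix H assume H: "H \<subseteq> L'" "infinite H" "\<forall>x\<in>s. \<forall>y\<in>H. x < y"
          obtain y where "y \<in> H" using H(2) by (metis ex_in_conv finite.emptyI)
          then have "s \<subseteq> {..<y}" using H(3) by auto
          then show "\<exists>k. F (s \<union> H \<inter> {..<k})" using False finite_subset by blast
        qed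
        then show ?thesis ..
      qed
    qed (use acc_mono sub in blast)
  next
    fix L s :: "nat set" assume "infinite L"
    then show "\<exists>L'\<subseteq>L. infinite L' \<and> (acc L' s \<or> rej L' s)"
      by (cases "rej L s") (auto simp: rej_def)
  qed auto
  then obtain M where M: "infinite M" "\<And>s. s \<subseteq> M \<Longrightarrow> finite s \<Longrightarrow> acc M s \<or> rej M s" by blast
  show ?thesis
  proof (cases "acc M {}")
    case True
    with M(1) show ?thesis by (auto simp: acc_def)
  next
    case False
    define Q where "Q L s \<longleftrightarrow> s \<subseteq> M \<longrightarrow> rej M s \<longrightarrow>
      (\<forall>n\<in>L. (\<forall>x\<in>s. x < n) \<longrightarrow> rej M (insert n s))" for L s
    have "\<exists>L\<subseteq>M. infinite L \<and> (\<forall>s\<subseteq>L. finite s \<longrightarrow> Q L s)"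
    proof (rule infinite_fusion)
      fix L s :: "nat set" assume L: "L \<subseteq> M" "infinite L" and s: "finite s"
      show "\<exists>L'\<subseteq>L. infinite L' \<and> Q L' s"
      proof (cases "s \<subseteq> M \<and> rej M s")
        case True
        \<comment> \<open>Were the set \<open>Z\<close> of accepted extensions infinite, it would
          accept \<open>s\<close>: the least element of any continuation inside \<open>Z\<close>
          already extends \<open>s\<close> to an accepted set.\<close>
        define Z where "Z = {n\<in>L. (\<forall>x\<in>s. x < n) \<and> acc M (insert n s)}"
        have "acc Z s" unfolding acc_def
        proof (intro allI impI)
          fix H assume H: "H \<subseteq> Z" "infinite H" "\<forall>x\<in>s. \<forall>y\<in>H. x < y"
          define n where "n = (LEAST n. n \<in> H)"
          have nH: "n \<in> H" unfolding n_def using H(2) by (metis LeastI ex_in_conv finite.emptyI)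
          have nle: "n \<le> m" if "m \<in> H" for m unfolding n_def using that by (rule Least_le)
          have "acc M (insert n s)" using nH H(1) by (auto simp: Z_def)
          moreover have "H - {n} \<subseteq> M" using H(1) L(1) by (auto simp: Z_def)
          moreover have "\<forall>x\<in>insert n s. \<forall>y\<in>H - {n}. x < y"
            using H(3) nle by (auto simp: le_less)
          moreover have "infinite (H - {n})" using H(2) by simp
          ultimately obtain k where k: "F (insert n s \<union> ((H - {n}) \<inter> {..<k}))"
            unfolding acc_def by blast
          have "H \<inter> {..<max k (Suc n)} = insert n ((H - {n}) \<inter> {..<k})"
          proof (intro equalityI subsetI)
            fix m assume "m \<in> H \<inter> {..<max k (Suc n)}"
            then show "m \<in> insert n ((H - {n}) \<inter> {..<k})" using nle[of m] by auto
          qed (use nH in auto)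
          then have "s \<union> (H \<inter> {..<max k (Suc n)}) = insert n s \<union> ((H - {n}) \<inter> {..<k})"
            by simp
          with k show "\<exists>k. F (s \<union> H \<inter> {..<k})" by metis
        qed
        moreover have "Z \<subseteq> M" using L(1) by (auto simp: Z_def)
        ultimately have "finite Z" using True unfolding rej_def by meson
        then have "infinite (L - Z)" using L(2) by simp
        moreover have "Q (L - Z) s"
          unfolding Q_def
        proof (intro impI ballI)
          fix n assume "n \<in> L - Z" "\<forall>x\<in>s. x < n" "s \<subseteq> M"
          then show "rej M (insert n s)"
            using M(2)[of "insert n s"] L(1) s by (auto simp: Z_def)
        qed
        ultimately show ?thesis by blast
      next
        case False
        then show ?thesis using L by (auto simp: Q_def)
      qed
    qed (use M(1) in \<open>auto simp: Q_def\<close>)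
    then obtain L where L: "L \<subseteq> M" "infinite L" "\<And>s. s \<subseteq> L \<Longrightarrow> finite s \<Longrightarrow> Q L s" by blast
    have rejL: "rej M s" if "finite s" "s \<subseteq> L" for s
      using that
    proof (induction s rule: finite_linorder_max_induct)
      case empty
      then show ?case using M(2)[of "{}"] False by auto
    next
      case (insert b A)
      then show ?case using L(1) L(3)[of A] by (auto simp: Q_def)
    qed
    have "\<not> F s" if "finite s" "s \<subseteq> L" for s
    proof
      assume F: "F s"
      define H where "H = L - (\<Union>x\<in>s. {..x})"
      have "infinite H" using L(2) that by (simp add: H_def)
      moreover have "H \<subseteq> M" using L(1) by (auto simp: H_def)
      \<comment> \<open>A member of \<open>F\<close> is accepted through the empty continuation,
        hence cannot be rejected.\<close>
      moreover have "acc H s" using F by (auto simp: acc_def intro: exI[of _ 0])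
      ultimately show False using rejL[OF that] by (auto simp: rej_def)
    qed
    then have "\<forall>s\<subseteq>L. finite s \<longrightarrow> \<not> F s" by simp
    then show ?thesis using L(2) by (intro exI[of _ L]) simp
  qed
qed

text \<open>Farahat's argument: apply Ramsey to the finite sets along which \<open>P\<close> and \<open>Q\<close> can be made to alternate.
  Every second element of the homogeneous set can then be given either sign, since the elements in
  between adjust the parity.\<close>

lemma independent_subsequence:
  fixes P Q :: "nat \<Rightarrow> 'k \<Rightarrow> bool"
  assumes osc: "\<And>M. infinite M \<Longrightarrow> \<exists>x. infinite {n\<in>M. P n x} \<and> infinite {n\<in>M. Q n x}"
  shows "\<exists>e :: nat \<Rightarrow> nat. strict_mono e \<and>
    (\<forall>m \<epsilon>. \<exists>x. \<forall>k<m. if \<epsilon> k then P (e k) x else Q (e k) x)"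
proof -
  define alt where "alt s x \<longleftrightarrow> (\<forall>n\<in>s. if even (card {j\<in>s. j < n}) then P n x else Q n x)" for s x
  \<comment> \<open>The dichotomy is applied to the sets along which no point alternates; a single
    oscillating point below excludes the second alternative.\<close>
  obtain M where M: "infinite M" "(\<forall>s\<subseteq>M. finite s \<longrightarrow> \<not> (\<nexists>x. alt s x)) \<or>
    (\<forall>L\<subseteq>M. infinite L \<longrightarrow> (\<exists>k. (\<nexists>x. alt (L \<inter> {..<k}) x)))"
    using Galvin_Nash_Williams[of "\<lambda>s. \<nexists>x. alt s x"] by blast
  from osc[OF M(1)] obtain x where x: "infinite {n\<in>M. P n x}" "infinite {n\<in>M. Q n x}" by blast
  define W where "W k n \<longleftrightarrow> n \<in> M \<and> (if even k then P n x else Q n x)" for k :: nat and n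
  have W_inf: "infinite {n. W k n}" for k
    using x by (cases "even k") (auto simp: W_def Collect_conj_eq)
  have "\<exists>l. \<forall>k. W k (l k) \<and> l k < l (Suc k)"
  proof (rule dependent_nat_choice)
    show "\<exists>n. W 0 n" using W_inf[of 0] not_finite_existsD by auto
    show "\<exists>n'. W (Suc k) n' \<and> n < n'" for k n
      using W_inf[of "Suc k"] by (metis infinite_nat_iff_unbounded mem_Collect_eq)
  qed
  then obtain l where l: "\<And>k. W k (l k)" "\<And>k. l k < l (Suc k)" by blast
  have l_mono: "strict_mono l" using l(2) by (simp add: strict_mono_Suc_iff)
  have card_l: "card {j \<in> range l \<inter> {..<k}. j < l i} = i" if "l i < k" for i k
  proof -
    have "l j < k" if "j < i" for j
      using that \<open>l i < k\<close> l_mono by (meson order.strict_trans strict_mono_less)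
    then have "{j \<in> range l \<inter> {..<k}. j < l i} = l ` {..<i}"
      using l_mono by (auto simp: strict_mono_less)
    then show ?thesis
      using l_mono by (simp add: card_image strict_mono_imp_inj_on)
  qed
  have "alt (range l \<inter> {..<k}) x" for k
    unfolding alt_def using card_l l(1) by (auto simp: W_def)
  moreover have "range l \<subseteq> M" using l(1) by (auto simp: W_def)
  moreover have "infinite (range l)"
    using l_mono by (simp add: range_inj_infinite strict_mono_imp_inj_on)
  ultimately have alt_M: "\<exists>x. alt s x" if "s \<subseteq> M" "finite s" for s
    using M(2) that by blast
  define e where "e = enumerate M"
  have e: "strict_mono e" "\<And>n. e n \<in> M"
    using M(1) strict_mono_enumerate by (auto simp: e_def enumerate_in_set)
  \<comment> \<open>Only odd places are kept. The even place just before each of them is a spare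
    that can be inserted to flip the parity of the rank.\<close>
  define f where "f k = e (2 * k + 1)" for k
  have "\<exists>x. \<forall>k<m. if \<epsilon> k then P (f k) x else Q (f k) x" for m and \<epsilon> :: "nat \<Rightarrow> bool"
  proof -
    have "\<exists>s. finite s \<and> s \<subseteq> M \<and> (\<forall>n\<in>s. n < e (2 * m)) \<and>
      (\<forall>k<m. f k \<in> s \<and> (even (card {j\<in>s. j < f k}) \<longleftrightarrow> \<epsilon> k))"
    proof (induction m)
      case 0
      then show ?case by auto
    next
      case (Suc m)
      then obtain s where s: "finite s" "s \<subseteq> M" "\<forall>n\<in>s. n < e (2 * m)"
        "\<forall>k<m. f k \<in> s \<and> (even (card {j\<in>s. j < f k}) \<longleftrightarrow> \<epsilon> k)" by blast
      define r where "r = (if even (card s) \<longleftrightarrow> \<epsilon> m then s else insert (e (2 * m)) s)"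
      have less: "e (2 * m) < f m" "f m < e (2 * Suc m)" 
        using e(1) by (auto simp: f_def strict_mono_less)
      have r: "finite r" "r \<subseteq> M" "\<forall>n\<in>r. n < f m" "even (card r) \<longleftrightarrow> \<epsilon> m" "s \<subseteq> r"
        "\<forall>n\<in>r - s. n = e (2 * m)"
        using s e(2) less by (auto simp: r_def)
      have f_less: "f k < e (2 * m)" if "k < m" for k
        using e(1) that by (auto simp: f_def strict_mono_less)
      have low: "{j \<in> insert (f m) r. j < f k} = {j\<in>s. j < f k}" if "k < m" for k
      proof -
        have "x \<in> s" if "x \<in> r" "x < f k" for x
          using that r(6) f_less[OF \<open>k < m\<close>] by (metis Diff_iff order.strict_trans less_irrefl)
        then show ?thesis using r(5) f_less[OF that] less by auto
      qed
      have top: "{j \<in> insert (f m) r. j < f m} = r" using r(3) by auto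
      show ?case
      proof (intro exI[of _ "insert (f m) r"] conjI allI impI)
        show "insert (f m) r \<subseteq> M" using r e by (auto simp: f_def)
        show "\<forall>n\<in>insert (f m) r. n < e (2 * Suc m)" using r(3) less by auto
        fix k assume "k < Suc m"
        then consider "k < m" | "k = m" by linarith
        then show "f k \<in> insert (f m) r" using s(4) r(5) by cases auto
        from \<open>k < Suc m\<close> consider "k < m" | "k = m" by linarith
        then show "even (card {j \<in> insert (f m) r. j < f k}) \<longleftrightarrow> \<epsilon> k"
          by cases (use s(4) r(4) low top in auto)
      qed (use r in auto)
    qed
    then obtain s where s: "finite s" "s \<subseteq> M"
      "\<forall>k<m. f k \<in> s \<and> (even (card {j\<in>s. j < f k}) \<longleftrightarrow> \<epsilon> k)" by blast
    with alt_M obtain x where "alt s x" by blast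
    then show ?thesis using s(3) by (auto simp: alt_def intro!: exI[of _ x])
  qed
  moreover have "strict_mono f" using e(1) by (auto simp: f_def strict_mono_def)
  ultimately show ?thesis by blast
qed

section \<open>From pointwise convergent subsequences to copies of ell_1\<close>

text \<open>A bounded divergent sequence clusters at some \<open>l\<close> and stays a fixed
  distance away on one side infinitely often, with rationals in between. Convergence is thus decided
  by countably many conditions, which a diagonal argument can meet.\<close>

lemma convergent_if_not_oscillating:
  fixes u :: "nat \<Rightarrow> real"
  assumes bdd: "\<And>n. \<bar>u n\<bar> \<le> C"
    and osc: "\<And>a b. a \<in> \<rat> \<Longrightarrow> b \<in> \<rat> \<Longrightarrow> a < b \<Longrightarrow>
      finite {n. u n < a} \<or> finite {n. b < u n}"
  shows "convergent u"
proof (rule ccontr)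
  assume nc: "\<not> convergent u"
  have "bounded (range u)" using bdd by (auto simp: bounded_iff)
  then obtain l r where r: "strict_mono r" "(u \<circ> r) \<longlonglongrightarrow> l"
    using bounded_imp_convergent_subsequence[of u] by auto
  have "\<not> u \<longlonglongrightarrow> l" using nc by (auto simp: convergent_def)
  then obtain d where d: "d > 0" "\<exists>\<^sub>F n in sequentially. \<not> \<bar>u n - l\<bar> < d"
    by (auto simp: tendsto_iff dist_real_def frequently_def)
  then have inf: "infinite {n. \<not> \<bar>u n - l\<bar> < d}"
    by (simp add: frequently_cofinite flip: cofinite_eq_sequentially)
  have near: "infinite {n. \<bar>u n - l\<bar> < h}" if "h > 0" for h
  proof -
    have "\<forall>\<^sub>F n in sequentially. \<bar>u (r n) - l\<bar> < h"
      using r(2) that by (auto simp: tendsto_iff dist_real_def)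
    then obtain N where N: "\<And>n. n \<ge> N \<Longrightarrow> \<bar>u (r n) - l\<bar> < h"
      by (auto simp: eventually_sequentially)
    have "r ` {N..} \<subseteq> {n. \<bar>u n - l\<bar> < h}" using N by auto
    moreover have "infinite (r ` {N..})"
      using r(1) by (simp add: finite_image_iff infinite_Ici strict_mono_imp_inj_on)
    ultimately show ?thesis using finite_subset by blast
  qed
  have "{n. \<not> \<bar>u n - l\<bar> < d} \<subseteq> {n. l + d \<le> u n} \<union> {n. u n \<le> l - d}" by auto
  then consider "infinite {n. l + d \<le> u n}" | "infinite {n. u n \<le> l - d}"
    using inf finite_subset by blast
  then show False
  proof cases
    case 1
    obtain a where a: "a \<in> \<rat>" "l < a" "a < l + d" using Rats_dense_in_real[of l "l + d"] d by auto
    obtain b where b: "b \<in> \<rat>" "a < b" "b < l + d" using Rats_dense_in_real[OF a(3)] by auto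
    have "{n. \<bar>u n - l\<bar> < a - l} \<subseteq> {n. u n < a}" "{n. l + d \<le> u n} \<subseteq> {n. b < u n}"
      using a b by auto
    then show False using osc[OF a(1) b(1,2)] 1 near[of "a - l"] a finite_subset
      by (metis diff_gt_0_iff_gt)
  next
    case 2
    obtain b where b: "b \<in> \<rat>" "l - d < b" "b < l" using Rats_dense_in_real[of "l - d" l] d by auto
    obtain a where a: "a \<in> \<rat>" "l - d < a" "a < b" using Rats_dense_in_real[OF b(2)] by auto
    have "{n. \<bar>u n - l\<bar> < l - b} \<subseteq> {n. b < u n}" "{n. u n \<le> l - d} \<subseteq> {n. u n < a}"
      using a b by auto
    then show False using osc[OF a(1) b(1) a(3)] 2 near[of "l - b"] b finite_subset
      by (metis diff_gt_0_iff_gt)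
  qed
qed

text \<open>Suppose no subsequence oscillates across fixed levels on all its infinite subsets. Then
  any pair of levels can be disposed of by thinning, and a diagonal over the rational pairs yields a
  pointwise convergent subsequence.\<close>

lemma oscillating_or_pointwise_convergent_subsequence:
  fixes u :: "nat \<Rightarrow> 'k \<Rightarrow> real"
  assumes bdd: "\<And>n x. x \<in> K \<Longrightarrow> \<bar>u n x\<bar> \<le> C"
    and nconv: "\<And>e :: nat \<Rightarrow> nat. strict_mono e \<Longrightarrow> \<exists>x\<in>K. \<not> convergent (\<lambda>n. u (e n) x)"
  shows "\<exists>(e :: nat \<Rightarrow> nat) a b. strict_mono e \<and> a < b \<and> (\<forall>M. infinite M \<longrightarrow> (\<exists>x\<in>K.
    infinite {n\<in>M. u (e n) x < a} \<and> infinite {n\<in>M. b < u (e n) x}))"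
proof (rule ccontr)
  assume neg: "\<not> ?thesis"
  define osc where "osc a b L \<longleftrightarrow> (\<exists>x\<in>K. infinite {n\<in>L. u n x < a} \<and> infinite {n\<in>L. b < u n x})"
    for a b L
  have osc_mono: "osc a b B" if "osc a b A" "A \<subseteq> B" for a b A B
  proof -
    from that(1) obtain x where x: "x \<in> K" "infinite {n\<in>A. u n x < a}" "infinite {n\<in>A. b < u n x}"
      by (auto simp: osc_def)
    have "{n\<in>A. u n x < a} \<subseteq> {n\<in>B. u n x < a}" "{n\<in>A. b < u n x} \<subseteq> {n\<in>B. b < u n x}"
      using that(2) by auto
    then have "infinite {n\<in>B. u n x < a}" "infinite {n\<in>B. b < u n x}"
      using x(2,3) infinite_super by blast+
    with x(1) show ?thesis by (auto simp: osc_def)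
  qed
  have ex: "\<exists>L'\<subseteq>L. infinite L' \<and> \<not> osc a b L'" if "infinite L" "a < b" for L a b
  proof -
    define e where "e = enumerate L"
    have e: "strict_mono e" "\<And>n. e n \<in> L"
      using that strict_mono_enumerate by (auto simp: e_def enumerate_in_set)
    have "\<not> (\<forall>M. infinite M \<longrightarrow> (\<exists>x\<in>K. infinite {n\<in>M. u (e n) x < a} \<and> infinite {n\<in>M. b < u (e n) x}))"
    proof
      assume *: "\<forall>M. infinite M \<longrightarrow> (\<exists>x\<in>K. infinite {n\<in>M. u (e n) x < a} \<and> infinite {n\<in>M. b < u (e n) x})"
      show False by (rule notE[OF neg]) (rule exI[of _ e], rule exI[of _ a], rule exI[of _ b], use e(1) that(2) * in simp)
    qed
    then obtain M where M: "infinite M"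
      "\<not> (\<exists>x\<in>K. infinite {n\<in>M. u (e n) x < a} \<and> infinite {n\<in>M. b < u (e n) x})" by auto
    have inj: "inj_on e A" for A using e(1) strict_mono_imp_inj_on by (metis inj_on_subset subset_UNIV)
    have "{n\<in>e ` M. u n x < a} = e ` {n\<in>M. u (e n) x < a}"
      "{n\<in>e ` M. b < u n x} = e ` {n\<in>M. b < u (e n) x}" for x by auto
    then have "\<not> osc a b (e ` M)" using M(2) by (simp add: osc_def finite_image_iff[OF inj])
    moreover have "infinite (e ` M)" using M(1) by (simp add: finite_image_iff[OF inj])
    ultimately show ?thesis using e(2) by blast
  qed
  obtain p :: "nat \<Rightarrow> real \<times> real" where p: "range p = {(a, b). a \<in> \<rat> \<and> b \<in> \<rat> \<and> a < b}"
  proof -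
    have "countable ((\<rat> :: real set) \<times> (\<rat> :: real set))" by (intro countable_SIGMA countable_rat)
    then have "countable {(a :: real, b). a \<in> \<rat> \<and> b \<in> \<rat> \<and> a < b}"
      by (rule countable_subset[rotated]) auto
    moreover have "(0, 1) \<in> {(a :: real, b). a \<in> \<rat> \<and> b \<in> \<rat> \<and> a < b}" by auto
    then have "{(a :: real, b). a \<in> \<rat> \<and> b \<in> \<rat> \<and> a < b} \<noteq> {}" by blast
    ultimately show ?thesis by (rule that[OF range_from_nat_into[rotated]])
  qed
  have p_less: "fst (p k) < snd (p k)" for k 
    using rangeI[of p k] by (auto simp: p split: prod.splits)
  \<comment> \<open>The cardinality of \<open>s\<close> selects the pair of levels, so fusion
    carries out the diagonal over the enumeration \<open>p\<close>. Restricting to the points beyond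
    \<open>s\<close> makes the condition hereditary.\<close>
  have "\<exists>M\<subseteq>UNIV. infinite M \<and>
    (\<forall>s\<subseteq>M. finite s \<longrightarrow> \<not> osc (fst (p (card s))) (snd (p (card s))) {n\<in>M. \<forall>x\<in>s. x < n})"
  proof (rule infinite_fusion)
    fix L L' s :: "nat set"
    assume *: "\<not> osc (fst (p (card s))) (snd (p (card s))) {n\<in>L. \<forall>x\<in>s. x < n}"
      and sub: "{n\<in>L'. \<forall>x\<in>s. x < n} \<subseteq> L"
    have "{n\<in>L'. \<forall>x\<in>s. x < n} \<subseteq> {n\<in>L. \<forall>x\<in>s. x < n}" using sub by auto
    with * show "\<not> osc (fst (p (card s))) (snd (p (card s))) {n\<in>L'. \<forall>x\<in>s. x < n}"
      using osc_mono by blast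
  next
    fix L s :: "nat set" assume "infinite L" "finite s"
    then have "infinite (L - (\<Union>x\<in>s. {..x}))" by simp
    from ex[OF this p_less[of "card s"]]
    obtain L' where L': "L' \<subseteq> L - (\<Union>x\<in>s. {..x})" "infinite L'"
      "\<not> osc (fst (p (card s))) (snd (p (card s))) L'" by blast
    have L'_eq: "{n\<in>L'. \<forall>x\<in>s. x < n} = L'" using L'(1) by force
    show "\<exists>L'\<subseteq>L. infinite L' \<and>
      \<not> osc (fst (p (card s))) (snd (p (card s))) {n\<in>L'. \<forall>x\<in>s. x < n}"
      by (rule exI[of _ L']) (use L' in \<open>auto simp: L'_eq\<close>)
  qed auto
  then obtain M where M: "infinite M" "\<And>s. s \<subseteq> M \<Longrightarrow> finite s \<Longrightarrow>
    \<not> osc (fst (p (card s))) (snd (p (card s))) {n\<in>M. \<forall>x\<in>s. x < n}" by blast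
  define e where "e = enumerate M"
  have e: "strict_mono e" "\<And>n. e n \<in> M"
    using M(1) strict_mono_enumerate by (auto simp: e_def enumerate_in_set)
  obtain x where x: "x \<in> K" "\<not> convergent (\<lambda>n. u (e n) x)" using nconv[OF e(1)] by blast
  have "convergent (\<lambda>n. u (e n) x)"
  proof (rule convergent_if_not_oscillating)
    show "\<bar>u (e n) x\<bar> \<le> C" for n using bdd x by auto
    fix a b :: real assume "a \<in> \<rat>" "b \<in> \<rat>" "a < b"
    then have "(a, b) \<in> range p" using p by auto
    then obtain k where k: "p k = (a, b)" by (metis rangeE)
    obtain s where s: "s \<subseteq> M" "finite s" "card s = k"
      using M(1) infinite_arbitrarily_large by blast
    define N where "N = {n\<in>M. \<forall>x\<in>s. x < n}"
    have nosc: "\<not> osc a b N" using M(2)[OF s(1,2)] by (simp add: s k N_def)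
    have "M - N \<subseteq> (\<Union>x\<in>s. {..x})" by (auto simp: N_def not_less)
    then have MN: "finite (M - N)" using s(2) by (meson finite_UN finite_atMost finite_subset)
    have fin: "finite {n. R (e n)}" if "finite {n\<in>N. R n}" for R
    proof -
      have "e ` {n. R (e n)} \<subseteq> {n\<in>N. R n} \<union> (M - N)" using e(2) by auto
      then have "finite (e ` {n. R (e n)})" using that MN finite_subset by blast
      then show ?thesis using e(1) by (metis finite_image_iff inj_on_subset strict_mono_imp_inj_on subset_UNIV)
    qed
    from nosc x(1) have "finite {n\<in>N. u n x < a} \<or> finite {n\<in>N. b < u n x}"
      by (auto simp: osc_def)
    then show "finite {n. u (e n) x < a} \<or> finite {n. b < u (e n) x}"
      using fin[of "\<lambda>n. u n x < a"] fin[of "\<lambda>n. b < u n x"] by blast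
  qed
  with x show False by blast
qed

text \<open>Without a weakly Cauchy subsequence there is a subsequence whose conditions
  \<open>f < a\<close> and \<open>b < f\<close> are independent over the dual ball, and independence
  amounts to a lower ell_1 estimate.\<close>

theorem Rosenthal_ell1:
  fixes x :: "nat \<Rightarrow> 'a::banach"
  assumes bdd: "\<And>n. norm (x n) \<le> C"
    and no_ell1: "\<not> contains_ell1 (norm :: 'a \<Rightarrow> real)"
  shows "\<exists>e :: nat \<Rightarrow> nat. strict_mono e \<and>
    (\<forall>f :: 'a \<Rightarrow> real. bounded_linear f \<longrightarrow> convergent (\<lambda>n. f (x (e n))))"
proof (rule ccontr)
  assume neg: "\<not> ?thesis"
  define K where "K = {f :: 'a \<Rightarrow> real. bounded_linear f \<and> (\<forall>y. \<bar>f y\<bar> \<le> norm y)}"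
  have C0: "C \<ge> 0" using bdd[of 0] norm_ge_zero order_trans by blast
  have "\<exists>f\<in>K. \<not> convergent (\<lambda>n. f (x (e n)))" if "strict_mono e" for e :: "nat \<Rightarrow> nat"
  proof -
    from neg that obtain f :: "'a \<Rightarrow> real"
      where f: "bounded_linear f" "\<not> convergent (\<lambda>n. f (x (e n)))" by blast
    from f(1) obtain B where B: "B > 0" "\<And>y. norm (f y) \<le> norm y * B"
      using bounded_linear.pos_bounded by blast
    define g where "g = (\<lambda>y. f y / B)"
    have "g \<in> K" using B bounded_linear_compose[OF bounded_linear_divide f(1), of B]
      by (auto simp: K_def g_def abs_divide divide_le_eq)
    moreover have "\<not> convergent (\<lambda>n. g (x (e n)))"
    proof
      assume "convergent (\<lambda>n. g (x (e n)))"
      then have "convergent (\<lambda>n. B * g (x (e n)))" by (intro convergent_mult convergent_const)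
      then show False using f(2) B(1) by (simp add: g_def)
    qed
    ultimately show ?thesis by blast
  qed
  moreover have "\<bar>f (x n)\<bar> \<le> C" if "f \<in> K" for f n
    using that bdd[of n] by (auto simp: K_def intro: order_trans)
  ultimately have "\<exists>(e :: nat \<Rightarrow> nat) a b. strict_mono e \<and> a < b \<and> (\<forall>M. infinite M \<longrightarrow>
    (\<exists>f\<in>K. infinite {n\<in>M. f (x (e n)) < a} \<and> infinite {n\<in>M. b < f (x (e n))}))"
    by (intro oscillating_or_pointwise_convergent_subsequence[of K "\<lambda>n f. f (x n)" C])
  then obtain e :: "nat \<Rightarrow> nat" and a b where e: "strict_mono e" "a < b" "\<forall>M. infinite M \<longrightarrow>
    (\<exists>f\<in>K. infinite {n\<in>M. f (x (e n)) < a} \<and> infinite {n\<in>M. b < f (x (e n))})"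
    by (elim exE conjE)
  have "\<exists>d :: nat \<Rightarrow> nat. strict_mono d \<and> (\<forall>m \<epsilon>. \<exists>f. \<forall>k<m. if \<epsilon> k then f \<in> K \<and> f (x (e (d k))) < a
      else f \<in> K \<and> b < f (x (e (d k))))"
  proof (rule independent_subsequence)
    fix M :: "nat set" assume "infinite M"
    then obtain f where "f \<in> K" "infinite {n\<in>M. f (x (e n)) < a}" "infinite {n\<in>M. b < f (x (e n))}"
      using e(3) by blast
    then show "\<exists>f. infinite {n\<in>M. f \<in> K \<and> f (x (e n)) < a} \<and> infinite {n\<in>M. f \<in> K \<and> b < f (x (e n))}"
      by (intro exI[of _ f]) auto
  qed
  then obtain d :: "nat \<Rightarrow> nat" where d: "\<forall>m \<epsilon>. \<exists>f. \<forall>k<m. if \<epsilon> k then f \<in> K \<and> f (x (e (d k))) < a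
      else f \<in> K \<and> b < f (x (e (d k)))"
    by (elim exE conjE)
  define y where "y n = x (e (d n))" for n
  \<comment> \<open>\<open>f\<close> follows the signs of the coefficients and \<open>g\<close>
    opposes them, so \<open>f - g\<close> gains \<open>b - a\<close> per unit of coefficient, while
    it is at most twice the norm. Taking a difference makes the position of \<open>a\<close> and
    \<open>b\<close> relative to 0 irrelevant.\<close>
  have lower: "(b - a) / 2 * (\<Sum>k<m. \<bar>c k\<bar>) \<le> norm (\<Sum>k<m. c k *\<^sub>R y k)" for m and c :: "nat \<Rightarrow> real"
  proof (cases "m = 0")
    case False
    obtain f where f: "\<forall>k<m. if c k < 0 then f \<in> K \<and> f (y k) < a else f \<in> K \<and> b < f (y k)"
      using d[rule_format, of m "\<lambda>k. c k < 0"] unfolding y_def by (elim exE)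
    obtain g where g: "\<forall>k<m. if 0 \<le> c k then g \<in> K \<and> g (y k) < a else g \<in> K \<and> b < g (y k)"
      using d[rule_format, of m "\<lambda>k. 0 \<le> c k"] unfolding y_def by (elim exE)
    have K: "f \<in> K" "g \<in> K" using f[rule_format, of 0] g[rule_format, of 0] False by (auto split: if_splits)
    let ?v = "\<Sum>k<m. c k *\<^sub>R y k"
    have lin: "h ?v = (\<Sum>k<m. c k * h (y k))" if "h \<in> K" for h
    proof -
      interpret h: bounded_linear h using that by (simp add: K_def)
      show ?thesis by (simp add: h.sum h.scaleR)
    qed
    have "(b - a) * (\<Sum>k<m. \<bar>c k\<bar>) = (\<Sum>k<m. (b - a) * \<bar>c k\<bar>)" by (simp add: sum_distrib_left)
    also have "\<dots> \<le> (\<Sum>k<m. c k * f (y k) - c k * g (y k))"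
    proof (rule sum_mono)
      fix k assume "k \<in> {..<m}"
      then have k: "k < m" by simp
      show "(b - a) * \<bar>c k\<bar> \<le> c k * f (y k) - c k * g (y k)"
      proof (cases "c k < 0")
        case True
        then have "b - a \<le> g (y k) - f (y k)" using f[rule_format, OF k] g[rule_format, OF k] by auto
        then have "(b - a) * \<bar>c k\<bar> \<le> (g (y k) - f (y k)) * \<bar>c k\<bar>" by (rule mult_right_mono) simp
        then show ?thesis using True by (simp add: algebra_simps)
      next
        case False
        then have "b - a \<le> f (y k) - g (y k)" using f[rule_format, OF k] g[rule_format, OF k] by auto
        then have "(b - a) * \<bar>c k\<bar> \<le> (f (y k) - g (y k)) * \<bar>c k\<bar>" by (rule mult_right_mono) simp
        then show ?thesis using False by (simp add: algebra_simps)
      qed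
    qed
    also have "\<dots> = f ?v - g ?v" by (simp add: lin K sum_subtractf)
    also have "\<dots> \<le> \<bar>f ?v\<bar> + \<bar>g ?v\<bar>" by linarith
    also have "\<dots> \<le> norm ?v + norm ?v" using K by (intro add_mono) (auto simp: K_def)
    finally show ?thesis by simp
  qed simp
  have yC: "norm (y n) \<le> C" for n using bdd by (simp add: y_def)
  define T where "T c = (\<Sum>n. c n *\<^sub>R y n)" for c :: "nat \<Rightarrow> real"
  have sum_abs: "summable (\<lambda>n. norm (c n *\<^sub>R y n))" if "c \<in> ell1" for c
  proof (rule summable_comparison_test')
    show "summable (\<lambda>n. C * \<bar>c n\<bar>)" using that by (simp add: ell1_def summable_mult)
    show "norm (norm (c n *\<^sub>R y n)) \<le> C * \<bar>c n\<bar>" if "n \<ge> 0" for n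
      using mult_right_mono[OF yC[of n], of "\<bar>c n\<bar>"] by (simp add: mult.commute)
  qed
  have summ: "summable (\<lambda>n. c n *\<^sub>R y n)" if "c \<in> ell1" for c
    using sum_abs[OF that] by (rule summable_norm_cancel)
  have "contains_ell1 (norm :: 'a \<Rightarrow> real)"
    unfolding contains_ell1_def
  proof (intro exI[of _ T] conjI ballI allI)
    show "T (\<lambda>n. u n + v n) = T u + T v" if "u \<in> ell1" "v \<in> ell1" for u v
      using suminf_add[OF summ[OF that(1)] summ[OF that(2)]] by (simp add: T_def scaleR_add_left)
    show "T (\<lambda>n. c * u n) = c *\<^sub>R T u" if "u \<in> ell1" for c u
      using bounded_linear.suminf[OF bounded_linear_scaleR_right summ[OF that], of c]
      by (simp add: T_def)
    have "(b - a) / 2 * (\<Sum>n. \<bar>u n\<bar>) \<le> norm (T u) \<and> norm (T u) \<le> C * (\<Sum>n. \<bar>u n\<bar>)"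
      if u: "u \<in> ell1" for u
    proof
      have s: "summable (\<lambda>n. \<bar>u n\<bar>)" using u by (simp add: ell1_def)
      have "(\<lambda>m. (b - a) / 2 * (\<Sum>k<m. \<bar>u k\<bar>)) \<longlonglongrightarrow> (b - a) / 2 * (\<Sum>n. \<bar>u n\<bar>)"
        by (intro tendsto_mult tendsto_const summable_LIMSEQ s)
      moreover have "(\<lambda>m. norm (\<Sum>k<m. u k *\<^sub>R y k)) \<longlonglongrightarrow> norm (T u)"
        unfolding T_def by (intro tendsto_norm summable_LIMSEQ summ u)
      ultimately show "(b - a) / 2 * (\<Sum>n. \<bar>u n\<bar>) \<le> norm (T u)"
        by (rule LIMSEQ_le) (use lower in auto)
      have "norm (T u) \<le> (\<Sum>n. norm (u n *\<^sub>R y n))"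
        unfolding T_def by (rule summable_norm[OF sum_abs[OF u]])
      also have "\<dots> \<le> (\<Sum>n. C * \<bar>u n\<bar>)"
        by (rule suminf_le[OF _ sum_abs[OF u] summable_mult[OF s]])
          (use mult_right_mono[OF yC abs_ge_zero] in \<open>simp add: mult.commute\<close>)
      finally show "norm (T u) \<le> C * (\<Sum>n. \<bar>u n\<bar>)" by (simp add: suminf_mult s)
    qed
    then show "\<exists>c>0. \<exists>C. \<forall>u\<in>ell1. c * (\<Sum>n. \<bar>u n\<bar>) \<le> norm (T u) \<and> norm (T u) \<le> C * (\<Sum>n. \<bar>u n\<bar>)"
      using e(2) by (intro exI[of _ "(b - a) / 2"] exI[of _ C]) auto
  qed
  with no_ell1 show False by blast
qed

section \<open>The Hahn--Banach theorem\<close>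

definition sublinear :: "('a::real_vector \<Rightarrow> real) \<Rightarrow> bool" where
  "sublinear p \<longleftrightarrow> (\<forall>x y. p (x + y) \<le> p x + p y) \<and> (\<forall>c x. 0 \<le> c \<longrightarrow> p (c *\<^sub>R x) = c * p x)"

lemma sublinear_zero: "sublinear p \<Longrightarrow> p 0 = 0"
  unfolding sublinear_def by (metis mult_zero_left order_refl scaleR_zero_left)

lemma sublinear_neg: "sublinear p \<Longrightarrow> - p (- x) \<le> p x"
  using sublinear_zero[of p] unfolding sublinear_def by (metis add.right_inverse add_increasing
      diff_ge_0_iff_ge minus_le_iff neg_le_iff_le order_refl diff_minus_eq_add minus_diff_eq)

text \<open>\<open>q\<close> is \<open>p\<close> lowered along \<open>y\<close> so that any linear
  functional below \<open>q\<close> is at most \<open>- p y\<close> at \<open>- y\<close>, hence at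
  least \<open>p y\<close> at \<open>y\<close>. This gives the norming property in the Hahn--Banach
  theorem.\<close>

lemma sublinear_lower_slope:
  fixes p :: "'a::real_vector \<Rightarrow> real" and y :: 'a
  assumes p: "sublinear p"
  defines "q \<equiv> \<lambda>x. INF t\<in>{0..}. p (x + t *\<^sub>R y) - t * p y"
  shows "sublinear q" "\<And>x. q x \<le> p x" "q (- y) \<le> - p y"
    "\<And>x t. 0 \<le> t \<Longrightarrow> q x \<le> p (x + t *\<^sub>R y) - t * p y"
proof -
  have add: "p (u + v) \<le> p u + p v" and hom: "0 \<le> c \<Longrightarrow> p (c *\<^sub>R u) = c * p u" for u v c
    using p by (auto simp: sublinear_def)
  have low: "- p (- x) \<le> p (x + t *\<^sub>R y) - t * p y" if "0 \<le> t" for x t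
    using add[of "x + t *\<^sub>R y" "- x"] hom[OF that, of y] by simp
  have bdd: "bdd_below ((\<lambda>t. p (x + t *\<^sub>R y) - t * p y) ` {0..})" for x
    using low by (intro bdd_belowI[of _ "- p (- x)"]) auto
  show le: "q x \<le> p (x + t *\<^sub>R y) - t * p y" if "0 \<le> t" for x t
    unfolding q_def using that by (intro cINF_lower bdd) auto
  have ge: "c \<le> q x" if "\<And>t. 0 \<le> t \<Longrightarrow> c \<le> p (x + t *\<^sub>R y) - t * p y" for c x
    unfolding q_def using that by (intro cINF_greatest) auto
  show "q x \<le> p x" for x using le[of 0 x] by simp
  show "q (- y) \<le> - p y" using le[of 1 "- y"] sublinear_zero[OF p] by simp
  show "sublinear q"
    unfolding sublinear_def
  proof (intro conjI allI impI)
    fix u v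
    have "q (u + v) - (p (u + t *\<^sub>R y) - t * p y) \<le> q v" if t: "0 \<le> t" for t
    proof (rule ge)
      fix s :: real assume s: "0 \<le> s"
      have "q (u + v) \<le> p (u + v + (t + s) *\<^sub>R y) - (t + s) * p y" using s t by (intro le) simp
      also have "u + v + (t + s) *\<^sub>R y = (u + t *\<^sub>R y) + (v + s *\<^sub>R y)" by (simp add: algebra_simps)
      also have "p \<dots> \<le> p (u + t *\<^sub>R y) + p (v + s *\<^sub>R y)" by (rule add)
      finally show "q (u + v) - (p (u + t *\<^sub>R y) - t * p y) \<le> p (v + s *\<^sub>R y) - s * p y"
        by (simp add: algebra_simps)
    qed
    then have "q (u + v) - q v \<le> q u" by (intro ge) (simp add: algebra_simps)
    then show "q (u + v) \<le> q u + q v" by simp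
  next
    fix c :: real and x assume "0 \<le> c"
    then consider "c = 0" | "c > 0" by linarith
    then show "q (c *\<^sub>R x) = c * q x"
    proof cases
      case 1
      have "q 0 \<le> 0" using le[of 0 0] sublinear_zero[OF p] by simp
      moreover have "0 \<le> q 0" by (rule ge) (simp add: hom)
      ultimately show ?thesis using 1 by simp
    next
      case 2
      have 3: "c * q x \<le> q (c *\<^sub>R x)" if "c > 0" for c x
      proof (rule ge)
        fix t :: real assume "0 \<le> t"
        then have "q x \<le> p (x + (t / c) *\<^sub>R y) - t / c * p y" using that by (intro le) simp
        then have "c * q x \<le> c * (p (x + (t / c) *\<^sub>R y) - t / c * p y)"
          using that by (intro mult_left_mono) auto
        also have "\<dots> = p (c *\<^sub>R (x + (t / c) *\<^sub>R y)) - t * p y"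
          using that by (simp add: hom right_diff_distrib)
        also have "c *\<^sub>R (x + (t / c) *\<^sub>R y) = c *\<^sub>R x + t *\<^sub>R y"
          using that by (simp add: scaleR_add_right)
        finally show "c * q x \<le> p (c *\<^sub>R x + t *\<^sub>R y) - t * p y" .
      qed
      from 3[of "inverse c" "c *\<^sub>R x"] 2 have "q (c *\<^sub>R x) \<le> c * q x"
        by (simp add: field_simps)
      with 3[OF 2, of x] show ?thesis by simp
    qed
  qed
qed

text \<open>Lowering a minimal functional along \<open>y\<close> changes nothing, and this is superadditivity.\<close>

lemma sublinear_minimal_linear:
  fixes p :: "'a::real_vector \<Rightarrow> real"
  assumes p: "sublinear p" and min: "\<And>q. sublinear q \<Longrightarrow> (\<And>x. q x \<le> p x) \<Longrightarrow> q = p"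
  shows "linear p"
proof -
  have hom: "p (c *\<^sub>R x) = c * p x" if "0 \<le> c" for c x using p that by (simp add: sublinear_def)
  have "p x + p y \<le> p (x + y)" for x y
  proof -
    have "(\<lambda>x. INF t\<in>{0..}. p (x + t *\<^sub>R y) - t * p y) = p"
      by (intro min sublinear_lower_slope p)
    from sublinear_lower_slope(4)[OF p, where y=y and x=x and t=1, unfolded fun_cong[OF this]] show ?thesis by simp
  qed
  then have add: "p (x + y) = p x + p y" for x y
    using p by (auto simp: sublinear_def intro: antisym)
  have neg: "p (- x) = - p x" for x
    using add[of x "- x"] sublinear_zero[OF p] by simp
  show ?thesis
  proof (rule linearI)
    show "p (c *\<^sub>R x) = c *\<^sub>R p x" for c x
      using hom[of c x] hom[of "- c" x] neg[of "c *\<^sub>R x"] by (cases "0 \<le> c") auto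
  qed (rule add)
qed

text \<open>Zorn's lemma yields a minimal sublinear functional below \<open>p\<close>. A chain has a
  finite pointwise infimum, since \<open>- p (- x)\<close> bounds every member from below.\<close>

lemma sublinear_dominates_linear:
  fixes p :: "'a::real_vector \<Rightarrow> real"
  assumes p: "sublinear p"
  shows "\<exists>f. linear f \<and> (\<forall>x. f x \<le> p x)"
proof -
  define S where "S = {q. sublinear q \<and> (\<forall>x. q x \<le> p x)}"
  have "\<exists>m\<in>S. \<forall>q\<in>S. (\<forall>x. q x \<le> m x) \<longrightarrow> q = m"
  proof (rule predicate_Zorn)
    show "partial_order_on S (relation_of (\<lambda>m q. \<forall>x. q x \<le> m x) S)"
      by (rule partial_order_on_relation_ofI) (blast intro: order_trans antisym ext)+
  next
    fix C assume C: "C \<in> Chains (relation_of (\<lambda>m q. \<forall>x. q x \<le> m x) S)"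
    show "\<exists>u\<in>S. \<forall>a\<in>C. \<forall>x. u x \<le> a x"
    proof (cases "C = {}")
      case True
      then show ?thesis using p by (auto simp: S_def intro!: exI[of _ p])
    next
      case False
      have CS: "C \<subseteq> S" and chain: "\<And>q q'. q \<in> C \<Longrightarrow> q' \<in> C \<Longrightarrow> (\<forall>x. q x \<le> q' x) \<or> (\<forall>x. q' x \<le> q x)"
        using C by (fastforce simp: Chains_def relation_of_def)+
      have sub: "sublinear q" "q x \<le> p x" if "q \<in> C" for q x
        using CS that by (auto simp: S_def)
      define u where "u x = (INF q\<in>C. q x)" for x
      have "- p (- x) \<le> q x" if "q \<in> C" for q x
        using sublinear_neg[OF sub(1)[OF that], of x] sub(2)[OF that, of "- x"] by linarith
      then have le: "u x \<le> q x" if "q \<in> C" for q x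
        unfolding u_def using that by (intro cINF_lower bdd_belowI[of _ "- p (- x)"]) auto
      have ge: "c \<le> u x" if "\<And>q. q \<in> C \<Longrightarrow> c \<le> q x" for c x
        unfolding u_def using that False by (intro cINF_greatest) auto
      have "sublinear u"
        unfolding sublinear_def
      proof (intro conjI allI impI)
        fix x y
        have "u (x + y) - q x \<le> u y" if q: "q \<in> C" for q
        proof (rule ge)
          fix q' assume q': "q' \<in> C"
          have "u (x + y) \<le> q (x + y)" "u (x + y) \<le> q' (x + y)" using le q q' by auto
          moreover have "q (x + y) \<le> q x + q y" "q' (x + y) \<le> q' x + q' y"
            using sub(1) q q' by (auto simp: sublinear_def)
          \<comment> \<open>Of two members of the chain one lies below the other, so a single one
            can estimate both summands.\<close>
          moreover have "q y \<le> q' y \<or> q' x \<le> q x" using chain[OF q q'] by blast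
          ultimately show "u (x + y) - q x \<le> q' y" by linarith
        qed
        then have "u (x + y) - u y \<le> u x" by (intro ge) (simp add: algebra_simps)
        then show "u (x + y) \<le> u x + u y" by simp
      next
        fix c :: real and x assume c: "0 \<le> c"
        have hom: "q (c *\<^sub>R x) = c * q x" if "q \<in> C" for q
          using sub(1)[OF that] c by (simp add: sublinear_def)
        show "u (c *\<^sub>R x) = c * u x"
        proof (cases "c = 0")
          case True
          have "q 0 = 0" if "q \<in> C" for q using sub(1)[OF that] by (rule sublinear_zero)
          then have "(INF q\<in>C. q 0) = (INF q\<in>C. 0)" by (intro INF_cong) auto
          then show ?thesis using True False by (simp add: u_def)
        next
          case c0: False
          with c have c0: "c > 0" by simp
          show ?thesis
          proof (rule antisym)
            have "u (c *\<^sub>R x) / c \<le> u x"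
            proof (rule ge)
              fix q assume q: "q \<in> C"
              show "u (c *\<^sub>R x) / c \<le> q x"
                using le[OF q, of "c *\<^sub>R x"] hom[OF q] c0 by (simp add: divide_le_eq mult.commute)
            qed
            then show "u (c *\<^sub>R x) \<le> c * u x" using c0 by (simp add: divide_le_eq mult.commute)
            show "c * u x \<le> u (c *\<^sub>R x)"
            proof (rule ge)
              fix q assume q: "q \<in> C"
              show "c * u x \<le> q (c *\<^sub>R x)" using mult_left_mono[OF le[OF q, of x] c] hom[OF q] by simp
            qed
          qed
        qed
      qed
      moreover have "u x \<le> p x" for x using False le sub(2) order_trans by blast
      ultimately show ?thesis using le by (auto simp: S_def intro!: bexI[of _ u])
    qed
  qed
  then obtain m where m: "m \<in> S" "\<And>q. q \<in> S \<Longrightarrow> (\<And>x. q x \<le> m x) \<Longrightarrow> q = m" by blast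
  have "linear m"
  proof (rule sublinear_minimal_linear)
    show "sublinear m" using m(1) by (simp add: S_def)
    fix q assume q: "sublinear q" "\<And>x. q x \<le> m x"
    then have "q \<in> S" using m(1) by (auto simp: S_def intro: order_trans)
    then show "q = m" using m(2) q(2) by blast
  qed
  then show ?thesis using m(1) by (auto simp: S_def)
qed

theorem Hahn_Banach_sublinear:
  fixes p :: "'a::real_vector \<Rightarrow> real"
  assumes p: "sublinear p"
  shows "\<exists>f. linear f \<and> (\<forall>x. f x \<le> p x) \<and> f y = p y"
proof -
  note q = sublinear_lower_slope[OF p, where y=y]
  obtain f where f: "linear f" "\<And>x. f x \<le> (INF t\<in>{0..}. p (x + t *\<^sub>R y) - t * p y)"
    using sublinear_dominates_linear[OF q(1)] by blast
  have le: "f x \<le> p x" for x using f(2) q(2) order_trans by blast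
  have "f (- y) \<le> - p y" using f(2) q(3) order_trans by blast
  then have "p y \<le> f y" using f(1) by (simp add: linear_neg)
  with le[of y] f(1) le show ?thesis by (intro exI[of _ f]) (auto intro: antisym)
qed

section \<open>Equivalent norms and their duals\<close>

lemma limsup_ereal_le_iff:
  fixes u :: "nat \<Rightarrow> real"
  shows "limsup (\<lambda>n. ereal (u n)) \<le> ereal c \<longleftrightarrow> (\<forall>e>0. \<forall>\<^sub>F n in sequentially. u n < c + e)"
  unfolding Limsup_le_iff
proof (intro iffI allI impI)
  fix e :: real assume "\<forall>y>ereal c. \<forall>\<^sub>F n in sequentially. ereal (u n) < y" "0 < e"
  from this(1)[rule_format, of "ereal (c + e)"] this(2)
  show "\<forall>\<^sub>F n in sequentially. u n < c + e" by simp
next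
  fix y assume *: "\<forall>e>0. \<forall>\<^sub>F n in sequentially. u n < c + e" and y: "ereal c < y"
  then obtain r where r: "ereal c < ereal r" "ereal r < y" using ereal_dense2 by blast
  then have "\<forall>\<^sub>F n in sequentially. u n < c + (r - c)" by (intro *[rule_format]) simp
  then show "\<forall>\<^sub>F n in sequentially. ereal (u n) < y"
    by eventually_elim (use r in \<open>auto intro: less_trans[of _ "ereal r"]\<close>)
qed

lemma le_liminf_ereal_iff:
  fixes u :: "nat \<Rightarrow> real"
  shows "ereal c \<le> liminf (\<lambda>n. ereal (u n)) \<longleftrightarrow> (\<forall>e>0. \<forall>\<^sub>F n in sequentially. c - e < u n)"
  unfolding le_Liminf_iff
proof (intro iffI allI impI)
  fix e :: real assume "\<forall>y<ereal c. \<forall>\<^sub>F n in sequentially. y < ereal (u n)" "0 < e"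
  from this(1)[rule_format, of "ereal (c - e)"] this(2)
  show "\<forall>\<^sub>F n in sequentially. c - e < u n" by simp
next
  fix y assume *: "\<forall>e>0. \<forall>\<^sub>F n in sequentially. c - e < u n" and y: "y < ereal c"
  then obtain r where r: "y < ereal r" "ereal r < ereal c" using ereal_dense2 by blast
  then have "\<forall>\<^sub>F n in sequentially. c - (c - r) < u n" by (intro *[rule_format]) simp
  then show "\<forall>\<^sub>F n in sequentially. y < ereal (u n)"
    by eventually_elim (use r in \<open>auto intro: less_trans[of _ "ereal r"]\<close>)
qed

lemma is_norm_norm: "is_norm (norm :: 'a::real_normed_vector \<Rightarrow> real)"
  by (simp add: is_norm_def norm_triangle_ineq)

lemma sublinear_is_norm: "is_norm N \<Longrightarrow> sublinear N"
  by (auto simp: is_norm_def sublinear_def)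

lemma is_normD:
  assumes "is_norm N"
  shows "N 0 = 0" "N x = 0 \<longleftrightarrow> x = 0" "N (x + y) \<le> N x + N y" "N (c *\<^sub>R x) = \<bar>c\<bar> * N x" "0 \<le> N x"
proof -
  show zero: "N 0 = 0" and "N x = 0 \<longleftrightarrow> x = 0" and tri: "N (x + y) \<le> N x + N y"
    and scale: "N (c *\<^sub>R x) = \<bar>c\<bar> * N x" for x y c
    using assms unfolding is_norm_def by blast+
  show "0 \<le> N x" using tri[of x "- x"] scale[of "-1" x] zero by simp
qed

text \<open>Equivalence to the given norm fixes the dual and with it weak and weak* nullness, so
  passing to another \<open>N\<close> changes only the norm and the dual norm in \<open>rho\<close>
  and \<open>theta\<close>.\<close>

locale equivalent_norm =
  fixes N :: "'a::real_normed_vector \<Rightarrow> real"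
  assumes norm: "is_norm N"
    and lower: "\<exists>c>0. \<forall>x. c * norm x \<le> N x"
    and upper: "\<exists>C. \<forall>x. N x \<le> C * norm x"
begin

lemma eq_0_iff: "N x = 0 \<longleftrightarrow> x = 0" and triangle: "N (x + y) \<le> N x + N y"
  and scale: "N (a *\<^sub>R x) = \<bar>a\<bar> * N x" and zero [simp]: "N 0 = 0" and nonneg [simp]: "0 \<le> N x"
  by (rule is_normD[OF norm])+

lemma minus [simp]: "N (- x) = N x" using scale[of "-1" x] by simp

lemma pos: "x \<noteq> 0 \<Longrightarrow> 0 < N x" using nonneg[of x] eq_0_iff[of x] by linarith

lemma triangle_diff: "N (x - y) \<le> N x + N y" using triangle[of x "- y"] by simp

lemma unit_vector: "x \<noteq> 0 \<Longrightarrow> N (x /\<^sub>R N x) = 1"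
  using pos[of x] by (simp add: scale)

lemma dual_eq: "dual N = {f. bounded_linear f}"
proof (intro equalityI subsetI CollectI)
  fix f assume "f \<in> dual N"
  then obtain K where f: "linear f" "\<And>x. \<bar>f x\<bar> \<le> K * N x" by (auto simp: dual_def bounded_lin_def)
  obtain C where C: "\<And>x. N x \<le> C * norm x" using upper by blast
  have "norm (f x) \<le> norm x * (\<bar>K\<bar> * C)" for x
  proof -
    have "\<bar>f x\<bar> \<le> \<bar>K\<bar> * N x" using f(2)[of x] mult_right_mono[OF abs_ge_self[of K] nonneg[of x]] by linarith
    also have "\<dots> \<le> \<bar>K\<bar> * (C * norm x)" using C by (intro mult_left_mono) auto
    finally show ?thesis by (simp add: mult_ac)
  qed
  with f(1) show "bounded_linear f"
    by (intro bounded_linear_intro) (auto simp: linear_add linear_scale)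
next
  fix f :: "'a \<Rightarrow> real" assume "f \<in> {f. bounded_linear f}"
  then interpret bounded_linear f by simp
  obtain B where B: "B > 0" "\<And>x. norm (f x) \<le> norm x * B" using pos_bounded by blast
  obtain c where c: "c > 0" "\<And>x. c * norm x \<le> N x" using lower by blast
  have "\<bar>f x\<bar> \<le> B / c * N x" for x
  proof -
    have "\<bar>f x\<bar> \<le> B / c * (c * norm x)" using B(2)[of x] c(1) by (simp add: mult_ac)
    also have "\<dots> \<le> B / c * N x" using B(1) c by (intro mult_left_mono) auto
    finally show ?thesis .
  qed
  then show "f \<in> dual N" unfolding dual_def bounded_lin_def using linear_axioms by blast
qed

lemma weakly_null_iff: "weakly_null N xs \<longleftrightarrow> (\<forall>f :: 'a \<Rightarrow> real. bounded_linear f \<longrightarrow> (\<lambda>n. f (xs n)) \<longlonglongrightarrow> 0)"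
  by (simp add: weakly_null_def dual_eq)

lemma weak_star_null_iff:
  "weak_star_null N fs \<longleftrightarrow> (\<forall>n. bounded_linear (fs n)) \<and> (\<forall>x. (\<lambda>n. fs n x) \<longlonglongrightarrow> 0)"
  by (simp add: weak_star_null_def dual_eq)

lemma dual_norm_le: "dual_norm N f \<le> b" if "\<And>x. N x \<le> 1 \<Longrightarrow> \<bar>f x\<bar> \<le> b"
proof -
  have "{x. N x \<le> 1} \<noteq> {}" by (auto intro!: exI[of _ 0])
  then show ?thesis
    unfolding dual_norm_def opnorm_def using that by (intro cSUP_least) auto
qed

lemma dual_norm_ge: "\<bar>f x\<bar> \<le> dual_norm N f * N x" if f: "bounded_linear f"
proof (cases "x = 0")
  case True
  then show ?thesis using f by (simp add: bounded_linear.linear linear_0)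
next
  case False
  interpret bounded_linear f by fact
  obtain K where K: "\<And>x. \<bar>f x\<bar> \<le> K * N x"
    using f dual_eq by (auto simp: dual_def bounded_lin_def)
  have "\<bar>f x\<bar> \<le> \<bar>K\<bar>" if "N x \<le> 1" for x
  proof -
    have "\<bar>f x\<bar> \<le> \<bar>K\<bar> * N x" using K[of x] mult_right_mono[OF abs_ge_self[of K] nonneg[of x]] by linarith
    also have "\<dots> \<le> \<bar>K\<bar> * 1" using that by (intro mult_left_mono) auto
    finally show ?thesis by simp
  qed
  then have "\<bar>f (x /\<^sub>R N x)\<bar> \<le> dual_norm N f"
    unfolding dual_norm_def opnorm_def
    by (intro cSUP_upper bdd_aboveI[of _ "\<bar>K\<bar>"]) (auto simp: unit_vector[OF False])
  then show ?thesis using pos[OF False] by (simp add: scaleR abs_mult field_simps)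
qed

lemma dual_norm_nonneg: "bounded_linear f \<Longrightarrow> 0 \<le> dual_norm N f"
  using dual_norm_ge[of f 0] nonneg unfolding dual_norm_def opnorm_def
proof -
  assume f: "bounded_linear f"
  show "0 \<le> (SUP x\<in>{x. N x \<le> 1}. \<bar>f x\<bar>)"
  proof (rule cSUP_upper2[of _ _ 0])
    show "bdd_above ((\<lambda>x. \<bar>f x\<bar>) ` {x. N x \<le> 1})"
    proof (rule bdd_aboveI2)
      fix x assume "x \<in> {x. N x \<le> 1}"
      then have "dual_norm N f * N x \<le> \<bar>dual_norm N f\<bar> * 1" by (intro mult_mono) auto
      then show "\<bar>f x\<bar> \<le> \<bar>dual_norm N f\<bar>" using dual_norm_ge[OF f, of x] by simp
    qed
  qed auto
qed

lemma dual_norm_le_iff: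
  assumes f: "bounded_linear f" and b: "0 \<le> b"
  shows "dual_norm N f \<le> b \<longleftrightarrow> (\<forall>x. \<bar>f x\<bar> \<le> b * N x)"
proof
  assume "dual_norm N f \<le> b"
  then show "\<forall>x. \<bar>f x\<bar> \<le> b * N x"
    using dual_norm_ge[OF f] mult_right_mono[OF _ nonneg] order_trans by blast
next
  assume *: "\<forall>x. \<bar>f x\<bar> \<le> b * N x"
  show "dual_norm N f \<le> b"
  proof (rule dual_norm_le)
    fix x assume "N x \<le> 1"
    then have "b * N x \<le> b * 1" using b by (intro mult_left_mono) auto
    then show "\<bar>f x\<bar> \<le> b" using *[rule_format, of x] by simp
  qed
qed

lemma dual_norm_triangle:
  assumes "bounded_linear f" "bounded_linear g"
  shows "dual_norm N (\<lambda>x. f x + g x) \<le> dual_norm N f + dual_norm N g"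
proof -
  have "\<bar>f x + g x\<bar> \<le> (dual_norm N f + dual_norm N g) * N x" for x
    using abs_triangle_ineq[of "f x" "g x"] dual_norm_ge[OF assms(1), of x] dual_norm_ge[OF assms(2), of x]
    by (simp add: distrib_right)
  then show ?thesis
    using dual_norm_le_iff[OF bounded_linear_add[OF assms]] dual_norm_nonneg assms by auto
qed

lemma dual_norm_scale:
  assumes f: "bounded_linear f"
  shows "dual_norm N (\<lambda>x. a * f x) = \<bar>a\<bar> * dual_norm N f"
proof -
  have le: "dual_norm N (\<lambda>x. a * g x) \<le> \<bar>a\<bar> * dual_norm N g" if g: "bounded_linear g" for a g
  proof -
    have "\<bar>a * g x\<bar> \<le> \<bar>a\<bar> * dual_norm N g * N x" for x
      using mult_left_mono[OF dual_norm_ge[OF g, of x] abs_ge_zero[of a]] by (simp add: abs_mult mult_ac)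
    then show ?thesis
      using dual_norm_le_iff[OF bounded_linear_const_mult[OF g]] dual_norm_nonneg[OF g] by auto
  qed
  show ?thesis
  proof (cases "a = 0")
    case True
    then show ?thesis using le[OF f, of a] dual_norm_nonneg[OF bounded_linear_const_mult[OF f, of a]] by simp
  next
    case False
    have "dual_norm N f \<le> \<bar>inverse a\<bar> * dual_norm N (\<lambda>x. a * f x)"
      using le[OF bounded_linear_const_mult[OF f, of a], of "inverse a"] False
      by (simp flip: mult.assoc)
    then show ?thesis using le[OF f, of a] False by (simp add: field_simps)
  qed
qed

lemma dual_norm_minus: "bounded_linear f \<Longrightarrow> dual_norm N (\<lambda>x. - f x) = dual_norm N f"
  using dual_norm_scale[of f "-1"] by simp

lemma dual_norm_triangle_diff:
  assumes "bounded_linear f" "bounded_linear g"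
  shows "dual_norm N (\<lambda>x. f x - g x) \<le> dual_norm N f + dual_norm N g"
  using dual_norm_triangle[OF assms(1) bounded_linear_minus[OF assms(2)]] dual_norm_minus[OF assms(2)] by simp

lemma dual_norm_pos:
  assumes f: "bounded_linear f" and x: "f x \<noteq> 0"
  shows "0 < dual_norm N f"
proof -
  have "0 < dual_norm N f * N x" using dual_norm_ge[OF f, of x] x by linarith
  then show ?thesis using nonneg[of x] by (simp add: zero_less_mult_iff)
qed

lemma dual_norm_almost_attained:
  assumes f: "bounded_linear f" and e: "0 < e"
  shows "\<exists>x. N x \<le> 1 \<and> dual_norm N f - e < f x"
proof (rule ccontr)
  assume *: "\<nexists>x. N x \<le> 1 \<and> dual_norm N f - e < f x"
  then have le: "f x \<le> dual_norm N f - e" if "N x \<le> 1" for x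
    using that by (auto simp: not_less)
  have "dual_norm N f \<le> dual_norm N f - e"
  proof (rule dual_norm_le)
    fix x assume "N x \<le> 1"
    moreover have "f (- x) = - f x" using f by (simp add: bounded_linear.linear linear_neg)
    ultimately have "f x \<le> dual_norm N f - e" "- f x \<le> dual_norm N f - e"
      using le[of x] le[of "- x"] by auto
    then show "\<bar>f x\<bar> \<le> dual_norm N f - e" by linarith
  qed
  with e show False by simp
qed

text \<open>Normalizing a near-maximizer with positive value does not decrease the value. Unit
  vectors are what \<open>rho\<close> tests.\<close>

lemma dual_norm_almost_attained_sphere:
  assumes f: "bounded_linear f" and e: "0 < e" and pos_f: "0 < dual_norm N f"
  shows "\<exists>x. N x = 1 \<and> dual_norm N f - e < f x"
proof -
  obtain x where x: "N x \<le> 1" "dual_norm N f - min e (dual_norm N f) < f x"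
    using dual_norm_almost_attained[OF f, of "min e (dual_norm N f)"] e pos_f by auto
  then have fx: "0 < f x" by (auto simp: min_def split: if_splits)
  then have x0: "x \<noteq> 0" using f by (auto simp: bounded_linear.linear linear_0)
  interpret bounded_linear f by fact
  have "f x \<le> f (x /\<^sub>R N x)" using fx x(1) pos[OF x0] by (simp add: scaleR field_simps)
  then show ?thesis using x unit_vector[OF x0] by (intro exI[of _ "x /\<^sub>R N x"]) auto
qed

lemma norming_functional:
  "\<exists>f. bounded_linear f \<and> (\<forall>y. \<bar>f y\<bar> \<le> N y) \<and> f x = N x"
proof -
  obtain f where f: "linear f" "\<And>y. f y \<le> N y" "f x = N x"
    using Hahn_Banach_sublinear[OF sublinear_is_norm[OF norm]] by blast
  have le: "\<bar>f y\<bar> \<le> N y" for y using f(2)[of y] f(2)[of "- y"] linear_neg[OF f(1), of y] by simp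
  then have "f \<in> dual N" using f(1) by (auto simp: dual_def bounded_lin_def intro!: exI[of _ 1])
  then show ?thesis using le f(3) by (auto simp: dual_eq)
qed

lemma dual_norm_lower_semicontinuous:
  assumes f: "bounded_linear f" and fs: "\<And>n. bounded_linear (fs n)"
    "\<And>x. (\<lambda>n. fs n x) \<longlonglongrightarrow> 0" and e: "0 < e"
  shows "\<forall>\<^sub>F n in sequentially. dual_norm N f - e < dual_norm N (\<lambda>x. f x + fs n x)"
proof -
  obtain x where x: "N x \<le> 1" "dual_norm N f - e / 2 < f x"
    using dual_norm_almost_attained[OF f, of "e / 2"] e by auto
  have "\<forall>\<^sub>F n in sequentially. dist (fs n x) 0 < e / 2" using fs(2)[of x] e by (intro tendstoD) auto
  then show ?thesis
  proof eventually_elim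
    case (elim n)
    have bl: "bounded_linear (\<lambda>x. f x + fs n x)" using f fs by (intro bounded_linear_add)
    have "dual_norm N (\<lambda>x. f x + fs n x) * N x \<le> dual_norm N (\<lambda>x. f x + fs n x) * 1"
      using x(1) dual_norm_nonneg[OF bl] by (intro mult_left_mono)
    then have "f x + fs n x \<le> dual_norm N (\<lambda>x. f x + fs n x)"
      using dual_norm_ge[OF bl, of x] by linarith
    then show ?case using elim x(2) by (simp add: dist_real_def abs_if split: if_splits)
  qed
qed

end

section \<open>Annihilating functionals and limits tested on dense sets\<close>

text \<open>Hahn--Banach with the distance to \<open>V\<close> as the sublinear functional: it
  vanishes exactly on the closed set \<open>V\<close>, so a functional below it that agrees with it
  at \<open>x\<close> annihilates \<open>V\<close> but not \<open>x\<close>.\<close>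

lemma functional_vanishing_on_closed_subspace:
  fixes x :: "'a::real_normed_vector"
  assumes V: "subspace V" "closed V" and x: "x \<notin> V"
  shows "\<exists>f :: 'a \<Rightarrow> real. bounded_linear f \<and> (\<forall>v\<in>V. f v = 0) \<and> f x \<noteq> 0"
proof -
  have ne: "V \<noteq> {}" and 0: "0 \<in> V" using subspace_0[OF V(1)] by auto
  define p where "p y = infdist y V" for y
  have le: "p y \<le> norm (y - v)" if "v \<in> V" for y v
    using infdist_le[OF that, of y] by (simp add: p_def dist_norm)
  have ge: "c \<le> p y" if "\<And>v. v \<in> V \<Longrightarrow> c \<le> norm (y - v)" for c y
    unfolding p_def infdist_notempty[OF ne] dist_norm using that ne by (intro cINF_greatest)
  have "sublinear p"
    unfolding sublinear_def
  proof (intro conjI allI impI)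
    fix u v
    have "p (u + v) - norm (u - a) \<le> p v" if a: "a \<in> V" for a
    proof (rule ge)
      fix b assume b: "b \<in> V"
      have "p (u + v) \<le> norm (u + v - (a + b))" using V a b by (intro le subspace_add)
      also have "u + v - (a + b) = (u - a) + (v - b)" by simp
      also have "norm \<dots> \<le> norm (u - a) + norm (v - b)" by (rule norm_triangle_ineq)
      finally show "p (u + v) - norm (u - a) \<le> norm (v - b)" by simp
    qed
    then have "p (u + v) - p v \<le> p u" by (intro ge) (simp add: algebra_simps)
    then show "p (u + v) \<le> p u + p v" by simp
  next
    fix c :: real and u assume "0 \<le> c"
    then consider "c = 0" | "c > 0" by linarith
    then show "p (c *\<^sub>R u) = c * p u"
    proof cases
      case 1
      then show ?thesis using 0 by (simp add: p_def)
    next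
      case 2
      have *: "c * p u \<le> p (c *\<^sub>R u)" if "c > 0" for c u
      proof (rule ge)
        fix v assume "v \<in> V"
        then have "p u \<le> norm (u - v /\<^sub>R c)" using V by (intro le subspace_scale)
        then have "c * p u \<le> norm (c *\<^sub>R (u - v /\<^sub>R c))" using that by simp
        then show "c * p u \<le> norm (c *\<^sub>R u - v)" using that by (simp add: scaleR_diff_right)
      qed
      from *[of "inverse c" "c *\<^sub>R u"] 2 have "p (c *\<^sub>R u) \<le> c * p u" by (simp add: field_simps)
      with *[OF 2, of u] show ?thesis by simp
    qed
  qed
  from Hahn_Banach_sublinear[OF this]
  obtain f where f: "linear f" "\<And>y. f y \<le> p y" "f x = p x" by blast
  have fneg: "f (- y) = - f y" for y using linear_neg[OF f(1)] by simp
  have f_le: "\<bar>f y\<bar> \<le> norm y" for y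
  proof -
    have "f y \<le> norm y" "f (- y) \<le> norm y" using f(2)[of y] f(2)[of "- y"] le[OF 0, of y] le[OF 0, of "- y"] by auto
    then show ?thesis using fneg[of y] by auto
  qed
  have "bounded_linear f"
    using f(1) f_le by (intro bounded_linear_intro[where K = 1]) (auto simp: linear_add linear_scale)
  moreover have "f v = 0" if "v \<in> V" for v
  proof -
    have "- v \<in> V" using V that by (simp add: subspace_neg)
    then have "f v \<le> 0" "f (- v) \<le> 0" using f(2)[of v] f(2)[of "- v"] that by (auto simp: p_def)
    then show ?thesis using fneg[of v] by simp
  qed
  moreover have "f x \<noteq> 0"
    using f(3) x V(2) ne in_closed_iff_infdist_zero[of V x] by (simp add: p_def)
  ultimately show ?thesis by blast
qed

text \<open>The span enlarged by \<open>x\<close> is the preimage of the old closed span under the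
  continuous map \<open>y - (f y / f x) *\<^sub>R x\<close>, where \<open>f\<close> annihilates the
  old span but not \<open>x\<close>.\<close>

lemma closed_span_finite:
  fixes B :: "'a::real_normed_vector set"
  assumes "finite B"
  shows "closed (span B)"
  using assms
proof (induction B rule: finite_induct)
  case (insert x B)
  show ?case
  proof (cases "x \<in> span B")
    case True
    then show ?thesis using insert.IH by (simp add: span_redundant)
  next
    case False
    obtain f :: "'a \<Rightarrow> real" where f: "bounded_linear f" "\<And>v. v \<in> span B \<Longrightarrow> f v = 0" "f x \<noteq> 0"
      using functional_vanishing_on_closed_subspace[OF subspace_span insert.IH False] by blast
    interpret bounded_linear f by fact
    have "span (insert x B) = (\<lambda>y. y - (f y / f x) *\<^sub>R x) -` span B"
    proof (intro equalityI subsetI)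
      fix y assume "y \<in> span (insert x B)"
      then obtain k where k: "y - k *\<^sub>R x \<in> span B" by (auto simp: span_insert)
      then have "f y = k * f x" using f(2)[OF k] by (simp add: diff scaleR)
      then show "y \<in> (\<lambda>y. y - (f y / f x) *\<^sub>R x) -` span B" using k f(3) by simp
    qed (auto simp: span_insert)
    moreover have "continuous_on UNIV (\<lambda>y. y - (f y / f x) *\<^sub>R x)"
      by (intro continuous_intros linear_continuous_on f(1)) (use f(3) in auto)
    ultimately show ?thesis using insert.IH by (simp add: closed_vimage)
  qed
qed simp

lemma tendsto_0_from_dense:
  fixes fs :: "nat \<Rightarrow> 'a::real_normed_vector \<Rightarrow> real"
  assumes lin: "\<And>n. bounded_linear (fs n)" and bdd: "\<And>n x. \<bar>fs n x\<bar> \<le> B * norm x"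
    and D: "closure D = UNIV" and conv: "\<And>d. d \<in> D \<Longrightarrow> (\<lambda>n. fs n d) \<longlonglongrightarrow> 0"
  shows "(\<lambda>n. fs n x) \<longlonglongrightarrow> 0"
proof (rule tendstoI)
  fix e :: real assume e: "0 < e"
  define \<delta> where "\<delta> = e / (2 * (\<bar>B\<bar> + 1))"
  have \<delta>: "\<delta> > 0" using e by (simp add: \<delta>_def)
  obtain d where d: "d \<in> D" "dist d x < \<delta>"
    using D \<delta> by (metis UNIV_I closure_approachable)
  have "\<forall>\<^sub>F n in sequentially. dist (fs n d) 0 < e / 2" using conv[OF d(1)] e by (intro tendstoD) auto
  then show "\<forall>\<^sub>F n in sequentially. dist (fs n x) 0 < e"
  proof eventually_elim
    case (elim n)
    have "fs n x = fs n d + fs n (x - d)" using lin[of n] by (simp add: linear_simps)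
    moreover have "\<bar>fs n (x - d)\<bar> \<le> \<bar>B\<bar> * norm (x - d)"
      using bdd[of n "x - d"] mult_right_mono[OF abs_ge_self[of B] norm_ge_zero[of "x - d"]] by linarith
    moreover have "\<bar>B\<bar> * norm (x - d) \<le> (\<bar>B\<bar> + 1) * \<delta>"
      using d(2) \<delta> by (intro mult_mono) (auto simp: dist_norm norm_minus_commute)
    moreover have "(\<bar>B\<bar> + 1) * \<delta> = e / 2" by (simp add: \<delta>_def field_simps)
    ultimately show ?case using elim by simp
  qed
qed

lemma convergent_from_dense:
  fixes fs :: "nat \<Rightarrow> 'a::real_normed_vector \<Rightarrow> real"
  assumes lin: "\<And>n. bounded_linear (fs n)" and bdd: "\<And>n x. \<bar>fs n x\<bar> \<le> B * norm x"
    and D: "closure D = UNIV" and conv: "\<And>d. d \<in> D \<Longrightarrow> convergent (\<lambda>n. fs n d)"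
  shows "convergent (\<lambda>n. fs n x)"
proof -
  have "Cauchy (\<lambda>n. fs n x)"
  proof (rule metric_CauchyI)
    fix e :: real assume e: "0 < e"
    define \<delta> where "\<delta> = e / (3 * (\<bar>B\<bar> + 1))"
    have \<delta>: "\<delta> > 0" using e by (simp add: \<delta>_def)
    obtain d where d: "d \<in> D" "dist d x < \<delta>"
      using D \<delta> by (metis UNIV_I closure_approachable)
    have small: "\<bar>fs n x - fs n d\<bar> \<le> e / 3" for n
    proof -
      have "fs n x - fs n d = fs n (x - d)" using lin[of n] by (simp add: linear_simps)
      moreover have "\<bar>fs n (x - d)\<bar> \<le> \<bar>B\<bar> * norm (x - d)"
        using bdd[of n "x - d"] mult_right_mono[OF abs_ge_self[of B] norm_ge_zero[of "x - d"]] by linarith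
      moreover have "\<bar>B\<bar> * norm (x - d) \<le> (\<bar>B\<bar> + 1) * \<delta>"
        using d(2) \<delta> by (intro mult_mono) (auto simp: dist_norm norm_minus_commute)
      moreover have "(\<bar>B\<bar> + 1) * \<delta> = e / 3" by (simp add: \<delta>_def field_simps)
      ultimately show ?thesis by linarith
    qed
    have "Cauchy (\<lambda>n. fs n d)" using conv[OF d(1)] by (rule convergent_Cauchy)
    then obtain M where M: "\<And>m n. m \<ge> M \<Longrightarrow> n \<ge> M \<Longrightarrow> dist (fs m d) (fs n d) < e / 3"
      using e metric_CauchyD[of _ "e / 3"] by (metis divide_pos_pos zero_less_numeral)
    have "dist (fs m x) (fs n x) < e" if "m \<ge> M" "n \<ge> M" for m n
      using M[OF that] small[of m] small[of n] unfolding dist_real_def by linarith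
    then show "\<exists>M. \<forall>m\<ge>M. \<forall>n\<ge>M. dist (fs m x) (fs n x) < e" by blast
  qed
  then show ?thesis by (rule Cauchy_convergent)
qed

section \<open>Separable spaces: weak* null sequences and weak* compactness\<close>

locale separable_norm = equivalent_norm N for N :: "'a::real_normed_vector \<Rightarrow> real" +
  assumes infinite_dim: "\<nexists>B :: 'a set. finite B \<and> span B = UNIV"
    and separable: "separable_space (euclidean :: 'a topology)"
begin

lemma dense_sequence: "\<exists>d :: nat \<Rightarrow> 'a. closure (range d) = UNIV"
proof -
  obtain C :: "'a set" where C: "countable C" "closure C = UNIV"
    using separable by (auto simp: separable_space_def)
  then have "C \<noteq> {}" by auto
  with C show ?thesis by (metis range_from_nat_into)
qed

text \<open>Separability makes the construction elementary: annihilate longer and longer pieces of a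
  dense sequence. Such sequences keep the condition in \<open>theta\<close> from being vacuous, so
  its supremum is taken over a set bounded above.\<close>

lemma Josefson_Nissenzweig:
  assumes "0 \<le> \<tau>"
  shows "\<exists>fs. weak_star_null N fs \<and> (\<forall>n. dual_norm N (fs n) = \<tau>)"
proof -
  obtain d :: "nat \<Rightarrow> 'a" where d: "closure (range d) = UNIV" using dense_sequence by blast
  have "\<exists>f :: 'a \<Rightarrow> real. bounded_linear f \<and> (\<forall>k<n. f (d k) = 0) \<and> dual_norm N f = \<tau>" for n
  proof -
    have "finite (d ` {..<n})" by simp
    then have "closed (span (d ` {..<n}))" by (rule closed_span_finite)
    moreover have "span (d ` {..<n}) \<noteq> UNIV" using infinite_dim by blast
    ultimately obtain x and f :: "'a \<Rightarrow> real" where f: "bounded_linear f"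
        "\<And>v. v \<in> span (d ` {..<n}) \<Longrightarrow> f v = 0" "f x \<noteq> 0"
      using functional_vanishing_on_closed_subspace[OF subspace_span] by blast
    have pos: "0 < dual_norm N f" using dual_norm_pos f by blast
    define g where "g = (\<lambda>y. \<tau> / dual_norm N f * f y)"
    have "bounded_linear g" unfolding g_def using f(1) by (rule bounded_linear_const_mult)
    moreover have "dual_norm N g = \<tau>"
      unfolding g_def dual_norm_scale[OF f(1)] using pos assms by simp
    moreover have "g (d k) = 0" if "k < n" for k
      using f(2)[of "d k"] that by (simp add: g_def span_base)
    ultimately show ?thesis by blast
  qed
  then obtain fs :: "nat \<Rightarrow> 'a \<Rightarrow> real" where fs: "\<And>n. bounded_linear (fs n)"
    "\<And>n k. k < n \<Longrightarrow> fs n (d k) = 0" "\<And>n. dual_norm N (fs n) = \<tau>"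
    by metis
  obtain C where C: "\<And>x. N x \<le> C * norm x" using upper by blast
  have "(\<lambda>n. fs n x) \<longlonglongrightarrow> 0" for x
  proof (rule tendsto_0_from_dense[OF fs(1) _ d])
    show "\<bar>fs n x\<bar> \<le> \<tau> * C * norm x" for n x
      using dual_norm_ge[OF fs(1), of n x] mult_left_mono[OF C[of x] assms] by (simp add: fs(3))
    fix v assume "v \<in> range d"
    then obtain k where "v = d k" by blast
    then have "\<forall>\<^sub>F n in sequentially. fs n v = 0"
      by (intro eventually_mono[OF eventually_gt_at_top[of k]]) (simp add: fs(2))
    then show "(\<lambda>n. fs n v) \<longlonglongrightarrow> 0" by (rule tendsto_eventually)
  qed
  then show ?thesis using fs by (auto simp: weak_star_null_iff)
qed

lemma unit_vector_exists: "\<exists>x. N x = 1"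
proof -
  have "\<exists>x :: 'a. x \<noteq> 0"
  proof (rule ccontr)
    assume "\<nexists>x :: 'a. x \<noteq> 0"
    then have "span {} = (UNIV :: 'a set)" by auto
    then show False using infinite_dim by blast
  qed
  then show ?thesis using unit_vector by blast
qed

lemma unit_functional_exists: "\<exists>f. bounded_linear f \<and> dual_norm N f = 1"
  using Josefson_Nissenzweig[of 1] by (auto simp: weak_star_null_iff)

lemma sequential_Banach_Alaoglu:
  fixes fs :: "nat \<Rightarrow> 'a \<Rightarrow> real"
  assumes lin: "\<And>n. bounded_linear (fs n)" and bdd: "\<And>n x. \<bar>fs n x\<bar> \<le> N x"
  shows "\<exists>(r :: nat \<Rightarrow> nat) h. strict_mono r \<and> bounded_linear h \<and> (\<forall>x. \<bar>h x\<bar> \<le> N x) \<and>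
    (\<forall>x. (\<lambda>n. fs (r n) x) \<longlonglongrightarrow> h x)"
proof -
  obtain d :: "nat \<Rightarrow> 'a" where d: "closure (range d) = UNIV" using dense_sequence by blast
  obtain C where C: "\<And>x. N x \<le> C * norm x" using upper by blast
  have Cb: "\<bar>fs n x\<bar> \<le> C * norm x" for n x using bdd C order_trans by blast
  have bound: "norm (fs n x / (1 + norm x)) \<le> \<bar>C\<bar>" for n x
  proof -
    have "\<bar>fs n x\<bar> \<le> \<bar>C\<bar> * (1 + norm x)"
      using Cb[of n x] mult_mono[OF abs_ge_self[of C], of "norm x" "1 + norm x"] by simp
    then show ?thesis by (simp add: abs_divide divide_le_eq add_pos_nonneg)
  qed
  \<comment> \<open>The diagonal lemma asks for one bound valid at all points, so the values are
    divided by \<open>1 + norm x\<close>; the factor is removed again point by point.\<close>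
  obtain r where r: "strict_mono r"
    "\<And>x. x \<in> range d \<Longrightarrow> \<exists>l. (\<lambda>n. fs (r n) x / (1 + norm x)) \<longlonglongrightarrow> l"
    using function_convergent_subsequence[of "range d" "\<lambda>n x. fs n x / (1 + norm x)" "\<bar>C\<bar>"] bound
    by auto
  have "convergent (\<lambda>n. fs (r n) x)" for x
  proof (rule convergent_from_dense[OF lin Cb d])
    fix v assume "v \<in> range d"
    then obtain l where "(\<lambda>n. fs (r n) v / (1 + norm v)) \<longlonglongrightarrow> l" using r(2) by blast
    then have "(\<lambda>n. (1 + norm v) * (fs (r n) v / (1 + norm v))) \<longlonglongrightarrow> (1 + norm v) * l"
      by (intro tendsto_mult tendsto_const)
    moreover have "(1 + norm v) \<noteq> 0" using norm_ge_zero[of v] by linarith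
    ultimately show "convergent (\<lambda>n. fs (r n) v)" by (auto simp: convergent_def)
  qed
  then obtain h where h: "\<And>x. (\<lambda>n. fs (r n) x) \<longlonglongrightarrow> h x" by (auto simp: convergent_def) metis
  have h_bdd: "\<bar>h x\<bar> \<le> N x" for x
    by (rule LIMSEQ_le_const2[OF tendsto_rabs[OF h]]) (use bdd in auto)
  have "linear h"
  proof (rule linearI)
    fix x y and a :: real
    have "(\<lambda>n. fs (r n) (x + y)) \<longlonglongrightarrow> h x + h y"
      using tendsto_add[OF h h, of x y] lin by (simp add: linear_simps)
    then show "h (x + y) = h x + h y" using h LIMSEQ_unique by blast
    have "(\<lambda>n. fs (r n) (a *\<^sub>R x)) \<longlonglongrightarrow> a * h x"
      using tendsto_mult_left[OF h, of a x] lin by (simp add: linear_simps)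
    then show "h (a *\<^sub>R x) = a *\<^sub>R h x" using h LIMSEQ_unique by auto
  qed
  then have "h \<in> dual N" using h_bdd by (auto simp: dual_def bounded_lin_def intro!: exI[of _ 1])
  then show ?thesis using r(1) h h_bdd by (auto simp: dual_eq intro!: exI[of _ r] exI[of _ h])
qed

end

section \<open>The moduli of asymptotic smoothness and convexity\<close>

context separable_norm
begin

lemma rho_upper:
  assumes \<sigma>: "0 \<le> \<sigma>" and x: "N x = 1" and xs: "weakly_null N xs"
    and le: "\<And>e. 0 < e \<Longrightarrow> \<forall>\<^sub>F n in sequentially. N (xs n) < \<sigma> + e" and e: "0 < e"
  shows "\<forall>\<^sub>F n in sequentially. N (x + xs n) < 1 + rho N \<sigma> + e"
proof -
  define S where "S = {c. \<forall>x xs. N x = 1 \<longrightarrow> weakly_null N xs \<longrightarrow>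
       limsup (\<lambda>n. ereal (N (xs n))) \<le> ereal \<sigma> \<longrightarrow>
       limsup (\<lambda>n. ereal (N (x + xs n))) \<le> ereal (1 + c)}"
  \<comment> \<open>The triangle inequality makes \<open>\<sigma>\<close> admissible; with a
    nonempty set the infimum can be approximated.\<close>
  have "\<sigma> \<in> S"
    unfolding S_def limsup_ereal_le_iff
  proof (intro CollectI allI impI)
    fix x xs and e :: real assume *: "N x = 1" "\<forall>e>0. \<forall>\<^sub>F n in sequentially. N (xs n) < \<sigma> + e" "e > 0"
    then have "\<forall>\<^sub>F n in sequentially. N (xs n) < \<sigma> + e" by blast
    then show "\<forall>\<^sub>F n in sequentially. N (x + xs n) < 1 + \<sigma> + e"
    proof eventually_elim
      case (elim n)
      then show ?case using triangle[of x "xs n"] *(1) by linarith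
    qed
  qed
  then have "Inf S < rho N \<sigma> + e / 2 \<and> S \<noteq> {}" using e by (auto simp: rho_def S_def)
  then obtain c where c: "c \<in> S" "c < rho N \<sigma> + e / 2" using cInf_lessD by blast
  from c(1) x xs le have "\<forall>\<^sub>F n in sequentially. N (x + xs n) < 1 + c + e / 2"
    using e unfolding S_def limsup_ereal_le_iff by simp
  then show ?thesis by eventually_elim (use c(2) in linarith)
qed

lemma rho_le:
  assumes \<sigma>: "0 \<le> \<sigma>"
    and le: "\<And>x xs e. N x = 1 \<Longrightarrow> weakly_null N xs \<Longrightarrow>
      (\<And>e. 0 < e \<Longrightarrow> \<forall>\<^sub>F n in sequentially. N (xs n) < \<sigma> + e) \<Longrightarrow> 0 < e \<Longrightarrow>
      \<forall>\<^sub>F n in sequentially. N (x + xs n) < 1 + c + e"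
  shows "rho N \<sigma> \<le> c"
  unfolding rho_def
proof (rule cInf_lower)
  show "c \<in> {c. \<forall>x xs. N x = 1 \<longrightarrow> weakly_null N xs \<longrightarrow>
       limsup (\<lambda>n. ereal (N (xs n))) \<le> ereal \<sigma> \<longrightarrow>
       limsup (\<lambda>n. ereal (N (x + xs n))) \<le> ereal (1 + c)}"
    unfolding limsup_ereal_le_iff using le by blast
  obtain x where x: "N x = 1" using unit_vector_exists by blast
  \<comment> \<open>The zero sequence forces every admissible constant to be nonnegative, which
    bounds the set from below.\<close>
  have "weakly_null N (\<lambda>_. 0)" by (auto simp: weakly_null_iff linear_0 bounded_linear.linear)
  with x \<sigma> show "bdd_below {c. \<forall>x xs. N x = 1 \<longrightarrow> weakly_null N xs \<longrightarrow>
       limsup (\<lambda>n. ereal (N (xs n))) \<le> ereal \<sigma> \<longrightarrow>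
       limsup (\<lambda>n. ereal (N (x + xs n))) \<le> ereal (1 + c)}"
    by (intro bdd_belowI[of _ 0]) (auto simp: Limsup_const dest!: spec[of _ x] spec[of _ "\<lambda>_. 0"])
qed

lemma rho_nonneg:
  assumes "0 \<le> \<sigma>"
  shows "0 \<le> rho N \<sigma>"
proof (rule field_le_epsilon)
  fix e :: real assume e: "0 < e"
  obtain x where x: "N x = 1" using unit_vector_exists by blast
  have "weakly_null N (\<lambda>_. 0)" by (auto simp: weakly_null_iff linear_0 bounded_linear.linear)
  from rho_upper[OF assms x this _ e] assms x show "0 \<le> rho N \<sigma> + e" by simp
qed

lemma rho_le_self:
  assumes "0 \<le> \<sigma>"
  shows "rho N \<sigma> \<le> \<sigma>"
proof (rule rho_le[OF assms])
  fix x xs and e :: real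
  assume x: "N x = 1" and le: "\<And>e. 0 < e \<Longrightarrow> \<forall>\<^sub>F n in sequentially. N (xs n) < \<sigma> + e" and e: "0 < e"
  from le[OF e] show "\<forall>\<^sub>F n in sequentially. N (x + xs n) < 1 + \<sigma> + e"
  proof eventually_elim
    case (elim n)
    then show ?case using triangle[of x "xs n"] x by linarith
  qed
qed

lemma weakly_null_scale: "weakly_null N xs \<Longrightarrow> weakly_null N (\<lambda>n. a *\<^sub>R xs n)"
  unfolding weakly_null_iff
  by (auto simp: bounded_linear.linear linear_scale intro!: tendsto_mult_right_zero)

lemma rho_scale:
  assumes \<sigma>: "0 \<le> \<sigma>" and l: "0 < l" "l \<le> 1"
  shows "rho N (l * \<sigma>) \<le> l * rho N \<sigma>"
proof (rule rho_le)
  show "0 \<le> l * \<sigma>" using assms by simp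
  fix x xs and e :: real
  assume x: "N x = 1" and wn: "weakly_null N xs"
    and le: "\<And>e. 0 < e \<Longrightarrow> \<forall>\<^sub>F n in sequentially. N (xs n) < l * \<sigma> + e" and e: "0 < e"
  have "\<forall>\<^sub>F n in sequentially. N (x + xs n /\<^sub>R l) < 1 + rho N \<sigma> + e"
  proof (rule rho_upper[OF \<sigma> x weakly_null_scale[OF wn] _ e])
    fix e :: real assume "0 < e"
    then have "\<forall>\<^sub>F n in sequentially. N (xs n) < l * \<sigma> + l * e" using l by (intro le) simp
    then show "\<forall>\<^sub>F n in sequentially. N (xs n /\<^sub>R l) < \<sigma> + e"
      by eventually_elim (use l in \<open>simp add: scale field_simps\<close>)
  qed
  then show "\<forall>\<^sub>F n in sequentially. N (x + xs n) < 1 + l * rho N \<sigma> + e"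
  proof eventually_elim
    case (elim n)
    have "x + xs n = (1 - l) *\<^sub>R x + l *\<^sub>R (x + xs n /\<^sub>R l)" using l by (simp add: algebra_simps)
    then have "N (x + xs n) \<le> (1 - l) * N x + l * N (x + xs n /\<^sub>R l)"
      using triangle[of "(1 - l) *\<^sub>R x" "l *\<^sub>R (x + xs n /\<^sub>R l)"] l by (simp add: scale)
    also have "\<dots> < (1 - l) * N x + l * (1 + rho N \<sigma> + e)" using elim l by simp
    also have "\<dots> \<le> 1 + l * rho N \<sigma> + e" using x l e mult_right_mono[of l 1 e] by (simp add: algebra_simps)
    finally show ?case .
  qed
qed

section \<open>The modulus of asymptotic convexity\<close>

lemma theta_upper_bound:
  assumes \<tau>: "0 \<le> \<tau>"
    and c: "\<And>f fs. bounded_linear f \<Longrightarrow> dual_norm N f = 1 \<Longrightarrow> weak_star_null N fs \<Longrightarrow>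
       (\<forall>e>0. \<forall>\<^sub>F n in sequentially. \<tau> - e < dual_norm N (fs n)) \<Longrightarrow>
       (\<forall>e>0. \<forall>\<^sub>F n in sequentially. 1 + c - e < dual_norm N (\<lambda>x. f x + fs n x))"
  shows "c \<le> \<tau>"
proof (rule field_le_epsilon)
  fix e :: real assume e: "0 < e"
  obtain f where f: "bounded_linear f" "dual_norm N f = 1" using unit_functional_exists by blast
  obtain fs where fs: "weak_star_null N fs" "\<And>n. dual_norm N (fs n) = \<tau>"
    using Josefson_Nissenzweig[OF \<tau>] by blast
  have lin: "bounded_linear (fs n)" for n using fs(1) by (simp add: weak_star_null_iff)
  have "\<forall>\<^sub>F n in sequentially. 1 + c - e < dual_norm N (\<lambda>x. f x + fs n x)"
    using c[OF f fs(1)] fs(2) e by simp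
  then obtain n where "1 + c - e < dual_norm N (\<lambda>x. f x + fs n x)"
    using eventually_happens'[OF sequentially_bot] by blast
  then show "c \<le> \<tau> + e"
    using dual_norm_triangle[OF f(1) lin[of n]] f(2) fs(2) by simp
qed

lemma theta_bdd_above:
  assumes "0 \<le> \<tau>"
  shows "bdd_above {c. \<forall>f fs. f \<in> dual N \<longrightarrow> dual_norm N f = 1 \<longrightarrow> weak_star_null N fs \<longrightarrow>
       ereal \<tau> \<le> liminf (\<lambda>n. ereal (dual_norm N (fs n))) \<longrightarrow>
       ereal (1 + c) \<le> liminf (\<lambda>n. ereal (dual_norm N (\<lambda>x. f x + fs n x)))}"
proof (rule bdd_aboveI)
  fix c assume "c \<in> {c. \<forall>f fs. f \<in> dual N \<longrightarrow> dual_norm N f = 1 \<longrightarrow> weak_star_null N fs \<longrightarrow>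
       ereal \<tau> \<le> liminf (\<lambda>n. ereal (dual_norm N (fs n))) \<longrightarrow>
       ereal (1 + c) \<le> liminf (\<lambda>n. ereal (dual_norm N (\<lambda>x. f x + fs n x)))}"
  then show "c \<le> \<tau>"
    unfolding le_liminf_ereal_iff dual_eq by (intro theta_upper_bound[OF assms]) blast
qed

lemma theta_ge:
  assumes \<tau>: "0 \<le> \<tau>"
    and ge: "\<And>f fs e. bounded_linear f \<Longrightarrow> dual_norm N f = 1 \<Longrightarrow> weak_star_null N fs \<Longrightarrow>
      (\<And>e. 0 < e \<Longrightarrow> \<forall>\<^sub>F n in sequentially. \<tau> - e < dual_norm N (fs n)) \<Longrightarrow> 0 < e \<Longrightarrow>
      \<forall>\<^sub>F n in sequentially. 1 + c - e < dual_norm N (\<lambda>x. f x + fs n x)"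
  shows "c \<le> theta N \<tau>"
  unfolding theta_def
proof (rule cSup_upper[OF _ theta_bdd_above[OF \<tau>]])
  show "c \<in> {c. \<forall>f fs. f \<in> dual N \<longrightarrow> dual_norm N f = 1 \<longrightarrow> weak_star_null N fs \<longrightarrow>
       ereal \<tau> \<le> liminf (\<lambda>n. ereal (dual_norm N (fs n))) \<longrightarrow>
       ereal (1 + c) \<le> liminf (\<lambda>n. ereal (dual_norm N (\<lambda>x. f x + fs n x)))}"
    unfolding le_liminf_ereal_iff dual_eq using ge by blast
qed

lemma theta_nonneg:
  assumes "0 \<le> \<tau>"
  shows "0 \<le> theta N \<tau>"
proof (rule theta_ge[OF assms])
  fix f fs and e :: real
  assume "bounded_linear f" "dual_norm N f = 1" "weak_star_null N fs" "0 < e"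
  then show "\<forall>\<^sub>F n in sequentially. 1 + 0 - e < dual_norm N (\<lambda>x. f x + fs n x)"
    using dual_norm_lower_semicontinuous[of f fs e] by (simp add: weak_star_null_iff)
qed

lemma theta_lower:
  assumes \<tau>: "0 \<le> \<tau>" and f: "bounded_linear f" "dual_norm N f = 1" and fs: "weak_star_null N fs"
    and ge: "\<And>e. 0 < e \<Longrightarrow> \<forall>\<^sub>F n in sequentially. \<tau> - e < dual_norm N (fs n)" and e: "0 < e"
  shows "\<forall>\<^sub>F n in sequentially. 1 + theta N \<tau> - e < dual_norm N (\<lambda>x. f x + fs n x)"
proof -
  define S where "S = {c. \<forall>f fs. f \<in> dual N \<longrightarrow> dual_norm N f = 1 \<longrightarrow> weak_star_null N fs \<longrightarrow>
       ereal \<tau> \<le> liminf (\<lambda>n. ereal (dual_norm N (fs n))) \<longrightarrow>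
       ereal (1 + c) \<le> liminf (\<lambda>n. ereal (dual_norm N (\<lambda>x. f x + fs n x)))}"
  have "0 \<in> S"
    unfolding S_def le_liminf_ereal_iff dual_eq
    using dual_norm_lower_semicontinuous by (fastforce simp: weak_star_null_iff)
  then have "S \<noteq> {}" by blast
  moreover have "theta N \<tau> - e / 2 < Sup S" using e by (simp add: theta_def S_def)
  ultimately obtain c where c: "c \<in> S" "theta N \<tau> - e / 2 < c" using less_cSupD by blast
  from c(1) f fs ge have "\<forall>\<^sub>F n in sequentially. 1 + c - e / 2 < dual_norm N (\<lambda>x. f x + fs n x)"
    using e unfolding S_def le_liminf_ereal_iff dual_eq by simp
  then show ?thesis by eventually_elim (use c(2) in linarith)
qed

lemma theta_le_self:
  assumes "0 \<le> \<tau>"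
  shows "theta N \<tau> \<le> \<tau>"
proof (rule theta_upper_bound[OF assms])
  fix f fs
  assume "bounded_linear f" "dual_norm N f = 1" "weak_star_null N fs"
    "\<forall>e>0. \<forall>\<^sub>F n in sequentially. \<tau> - e < dual_norm N (fs n)"
  then show "\<forall>e>0. \<forall>\<^sub>F n in sequentially. 1 + theta N \<tau> - e < dual_norm N (\<lambda>x. f x + fs n x)"
    using theta_lower[OF assms] by blast
qed

lemma weak_star_null_scale: "weak_star_null N fs \<Longrightarrow> weak_star_null N (\<lambda>n x. a * fs n x)"
  by (auto simp: weak_star_null_iff intro!: bounded_linear_const_mult tendsto_mult_right_zero)

lemma weak_star_null_linear: "weak_star_null N fs \<Longrightarrow> bounded_linear (fs n)"
  by (simp add: weak_star_null_iff)

lemma theta_scale: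
  assumes \<tau>: "0 \<le> \<tau>" and l: "0 < l" "l \<le> 1"
  shows "theta N (l * \<tau>) \<le> l * theta N \<tau>"
proof -
  have "theta N (l * \<tau>) / l \<le> theta N \<tau>"
  proof (rule theta_ge[OF \<tau>])
    fix f fs and e :: real
    assume f: "bounded_linear f" "dual_norm N f = 1" and fs: "weak_star_null N fs"
      and ge: "\<And>e. 0 < e \<Longrightarrow> \<forall>\<^sub>F n in sequentially. \<tau> - e < dual_norm N (fs n)" and e: "0 < e"
    note lin = weak_star_null_linear[OF fs]
    have "\<forall>\<^sub>F n in sequentially. 1 + theta N (l * \<tau>) - l * e < dual_norm N (\<lambda>x. f x + l * fs n x)"
    proof (rule theta_lower[OF _ f weak_star_null_scale[OF fs]])
      fix e :: real assume "0 < e"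
      then have "\<forall>\<^sub>F n in sequentially. \<tau> - e / l < dual_norm N (fs n)" using l by (intro ge) simp
      then show "\<forall>\<^sub>F n in sequentially. l * \<tau> - e < dual_norm N (\<lambda>x. l * fs n x)"
        by eventually_elim (use l in \<open>simp add: dual_norm_scale[OF lin] field_simps\<close>)
    qed (use \<tau> l e in auto)
    then show "\<forall>\<^sub>F n in sequentially. 1 + theta N (l * \<tau>) / l - e < dual_norm N (\<lambda>x. f x + fs n x)"
    proof eventually_elim
      case (elim n)
      have bl: "bounded_linear (\<lambda>x. f x + fs n x)" using f lin by (intro bounded_linear_add)
      have "(\<lambda>x. f x + l * fs n x) = (\<lambda>x. (1 - l) * f x + l * (f x + fs n x))" by (auto simp: algebra_simps)
      then have "dual_norm N (\<lambda>x. f x + l * fs n x) \<le> (1 - l) * dual_norm N f + l * dual_norm N (\<lambda>x. f x + fs n x)"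
        using dual_norm_triangle[OF bounded_linear_const_mult[OF f(1)] bounded_linear_const_mult[OF bl],
            of "1 - l" l] l
        by (simp add: dual_norm_scale[OF f(1)] dual_norm_scale[OF bl])
      with elim f(2) have "l * (1 + theta N (l * \<tau>) / l - e) < l * dual_norm N (\<lambda>x. f x + fs n x)"
        using l by (simp add: algebra_simps)
      then show ?case using l by simp
    qed
  qed
  then show ?thesis using l by (simp add: field_simps)
qed

text \<open>Rescaling a sequence of size \<open>l * \<tau>\<close> by \<open>1 / l\<close> makes it
  admissible for \<open>\<tau>\<close>. The explicit rate is what later pays for a renorming ratio
  above 2.\<close>

lemma theta_left_continuous:
  assumes \<tau>: "0 \<le> \<tau>" "\<tau> \<le> 1" and l: "0 < l" "l \<le> 1"
  shows "theta N \<tau> - 3 * (1 / l - 1) \<le> theta N (l * \<tau>)"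
proof (rule theta_ge)
  show "0 \<le> l * \<tau>" using assms by simp
  fix f fs and e :: real
  assume f: "bounded_linear f" "dual_norm N f = 1" and fs: "weak_star_null N fs"
    and ge: "\<And>e. 0 < e \<Longrightarrow> \<forall>\<^sub>F n in sequentially. l * \<tau> - e < dual_norm N (fs n)" and e: "0 < e"
  note lin = weak_star_null_linear[OF fs]
  have "\<forall>\<^sub>F n in sequentially. 1 + theta N \<tau> - e < dual_norm N (\<lambda>x. f x + 1 / l * fs n x)"
  proof (rule theta_lower[OF \<tau>(1) f weak_star_null_scale[OF fs] _ e])
    fix e :: real assume "0 < e"
    then have "\<forall>\<^sub>F n in sequentially. l * \<tau> - l * e < dual_norm N (fs n)" using l by (intro ge) simp
    then show "\<forall>\<^sub>F n in sequentially. \<tau> - e < dual_norm N (\<lambda>x. 1 / l * fs n x)"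
      by eventually_elim (use l in \<open>simp only: dual_norm_scale[OF lin], simp add: field_simps\<close>)
  qed
  then show "\<forall>\<^sub>F n in sequentially. 1 + (theta N \<tau> - 3 * (1 / l - 1)) - e < dual_norm N (\<lambda>x. f x + fs n x)"
  proof eventually_elim
    case (elim n)
    have bl: "bounded_linear (\<lambda>x. f x + fs n x)" using f lin by (intro bounded_linear_add)
    have l1: "1 / l - 1 \<ge> 0" using l by simp
    show ?case
    \<comment> \<open>Undoing the rescaling costs \<open>1 / l - 1\<close> times the norm of
      \<open>fs n\<close>. If that norm exceeds 3, then \<open>f + fs n\<close> has norm above 2,
      hence above \<open>1 + theta N \<tau>\<close>, without any comparison.\<close>
    proof (cases "dual_norm N (fs n) \<le> 3")
      case True
      have "(\<lambda>x. f x + 1 / l * fs n x) = (\<lambda>x. (f x + fs n x) + (1 / l - 1) * fs n x)"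
        by (auto simp: algebra_simps)
      then have "dual_norm N (\<lambda>x. f x + 1 / l * fs n x)
        \<le> dual_norm N (\<lambda>x. f x + fs n x) + (1 / l - 1) * dual_norm N (fs n)"
        using dual_norm_triangle[OF bl bounded_linear_const_mult[OF lin], of "1 / l - 1" n] l1
        by (simp add: dual_norm_scale[OF lin])
      moreover have "(1 / l - 1) * dual_norm N (fs n) \<le> (1 / l - 1) * 3"
        using True l1 by (rule mult_left_mono)
      ultimately show ?thesis using elim by linarith
    next
      case False
      have "dual_norm N (fs n) \<le> dual_norm N (\<lambda>x. f x + fs n x) + dual_norm N f"
        using dual_norm_triangle_diff[OF bl f(1)] by simp
      then show ?thesis using False f(2) theta_le_self[OF \<tau>(1)] \<tau>(2) l1 e by simp
    qed
  qed
qed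

text \<open>Since \<open>\<theta>\<close> is controlled only up to 1, the sequence is scaled by \<open>b = max \<parallel>f\<parallel> \<tau>\<close> rather than by \<open>\<parallel>f\<parallel>\<close>.\<close>

lemma theta_lower_subunit:
  assumes \<tau>: "0 \<le> \<tau>" "\<tau> \<le> 1" and f: "bounded_linear f" "dual_norm N f \<le> 1"
    and fs: "weak_star_null N fs"
    and ge: "\<And>e. 0 < e \<Longrightarrow> \<forall>\<^sub>F n in sequentially. \<tau> - e < dual_norm N (fs n)" and e: "0 < e"
  shows "\<forall>\<^sub>F n in sequentially. dual_norm N f + theta N \<tau> - e < dual_norm N (\<lambda>x. f x + fs n x)"
proof -
  note lin = weak_star_null_linear[OF fs]
  have bl: "bounded_linear (\<lambda>x. f x + fs n x)" for n using f lin by (intro bounded_linear_add)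
  define a where "a = dual_norm N f"
  have a: "0 \<le> a" "a \<le> 1" using f dual_norm_nonneg by (auto simp: a_def)
  show ?thesis
  proof (cases "a = 0")
    case True
    from ge[OF e] show ?thesis
    proof eventually_elim
      case (elim n)
      have "dual_norm N (fs n) \<le> dual_norm N (\<lambda>x. f x + fs n x) + dual_norm N f"
        using dual_norm_triangle_diff[OF bl f(1), of n] by simp
      then show ?case using elim True theta_le_self[OF \<tau>(1)] by (simp add: a_def)
    qed
  next
    case False
    with a have a0: "0 < a" by simp
    define b where "b = max a \<tau>"
    have b: "0 < b" "b \<le> 1" "a \<le> b" "\<tau> \<le> b" using a0 a \<tau> by (auto simp: b_def)
    have "\<forall>\<^sub>F n in sequentially. 1 + theta N (\<tau> / b) - e / b < dual_norm N (\<lambda>x. 1 / a * f x + 1 / b * fs n x)"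
    proof (rule theta_lower[OF _ bounded_linear_const_mult[OF f(1)] _ weak_star_null_scale[OF fs]])
      show "dual_norm N (\<lambda>x. 1 / a * f x) = 1"
        unfolding dual_norm_scale[OF f(1)] using a0 by (simp add: a_def)
      fix d :: real assume "0 < d"
      then have "\<forall>\<^sub>F n in sequentially. \<tau> - b * d < dual_norm N (fs n)" using b by (intro ge) simp
      then show "\<forall>\<^sub>F n in sequentially. \<tau> / b - d < dual_norm N (\<lambda>x. 1 / b * fs n x)"
      proof eventually_elim
        case (elim n)
        then have "(\<tau> - b * d) / b < dual_norm N (fs n) / b" using b by (intro divide_strict_right_mono)
        then show ?case unfolding dual_norm_scale[OF lin] using b by (simp add: diff_divide_distrib)
      qed
    qed (use \<tau> b e in auto)
    then show ?thesis
    proof eventually_elim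
      case (elim n)
      have th: "theta N \<tau> \<le> b * theta N (\<tau> / b)"
        using theta_scale[of "\<tau> / b" b] \<tau> b by simp
      have "bounded_linear (\<lambda>x. 1 / a * f x + 1 / b * fs n x)"
        by (intro bounded_linear_add bounded_linear_const_mult f(1) lin)
      from dual_norm_scale[OF this, of b]
      have "b * dual_norm N (\<lambda>x. 1 / a * f x + 1 / b * fs n x)
        = dual_norm N (\<lambda>x. b * (1 / a * f x + 1 / b * fs n x))"
        using b by simp
      \<comment> \<open>Multiplying by \<open>b\<close> restores \<open>f + fs n\<close> up to a
        multiple of \<open>f\<close> of norm \<open>b - a\<close>; this excess lowers the leading
        \<open>b\<close> of the estimate to \<open>a\<close>.\<close>
      moreover have "(\<lambda>x. b * (1 / a * f x + 1 / b * fs n x)) = (\<lambda>x. (f x + fs n x) + (b / a - 1) * f x)"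
        using a0 b by (auto simp: field_simps)
      ultimately have "b * dual_norm N (\<lambda>x. 1 / a * f x + 1 / b * fs n x)
        = dual_norm N (\<lambda>x. (f x + fs n x) + (b / a - 1) * f x)" by simp
      moreover have "dual_norm N (\<lambda>x. (f x + fs n x) + (b / a - 1) * f x)
        \<le> dual_norm N (\<lambda>x. f x + fs n x) + (b / a - 1) * a"
        using dual_norm_triangle[OF bl bounded_linear_const_mult[OF f(1)], of n "b / a - 1"] a0 b
        by (simp add: dual_norm_scale[OF f(1)] a_def)
      moreover have "(b / a - 1) * a = b - a" using a0 by (simp add: field_simps)
      moreover have "b * (1 + theta N (\<tau> / b) - e / b) < b * dual_norm N (\<lambda>x. 1 / a * f x + 1 / b * fs n x)"
        using elim b by simp
      moreover have "b * (1 + theta N (\<tau> / b) - e / b) = b + b * theta N (\<tau> / b) - e"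
        using b by (simp add: field_simps)
      ultimately show ?case using th unfolding a_def[symmetric] by linarith
    qed
  qed
qed

end

section \<open>The two inequalities between the moduli\<close>

lemma subsequence_if_not_eventually:
  assumes "\<not> eventually P sequentially"
  shows "\<exists>r :: nat \<Rightarrow> nat. strict_mono r \<and> (\<forall>n. \<not> P (r n))"
proof -
  have "infinite {n. \<not> P n}"
    using assms by (simp add: eventually_cofinite flip: cofinite_eq_sequentially)
  then show ?thesis
    using strict_mono_enumerate enumerate_in_set by blast
qed

lemma theta_ge_young:
  fixes N :: "'a::banach \<Rightarrow> real"
  assumes "separable_norm N" and no_ell1: "\<not> contains_ell1 (norm :: 'a \<Rightarrow> real)"
    and \<tau>: "0 \<le> \<tau>" "\<tau> \<le> 1" and t: "0 \<le> t" "t \<le> 1"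
  shows "\<tau> * t / 4 - rho N t \<le> theta N \<tau>"
proof -
  interpret separable_norm N by fact
  define c where "c = \<tau> * t / 4 - rho N t"
  have rho: "0 \<le> rho N t" "rho N t \<le> t" using rho_nonneg rho_le_self t by auto
  have \<tau>t: "\<tau> * t \<le> 1" using mult_mono[of \<tau> 1 t 1] \<tau> t by simp
  have "c \<le> theta N \<tau>"
  \<comment> \<open>Positivity of \<open>c\<close> is used at the end to absorb
    \<open>c * rho N t\<close> into \<open>c\<close>.\<close>
  proof (cases "c \<le> 0")
    case True
    then show ?thesis using theta_nonneg[OF \<tau>(1)] by simp
  next
    case c0: False
    show ?thesis
    proof (rule theta_ge[OF \<tau>(1)], rule ccontr)
      fix f fs and e :: real
      assume f: "bounded_linear f" "dual_norm N f = 1" and fs: "weak_star_null N fs"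
        and ge: "\<And>e. 0 < e \<Longrightarrow> \<forall>\<^sub>F n in sequentially. \<tau> - e < dual_norm N (fs n)" and e: "0 < e"
        and neg: "\<not> (\<forall>\<^sub>F n in sequentially. 1 + c - e < dual_norm N (\<lambda>x. f x + fs n x))"
      obtain r :: "nat \<Rightarrow> nat" where r: "strict_mono r"
        "\<And>n. dual_norm N (\<lambda>x. f x + fs (r n) x) \<le> 1 + c - e"
        using subsequence_if_not_eventually[OF neg] by (auto simp: not_less)
      \<comment> \<open>The errors below add up to \<open>13 / 2 * \<eta>\<close>, namely
        \<open>9 / 2 * \<eta>\<close> in the lower estimate and \<open>2 * \<eta>\<close> in the
        upper one, which stays below \<open>e\<close>.\<close>
      define \<eta> where "\<eta> = e / 8"
      have \<eta>: "0 < \<eta>" using e by (simp add: \<eta>_def)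
      note lin = weak_star_null_linear[OF fs]
      have "\<forall>n. \<exists>x. N x \<le> 1 \<and> dual_norm N (fs (r n)) - \<eta> < fs (r n) x"
        using dual_norm_almost_attained[OF lin \<eta>] by blast
      then obtain xs where xs: "\<And>n. N (xs n) \<le> 1" "\<And>n. dual_norm N (fs (r n)) - \<eta> < fs (r n) (xs n)"
        by metis
      obtain b where b: "0 < b" "\<And>x. b * norm x \<le> N x" using lower by blast
      have "norm (xs n) \<le> 1 / b" for n
        using b(2)[of "xs n"] xs(1)[of n] b(1) by (simp add: field_simps)
      from Rosenthal_ell1[of xs "1 / b", OF this no_ell1] obtain s :: "nat \<Rightarrow> nat" where s: "strict_mono s"
        "\<And>g :: 'a \<Rightarrow> real. bounded_linear g \<Longrightarrow> convergent (\<lambda>n. g (xs (s n)))" by blast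
      define hs where "hs n = fs (r (s n))" for n
      define ys where "ys n = xs (s n)" for n
      have rs: "strict_mono (\<lambda>n. r (s n))" using strict_mono_compose[OF r(1) s(1)] .
      have hs_lin: "bounded_linear (hs n)" for n using lin by (simp add: hs_def)
      have hs_null: "(\<lambda>n. hs n x) \<longlonglongrightarrow> 0" for x
        using LIMSEQ_subseq_LIMSEQ[OF _ rs, of "\<lambda>n. fs n x" 0] fs by (simp add: hs_def weak_star_null_iff o_def)
      have hs_ge: "\<forall>\<^sub>F n in sequentially. \<tau> - \<eta> < dual_norm N (hs n)"
        using eventually_subseq[OF rs ge[OF \<eta>]] by (simp add: hs_def)
      have ys: "N (ys n) \<le> 1" "dual_norm N (hs n) - \<eta> < hs n (ys n)" for n
        using xs by (auto simp: hs_def ys_def)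
      \<comment> \<open>Sparse choice: each functional is nearly zero on the vector chosen before,
        so on the difference it keeps almost the whole value at its own vector.\<close>
      have "\<exists>m :: nat \<Rightarrow> nat. \<forall>k. True \<and> (m k < m (Suc k) \<and> \<bar>hs (m (Suc k)) (ys (m k))\<bar> < \<eta>)"
      proof (rule dependent_nat_choice)
        fix x k :: nat
        have "\<forall>\<^sub>F n in sequentially. dist (hs n (ys x)) 0 < \<eta>" using hs_null \<eta> by (rule tendstoD)
        then have "\<forall>\<^sub>F n in sequentially. x < n \<and> \<bar>hs n (ys x)\<bar> < \<eta>"
          using eventually_gt_at_top[of x] by eventually_elim simp
        then show "\<exists>y. True \<and> x < y \<and> \<bar>hs y (ys x)\<bar> < \<eta>"
          using eventually_happens'[OF sequentially_bot] by blast
      qed auto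
      then obtain m :: "nat \<Rightarrow> nat" where m: "\<And>k. m k < m (Suc k)" "\<And>k. \<bar>hs (m (Suc k)) (ys (m k))\<bar> < \<eta>"
        by blast
      have m_mono: "strict_mono m" "strict_mono (\<lambda>k. m (Suc k))"
        using m(1) by (auto simp: strict_mono_Suc_iff)
      \<comment> \<open>The weakly Cauchy sequence itself may have no weak limit, but its successive
        differences are weakly null; the factor 1/2 brings them back into the unit ball.\<close>
      define us where "us k = (1 / 2) *\<^sub>R (ys (m (Suc k)) - ys (m k))" for k
      have us_null: "(\<lambda>k. g (us k)) \<longlonglongrightarrow> 0" if g: "bounded_linear g" for g :: "'a \<Rightarrow> real"
      proof -
        obtain l where l: "(\<lambda>n. g (ys n)) \<longlonglongrightarrow> l" using s(2)[OF g] by (auto simp: convergent_def ys_def)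
        have "(\<lambda>k. g (ys (m k))) \<longlonglongrightarrow> l" "(\<lambda>k. g (ys (m (Suc k)))) \<longlonglongrightarrow> l"
          using LIMSEQ_subseq_LIMSEQ[OF l m_mono(1)] LIMSEQ_subseq_LIMSEQ[OF l m_mono(2)] by (auto simp: o_def)
        then have "(\<lambda>k. 1 / 2 * (g (ys (m (Suc k))) - g (ys (m k)))) \<longlonglongrightarrow> 1 / 2 * (l - l)"
          by (intro tendsto_mult tendsto_const tendsto_diff)
        then show ?thesis using g by (simp add: us_def linear_simps)
      qed
      have us_le: "N (us k) \<le> 1" for k
        using triangle_diff[of "ys (m (Suc k))" "ys (m k)"] ys(1)[of "m (Suc k)"] ys(1)[of "m k"]
        by (simp add: us_def scale)
      obtain x where x: "N x = 1" "1 - \<eta> < f x"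
        using dual_norm_almost_attained_sphere[OF f(1) \<eta>] f(2) by auto
      \<comment> \<open>The test vector is \<open>x + t *\<^sub>R us k\<close>: \<open>rho\<close>
        bounds its norm, and \<open>f + h\<close> is large on it because the cross terms
        \<open>f (us k)\<close> and \<open>h x\<close> are small.\<close>
      have "\<forall>\<^sub>F k in sequentially. N (x + t *\<^sub>R us k) < 1 + rho N t + \<eta>"
      proof (rule rho_upper[OF t(1) x(1) weakly_null_scale _ \<eta>])
        show "weakly_null N us" using us_null by (simp add: weakly_null_iff)
        fix d :: real assume "0 < d"
        moreover have "N (t *\<^sub>R us k) \<le> t" for k
          using mult_left_mono[OF us_le t(1), of k] t by (simp add: scale)
        ultimately show "\<forall>\<^sub>F k in sequentially. N (t *\<^sub>R us k) < t + d"
          by (intro always_eventually allI) (meson le_less_trans less_add_same_cancel1)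
      qed
      moreover have "\<forall>\<^sub>F k in sequentially. dist (f (us k)) 0 < \<eta>"
        using us_null[OF f(1)] \<eta> by (rule tendstoD)
      moreover have "\<forall>\<^sub>F k in sequentially. dist (hs (m (Suc k)) x) 0 < \<eta>"
        using eventually_subseq[OF m_mono(2) tendstoD[OF hs_null \<eta>]] .
      moreover have "\<forall>\<^sub>F k in sequentially. \<tau> - \<eta> < dual_norm N (hs (m (Suc k)))"
        using eventually_subseq[OF m_mono(2) hs_ge] .
      ultimately have "\<forall>\<^sub>F k in sequentially. N (x + t *\<^sub>R us k) < 1 + rho N t + \<eta> \<and>
        \<bar>f (us k)\<bar> < \<eta> \<and> \<bar>hs (m (Suc k)) x\<bar> < \<eta> \<and> \<tau> - \<eta> < dual_norm N (hs (m (Suc k)))"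
        by eventually_elim simp
      then obtain k where k: "N (x + t *\<^sub>R us k) < 1 + rho N t + \<eta>" "\<bar>f (us k)\<bar> < \<eta>"
        "\<bar>hs (m (Suc k)) x\<bar> < \<eta>" "\<tau> - \<eta> < dual_norm N (hs (m (Suc k)))"
        using eventually_happens'[OF sequentially_bot] by blast
      define h where "h = hs (m (Suc k))"
      have h: "bounded_linear h" using hs_lin by (simp add: h_def)
      have fh: "bounded_linear (\<lambda>x. f x + h x)" using f(1) h by (rule bounded_linear_add)
      define D where "D = dual_norm N (\<lambda>x. f x + h x)"
      have D: "0 \<le> D" "D \<le> 1 + c - e" using dual_norm_nonneg[OF fh] r(2) by (auto simp: D_def h_def hs_def)
      have hu: "(\<tau> - 3 * \<eta>) / 2 \<le> h (us k)"
      proof -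
        have "h (us k) = (h (ys (m (Suc k))) - h (ys (m k))) / 2" using h by (simp add: us_def linear_simps)
        then show ?thesis using ys(2)[of "m (Suc k)"] m(2)[of k] k(4) by (simp add: h_def)
      qed
      have "t * h (us k) \<ge> t * ((\<tau> - 3 * \<eta>) / 2)" using hu t(1) by (rule mult_left_mono)
      moreover have "t * ((\<tau> - 3 * \<eta>) / 2) = \<tau> * t / 2 - 3 / 2 * (t * \<eta>)" by (simp add: field_simps)
      moreover have t\<eta>: "t * \<eta> \<le> \<eta>" using t \<eta> by (simp add: mult_left_le_one_le)
      moreover have "t * f (us k) \<ge> - \<eta>"
      proof -
        have "\<bar>t * f (us k)\<bar> \<le> 1 * \<eta>" unfolding abs_mult using t k(2) by (intro mult_mono) auto
        then show ?thesis by linarith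
      qed
      moreover have "f (x + t *\<^sub>R us k) + h (x + t *\<^sub>R us k) = f x + t * f (us k) + h x + t * h (us k)"
        using f(1) h by (simp add: linear_simps)
      ultimately have low: "1 + \<tau> * t / 2 - 9 / 2 * \<eta> \<le> f (x + t *\<^sub>R us k) + h (x + t *\<^sub>R us k)"
        using x(2) k(3)[folded h_def] by linarith
      also have "\<dots> \<le> D * N (x + t *\<^sub>R us k)"
        using dual_norm_ge[OF fh, of "x + t *\<^sub>R us k"] by (simp add: D_def)
      also have "\<dots> \<le> (1 + c - e) * (1 + rho N t + \<eta>)"
        using D k(1) by (intro mult_mono) auto
      also have "\<dots> = (1 + c) + rho N t + c * rho N t - e * (1 + rho N t) + (1 + c - e) * \<eta>"
        by (simp add: algebra_simps)
      finally have "1 + \<tau> * t / 2 - 9 / 2 * \<eta> \<le>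
        (1 + c) + rho N t + c * rho N t - e * (1 + rho N t) + (1 + c - e) * \<eta>" .
      \<comment> \<open>Since \<open>rho N t \<le> t \<le> 1\<close>, the product of the two
        excesses is at most \<open>c\<close>. This doubles \<open>c\<close> and is why
        \<open>c\<close> carries the divisor 4 and not 2.\<close>
      moreover have "c * rho N t \<le> c * 1" using c0 rho t by (intro mult_left_mono) auto
      moreover have "e * 1 \<le> e * (1 + rho N t)" using e rho by (intro mult_left_mono) auto
      moreover have "(1 + c - e) * \<eta> \<le> 2 * \<eta>"
        using \<eta> rho e \<tau>t by (intro mult_right_mono) (auto simp: c_def)
      ultimately show False using \<eta> rho c_def \<eta>_def by linarith
    qed
  qed
  then show ?thesis by (simp add: c_def)
qed

text \<open>The argument \<open>theta N u / (2 * u)\<close> balances the size \<open>s\<close> of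
  the weak* null part. Up to \<open>s = u\<close> its pairing with the vectors costs at most half of
  \<open>theta N u\<close>. Beyond \<open>u\<close> the increasing slope of \<open>theta\<close>
  makes the loss in the norm of the limit functional pay for the pairing.\<close>

lemma (in separable_norm) rho_theta_slope_le:
  assumes u: "0 < u" "u \<le> 1"
  shows "rho N (theta N u / (2 * u)) \<le> theta N u / 2"
proof -
  define t where "t = theta N u / (2 * u)"
  have th: "0 \<le> theta N u" "theta N u \<le> u" using theta_nonneg theta_le_self u by auto
  have t: "0 \<le> t" "t \<le> 1" using th u by (auto simp: t_def field_simps)
  have ut: "u * t = theta N u / 2" using u by (simp add: t_def)
  have "rho N t \<le> theta N u / 2"
  proof (rule rho_le[OF t(1)], rule ccontr)
    fix x xs and e :: real
    assume x: "N x = 1" and wn: "weakly_null N xs"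
      and le: "\<And>e. 0 < e \<Longrightarrow> \<forall>\<^sub>F n in sequentially. N (xs n) < t + e" and e: "0 < e"
      and neg: "\<not> (\<forall>\<^sub>F n in sequentially. N (x + xs n) < 1 + theta N u / 2 + e)"
    obtain r :: "nat \<Rightarrow> nat" where r: "strict_mono r" "\<And>n. 1 + theta N u / 2 + e \<le> N (x + xs (r n))"
      using subsequence_if_not_eventually[OF neg] by (auto simp: not_less)
    have "\<forall>n. \<exists>f. bounded_linear f \<and> (\<forall>y. \<bar>f y\<bar> \<le> N y) \<and> f (x + xs (r n)) = N (x + xs (r n))"
      using norming_functional by blast
    then obtain hs where hs: "\<And>n. bounded_linear (hs n)" "\<And>n y. \<bar>hs n y\<bar> \<le> N y"
      "\<And>n. hs n (x + xs (r n)) = N (x + xs (r n))" by metis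
    obtain r2 :: "nat \<Rightarrow> nat" and h where r2: "strict_mono r2" and h: "bounded_linear h" "\<And>y. \<bar>h y\<bar> \<le> N y"
      and lim: "\<And>y. (\<lambda>n. hs (r2 n) y) \<longlonglongrightarrow> h y"
      using sequential_Banach_Alaoglu[of hs, OF hs(1,2)] by blast
    define g where "g n = (\<lambda>y. hs (r2 n) y - h y)" for n
    have g_lin: "bounded_linear (g n)" for n
      unfolding g_def using hs(1) h(1) by (intro bounded_linear_sub)
    have le1: "dual_norm N f \<le> 1" if "\<And>y. \<bar>f y\<bar> \<le> N y" for f
      using that order_trans by (intro dual_norm_le) blast
    have g_le: "dual_norm N (g n) \<le> 2" for n
      unfolding g_def using dual_norm_triangle_diff[OF hs(1) h(1), of "r2 n"] le1[of "hs (r2 n)", OF hs(2)] le1[of h, OF h(2)] by linarith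
    have "bounded (range (\<lambda>n. dual_norm N (g n)))"
      using g_le dual_norm_nonneg[OF g_lin] by (auto simp: bounded_iff intro!: exI[of _ 2])
    then obtain s and r3 :: "nat \<Rightarrow> nat" where r3: "strict_mono r3" and s: "(\<lambda>n. dual_norm N (g (r3 n))) \<longlonglongrightarrow> s"
      using bounded_imp_convergent_subsequence[of "\<lambda>n. dual_norm N (g n)"] by (auto simp: o_def)
    have s_range: "0 \<le> s" "s \<le> 2"
      using s g_le dual_norm_nonneg[OF g_lin] by (auto intro: LIMSEQ_le_const LIMSEQ_le_const2)
    define gs where "gs n = g (r3 n)" for n
    define zs where "zs n = xs (r (r2 (r3 n)))" for n
    define a where "a = dual_norm N h"
    have a1: "a \<le> 1" unfolding a_def using h(2) by (rule le1)
    have gs_null: "weak_star_null N gs"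
      unfolding weak_star_null_iff
    proof (intro conjI allI)
      fix y
      have "(\<lambda>n. g n y) \<longlonglongrightarrow> h y - h y" unfolding g_def by (intro tendsto_diff lim tendsto_const)
      then show "(\<lambda>n. gs n y) \<longlonglongrightarrow> 0"
        using LIMSEQ_subseq_LIMSEQ[OF _ r3, of "\<lambda>n. g n y"] by (simp add: gs_def o_def)
    qed (simp add: gs_def g_lin)
    \<comment> \<open>Each \<open>h + gs n\<close> is a norming functional of norm at most 1, so a
      large weak* null part leaves only a small limit \<open>h\<close>. The minimum keeps the
      argument of \<open>theta\<close> in the range where the lower estimate holds.\<close>
    have a_theta: "a + theta N (min s 1) \<le> 1"
    proof (rule field_le_epsilon)
      fix d :: real assume d: "0 < d"
      have "\<forall>\<^sub>F n in sequentially. dual_norm N h + theta N (min s 1) - d < dual_norm N (\<lambda>x. h x + gs n x)"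
      proof (rule theta_lower_subunit[OF _ _ h(1) _ gs_null _ d])
        fix d :: real assume "0 < d"
        then have "\<forall>\<^sub>F n in sequentially. s - d < dual_norm N (gs n)"
          using order_tendstoD(1)[OF s, of "s - d"] by (simp add: gs_def)
        then show "\<forall>\<^sub>F n in sequentially. min s 1 - d < dual_norm N (gs n)"
          by eventually_elim auto
      qed (use s_range a1 in \<open>auto simp: a_def\<close>)
      then obtain n where "a + theta N (min s 1) - d < dual_norm N (\<lambda>x. h x + gs n x)"
        unfolding a_def using eventually_happens'[OF sequentially_bot] by blast
      moreover have "dual_norm N (\<lambda>x. h x + gs n x) \<le> 1"
        using le1[of "hs (r2 (r3 n))", OF hs(2)] by (simp add: gs_def g_def)
      ultimately show "a + theta N (min s 1) \<le> 1 + d" by simp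
    qed
    have ast: "a + s * t \<le> 1 + theta N u / 2"
    proof -
      consider "s \<le> u" | "u < s" "s \<le> 1" | "1 < s" by linarith
      then show ?thesis
      proof cases
        case 1
        have "s * t \<le> u * t" using 1 t by (intro mult_right_mono)
        then show ?thesis using a1 ut by simp
      next
        case 2
        have "theta N u \<le> u / s * theta N s" using theta_scale[of s "u / s"] 2 u by simp
        then have "2 * (s * t) \<le> theta N s" using 2 u by (simp add: t_def field_simps)
        moreover have "min s 1 = s" "0 \<le> s * t" using 2 s_range t by auto
        ultimately show ?thesis using a_theta th by simp
      next
        \<comment> \<open>A difference of two functionals from the unit ball has norm at most 2, so
          \<open>s \<le> 2\<close>, and \<open>2 * t \<le> theta N 1\<close> covers exactly this
          range.\<close>
        case 3
        have "theta N u \<le> u * theta N 1" using theta_scale[of 1 u] u by simp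
        then have "2 * t \<le> theta N 1" using u by (simp add: t_def field_simps)
        moreover have "s * t \<le> 2 * t" using s_range t by (intro mult_right_mono)
        ultimately show ?thesis using a_theta 3 th by (simp add: min_def split: if_splits)
      qed
    qed
    \<comment> \<open>Two errors of size \<open>d\<close> and the term
      \<open>(s + t + d) * d \<le> 4 * d\<close> make \<open>6 * d\<close>, at most half of
      \<open>e\<close>.\<close>
    define d where "d = min 1 (e / 12)"
    have d: "0 < d" "d \<le> 1" "12 * d \<le> e" using e by (auto simp: d_def)
    have r123: "strict_mono (\<lambda>n. r (r2 (r3 n)))"
      using r(1) r2 r3 by (simp add: strict_mono_def)
    have "(\<lambda>n. h (xs n)) \<longlonglongrightarrow> 0" using wn h(1) by (simp add: weakly_null_iff)
    then have "(\<lambda>n. h (zs n)) \<longlonglongrightarrow> 0"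
      using LIMSEQ_subseq_LIMSEQ[OF _ r123] by (fastforce simp: zs_def o_def)
    then have "\<forall>\<^sub>F n in sequentially. dist (h (zs n)) 0 < d" using d(1) by (rule tendstoD)
    moreover have "\<forall>\<^sub>F n in sequentially. dist (gs n x) 0 < d"
      using gs_null d(1) by (intro tendstoD) (auto simp: weak_star_null_iff)
    moreover have "\<forall>\<^sub>F n in sequentially. dual_norm N (gs n) < s + d"
      using order_tendstoD(2)[OF s, of "s + d"] d(1) by (simp add: gs_def)
    moreover have "\<forall>\<^sub>F n in sequentially. N (zs n) < t + d"
      using eventually_subseq[OF r123 le[OF d(1)]] by (simp add: zs_def)
    ultimately have "\<forall>\<^sub>F n in sequentially. \<bar>h (zs n)\<bar> < d \<and> \<bar>gs n x\<bar> < d \<and>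
      dual_norm N (gs n) < s + d \<and> N (zs n) < t + d"
      by eventually_elim simp
    then obtain n where n: "\<bar>h (zs n)\<bar> < d" "\<bar>gs n x\<bar> < d" "dual_norm N (gs n) < s + d" "N (zs n) < t + d"
      using eventually_happens'[OF sequentially_bot] by blast
    have gs_lin: "bounded_linear (gs n)" using gs_null by (rule weak_star_null_linear)
    have "1 + theta N u / 2 + e \<le> h x + gs n x + h (zs n) + gs n (zs n)"
      using r(2)[of "r2 (r3 n)"] hs(3)[of "r2 (r3 n)"] hs(1)
      by (simp add: gs_def g_def zs_def linear_simps)
    also have "h x \<le> a" using dual_norm_ge[OF h(1), of x] x by (simp add: a_def)
    also have "gs n (zs n) \<le> (s + d) * (t + d)"
    proof -
      have "gs n (zs n) \<le> dual_norm N (gs n) * N (zs n)" using dual_norm_ge[OF gs_lin, of "zs n"] by simp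
      also have "\<dots> \<le> (s + d) * (t + d)"
        using n s_range d by (intro mult_mono) auto
      finally show ?thesis .
    qed
    also have "(s + d) * (t + d) = s * t + (s + t + d) * d" by (simp add: algebra_simps)
    also have "(s + t + d) * d \<le> 4 * d" using s_range t d by (intro mult_right_mono) auto
    finally have "1 + theta N u / 2 + e \<le> a + gs n x + h (zs n) + (s * t + 4 * d)" by simp
    then show False using ast n(1,2) d by linarith
  qed
  then show ?thesis by (simp add: t_def)
qed

section \<open>Isometries\<close>

context
  fixes T :: "'a::real_vector \<Rightarrow> 'b::real_vector" and N :: "'b \<Rightarrow> real"
  assumes lin: "linear T" and bij: "bij T"
begin

lemma dual_pullback_iff: "(\<lambda>x. f (T x)) \<in> dual (\<lambda>x. N (T x)) \<longleftrightarrow> f \<in> dual N"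
proof -
  have all_iff: "(\<forall>x. P (T x)) \<longleftrightarrow> (\<forall>y. P y)" for P using bij by (metis bij_pointE)
  have "linear (\<lambda>x. f (T x)) \<longleftrightarrow> linear f"
  proof
    assume f: "linear (\<lambda>x. f (T x))"
    have T: "T (inv T y) = y" for y using bij by (simp add: bij_is_surj surj_f_inv_f)
    show "linear f"
    proof (rule linearI)
      fix x y and c :: real
      have "f (x + y) = f (T (inv T x + inv T y))" by (simp add: linear_add[OF lin] T)
      also have "\<dots> = f (T (inv T x)) + f (T (inv T y))" using linear_add[OF f] .
      finally show "f (x + y) = f x + f y" by (simp add: T)
      have "f (c *\<^sub>R x) = f (T (c *\<^sub>R inv T x))" by (simp add: linear_scale[OF lin] T)
      also have "\<dots> = c *\<^sub>R f (T (inv T x))" using linear_scale[OF f] .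
      finally show "f (c *\<^sub>R x) = c *\<^sub>R f x" by (simp add: T)
    qed
  qed (use linear_compose[OF lin] in \<open>simp add: o_def\<close>)
  then show ?thesis
    by (simp add: dual_def bounded_lin_def all_iff[of "\<lambda>y. \<bar>f y\<bar> \<le> _ * N y"])
qed

lemma dual_norm_pullback: "dual_norm (\<lambda>x. N (T x)) (\<lambda>x. f (T x)) = dual_norm N f"
proof -
  have "{y. N y \<le> 1} = T ` {x. N (T x) \<le> 1}" using bij by (force simp: bij_def dest: surjD)
  then show ?thesis by (simp add: dual_norm_def opnorm_def image_image)
qed

lemma weakly_null_pullback: "weakly_null (\<lambda>x. N (T x)) xs \<longleftrightarrow> weakly_null N (\<lambda>n. T (xs n))"
  unfolding weakly_null_def
proof (intro iffI ballI)
  fix f assume *: "\<forall>f\<in>dual (\<lambda>x. N (T x)). (\<lambda>n. f (xs n)) \<longlonglongrightarrow> 0" and "f \<in> dual N"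
  then have "(\<lambda>x. f (T x)) \<in> dual (\<lambda>x. N (T x))" using dual_pullback_iff by blast
  with * show "(\<lambda>n. f (T (xs n))) \<longlonglongrightarrow> 0" by fast
next
  fix g assume *: "\<forall>f\<in>dual N. (\<lambda>n. f (T (xs n))) \<longlonglongrightarrow> 0" and "g \<in> dual (\<lambda>x. N (T x))"
  then have "(\<lambda>y. g (inv T y)) \<in> dual N" using dual_pullback_iff[of "\<lambda>y. g (inv T y)"] bij by (simp add: bij_is_inj)
  with * have "(\<lambda>n. g (inv T (T (xs n)))) \<longlonglongrightarrow> 0" by fast
  then show "(\<lambda>n. g (xs n)) \<longlonglongrightarrow> 0" using bij by (simp add: bij_is_inj)
qed

lemma weak_star_null_pullback:
  "weak_star_null (\<lambda>x. N (T x)) (\<lambda>n x. fs n (T x)) \<longleftrightarrow> weak_star_null N fs"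
proof -
  have all_iff: "(\<forall>x. P (T x)) \<longleftrightarrow> (\<forall>y. P y)" for P using bij by (metis bij_pointE)
  show ?thesis
    by (simp add: weak_star_null_def dual_pullback_iff all_iff[of "\<lambda>y. (\<lambda>n. fs n y) \<longlonglongrightarrow> 0"])
qed

lemma rho_pullback: "rho (\<lambda>x. N (T x)) = rho N"
proof
  fix \<sigma>
  define P where "P c y ys \<longleftrightarrow> (N y = 1 \<longrightarrow> weakly_null N ys \<longrightarrow>
       limsup (\<lambda>n. ereal (N (ys n))) \<le> ereal \<sigma> \<longrightarrow>
       limsup (\<lambda>n. ereal (N (y + ys n))) \<le> ereal (1 + c))" for c y ys
  have "(\<forall>x xs. P c (T x) (\<lambda>n. T (xs n))) \<longleftrightarrow> (\<forall>y ys. P c y ys)" for c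
  proof (intro iffI allI)
    fix y ys assume "\<forall>x xs. P c (T x) (\<lambda>n. T (xs n))"
    from this[rule_format, of "inv T y" "\<lambda>n. inv T (ys n)"]
    show "P c y ys" using bij by (simp add: bij_is_surj surj_f_inv_f)
  qed simp
  then show "rho (\<lambda>x. N (T x)) \<sigma> = rho N \<sigma>"
    by (simp add: rho_def weakly_null_pullback linear_add[OF lin] P_def)
qed

lemma theta_pullback: "theta (\<lambda>x. N (T x)) = theta N"
proof
  fix \<tau>
  define P where "P c f fs \<longleftrightarrow> (f \<in> dual N \<longrightarrow> dual_norm N f = 1 \<longrightarrow> weak_star_null N fs \<longrightarrow>
       ereal \<tau> \<le> liminf (\<lambda>n. ereal (dual_norm N (fs n))) \<longrightarrow>
       ereal (1 + c) \<le> liminf (\<lambda>n. ereal (dual_norm N (\<lambda>x. f x + fs n x))))" for c f fs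
  define M where "M = (\<lambda>x. N (T x))"
  define P' where "P' c f fs \<longleftrightarrow> (f \<in> dual M \<longrightarrow> dual_norm M f = 1 \<longrightarrow> weak_star_null M fs \<longrightarrow>
       ereal \<tau> \<le> liminf (\<lambda>n. ereal (dual_norm M (fs n))) \<longrightarrow>
       ereal (1 + c) \<le> liminf (\<lambda>n. ereal (dual_norm M (\<lambda>x. f x + fs n x))))" for c f fs
  have P'_iff: "P' c (\<lambda>x. f (T x)) (\<lambda>n x. fs n (T x)) \<longleftrightarrow> P c f fs" for c f fs
  proof -
    have "dual_norm M (\<lambda>x. f (T x) + fs n (T x)) = dual_norm N (\<lambda>y. f y + fs n y)" for n
      unfolding M_def by (rule dual_norm_pullback)
    then show ?thesis
      by (simp add: P_def P'_def dual_pullback_iff dual_norm_pullback weak_star_null_pullback M_def)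
  qed
  have "(\<forall>f fs. P' c f fs) \<longleftrightarrow> (\<forall>f fs. P c f fs)" for c
  proof (intro iffI allI)
    fix f fs assume "\<forall>f fs. P c f fs"
    then have "P' c (\<lambda>x. f (inv T (T x))) (\<lambda>n x. fs n (inv T (T x)))"
      using P'_iff[of c "\<lambda>y. f (inv T y)" "\<lambda>n y. fs n (inv T y)"] by simp
    then show "P' c f fs" using bij by (simp add: bij_is_inj)
  qed (use P'_iff in blast)
  then show "theta (\<lambda>x. N (T x)) \<tau> = theta N \<tau>"
    by (simp add: theta_def P_def P'_def M_def)
qed

end

section \<open>Renormings at controlled Banach--Mazur distance\<close>

lemma opnorm_bound:
  assumes M: "is_norm M" and N: "is_norm N" and T: "bounded_lin M N T"
  shows "N (T x) \<le> opnorm M N T * M x"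
proof -
  have lin: "linear T" using T by (simp add: bounded_lin_def)
  obtain C where C: "\<And>x. N (T x) \<le> C * M x" using T by (auto simp: bounded_lin_def)
  note M_nonneg = is_normD(5)[OF M]
  show ?thesis
  proof (cases "x = 0")
    case True
    then show ?thesis using is_normD(1)[OF M] is_normD(1)[OF N] lin by (simp add: linear_0)
  next
    case False
    then have pos: "0 < M x" using is_normD(2)[OF M, of x] M_nonneg[of x] by linarith
    have bdd: "bdd_above ((\<lambda>x. N (T x)) ` {x. M x \<le> 1})"
    proof (rule bdd_aboveI2)
      fix y assume "y \<in> {x. M x \<le> 1}"
      then have "\<bar>C\<bar> * M y \<le> \<bar>C\<bar> * 1" by (intro mult_left_mono) auto
      then show "N (T y) \<le> \<bar>C\<bar>"
        using C[of y] mult_right_mono[OF abs_ge_self[of C] M_nonneg[of y]] by linarith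
    qed
    have "M (x /\<^sub>R M x) = 1" using pos by (simp add: is_normD(4)[OF M])
    then have "N (T (x /\<^sub>R M x)) \<le> opnorm M N T"
      unfolding opnorm_def by (intro cSUP_upper bdd) simp
    then have "inverse (M x) * N (T x) \<le> opnorm M N T"
      using pos by (simp add: is_normD(4)[OF N] linear_scale[OF lin])
    then show ?thesis using pos by (simp add: field_simps)
  qed
qed

lemma is_norm_pullback:
  assumes N: "is_norm N" and T: "linear T" "inj T"
  shows "is_norm (\<lambda>x. N (T x))"
proof -
  have "T x = 0 \<longleftrightarrow> x = 0" for x
    using T linear_0[OF T(1)] by (metis injD)
  then show ?thesis
    unfolding is_norm_def
    by (simp add: is_normD(2-4)[OF N] linear_add[OF T(1)] linear_scale[OF T(1)])
qed

text \<open>Scaling the isomorphism by the norm of its inverse puts the entire distortion into the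
  upper bound and leaves the lower constant 1. A strict inequality is assumed so that some
  isomorphism achieves it even if the infimum is not attained.\<close>

lemma equivalent_norm_of_banach_mazur:
  fixes N :: "'a::real_normed_vector \<Rightarrow> real"
  assumes N: "is_norm N" and d: "banach_mazur (norm :: 'a \<Rightarrow> real) N < ereal K"
    and nontrivial: "\<exists>x :: 'a. x \<noteq> 0"
  shows "\<exists>M :: 'a \<Rightarrow> real. is_norm M \<and> (\<forall>x. norm x \<le> M x \<and> M x \<le> K * norm x) \<and>
    rho M = rho N \<and> theta M = theta N"
proof -
  obtain T :: "'a \<Rightarrow> 'a" where T: "bij T" "bounded_lin norm N T" "bounded_lin N norm (inv T)"
    and K: "opnorm norm N T * opnorm N norm (inv T) < K"
    using d by (auto simp: banach_mazur_def INF_less_iff)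
  define B where "B = opnorm N norm (inv T)"
  have A: "N (T x) \<le> opnorm norm N T * norm x" for x
    using opnorm_bound[OF is_norm_norm N T(2)] .
  have B: "norm x \<le> B * N (T x)" for x
    using opnorm_bound[OF N is_norm_norm T(3), of "T x"] T(1) by (simp add: B_def bij_is_inj)
  note N_nonneg = is_normD(5)[OF N]
  obtain x :: 'a where "x \<noteq> 0" using nontrivial by blast
  then have "0 < B * N (T x)" using B[of x] by (metis less_le_trans zero_less_norm_iff)
  then have B0: "0 < B" using N_nonneg[of "T x"] by (simp add: zero_less_mult_iff)
  define S where "S x = B *\<^sub>R T x" for x
  have lin_T: "linear T" using T(2) by (simp add: bounded_lin_def)
  have S: "linear S" "bij S"
  proof -
    show "linear S" unfolding S_def using linear_compose_scale_right[OF lin_T] by simp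
    have "bij (\<lambda>y :: 'a. B *\<^sub>R y)"
      by (rule o_bij[of "\<lambda>y. y /\<^sub>R B"]) (use B0 in \<open>auto simp: o_def fun_eq_iff\<close>)
    from bij_comp[OF T(1) this] show "bij S" by (simp add: S_def[abs_def] o_def)
  qed
  have NS: "N (S x) = B * N (T x)" for x using B0 by (simp add: S_def is_normD(4)[OF N])
  show ?thesis
  proof (intro exI[of _ "\<lambda>x. N (S x)"] conjI allI)
    show "is_norm (\<lambda>x. N (S x))" by (rule is_norm_pullback[OF N S(1) bij_is_inj[OF S(2)]])
    show "norm x \<le> N (S x)" for x using B NS by simp
    show "N (S x) \<le> K * norm x" for x
    proof -
      have "N (S x) \<le> B * (opnorm norm N T * norm x)"
        unfolding NS using A B0 by (intro mult_left_mono) auto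
      also have "\<dots> = (opnorm norm N T * B) * norm x" by simp
      also have "\<dots> \<le> K * norm x" using K by (intro mult_right_mono) (auto simp: B_def)
      finally show ?thesis .
    qed
  qed (use rho_pullback[OF S] theta_pullback[OF S] in auto)
qed

section \<open>Duality of Young functions\<close>

lemma dual_young_ge:
  assumes f: "\<And>t. 0 \<le> t \<Longrightarrow> 0 \<le> f t" and s: "0 \<le> s" and t: "0 \<le> t" "t \<le> 1"
  shows "s * t - f t \<le> dual_young f s"
  unfolding dual_young_def
proof (rule cSUP_upper)
  show "bdd_above ((\<lambda>t. s * t - f t) ` {0..1})"
  proof (rule bdd_aboveI2)
    fix t :: real assume t: "t \<in> {0..1}"
    then have "s * t \<le> s * 1" using s by (intro mult_left_mono) auto
    then show "s * t - f t \<le> s" using f[of t] t by simp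
  qed
qed (use t in auto)

lemma dual_young_le:
  "(\<And>t. 0 \<le> t \<Longrightarrow> t \<le> 1 \<Longrightarrow> s * t - f t \<le> b) \<Longrightarrow> dual_young f s \<le> b"
  unfolding dual_young_def by (intro cSUP_least) auto

lemma mono_on_slope:
  fixes f :: "real \<Rightarrow> real"
  assumes "\<And>l t. 0 \<le> t \<Longrightarrow> 0 < l \<Longrightarrow> l \<le> 1 \<Longrightarrow> f (l * t) \<le> l * f t"
  shows "mono_on {0<..<1} (\<lambda>t. f t / t)"
proof (rule mono_onI)
  fix s t :: real assume st: "s \<in> {0<..<1}" "t \<in> {0<..<1}" "s \<le> t"
  then have "f s \<le> s / t * f t" using assms[of t "s / t"] by simp
  then show "f s / s \<le> f t / t" using st by (simp add: field_simps)
qed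

text \<open>Instantiated twice: with all norms at distance at most 2, which gives
  \<open>\<phi>\<close> and \<open>\<psi>\<close>, and with the original norm alone, which gives
  \<open>\<rho>\<close> and \<open>\<theta>\<close>. In \<open>young\<close> and
  \<open>slope\<close> each \<open>R i\<close> meets only its own \<open>\<Theta> i\<close>.\<close>

locale young_family =
  fixes I :: "'i set" and R \<Theta> :: "'i \<Rightarrow> real \<Rightarrow> real" and F G :: "real \<Rightarrow> real"
  assumes ne: "I \<noteq> {}"
    and R: "\<And>i t. i \<in> I \<Longrightarrow> 0 \<le> t \<Longrightarrow> 0 \<le> R i t" "\<And>i t. i \<in> I \<Longrightarrow> 0 \<le> t \<Longrightarrow> R i t \<le> t"
    and \<Theta>: "\<And>i t. i \<in> I \<Longrightarrow> 0 \<le> t \<Longrightarrow> 0 \<le> \<Theta> i t" "\<And>i t. i \<in> I \<Longrightarrow> 0 \<le> t \<Longrightarrow> \<Theta> i t \<le> t"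
    and R_scale: "\<And>i l t. i \<in> I \<Longrightarrow> 0 \<le> t \<Longrightarrow> 0 < l \<Longrightarrow> l \<le> 1 \<Longrightarrow> R i (l * t) \<le> l * R i t"
    and \<Theta>_scale: "\<And>i l t. i \<in> I \<Longrightarrow> 0 \<le> t \<Longrightarrow> 0 < l \<Longrightarrow> l \<le> 1 \<Longrightarrow> \<Theta> i (l * t) \<le> l * \<Theta> i t"
    and young: "\<And>i \<tau> t. i \<in> I \<Longrightarrow> 0 \<le> \<tau> \<Longrightarrow> \<tau> \<le> 1 \<Longrightarrow> 0 \<le> t \<Longrightarrow> t \<le> 1 \<Longrightarrow>
      \<tau> * t / 4 - R i t \<le> \<Theta> i \<tau>"
    and slope: "\<And>i u. i \<in> I \<Longrightarrow> 0 < u \<Longrightarrow> u \<le> 1 \<Longrightarrow> R i (\<Theta> i u / (2 * u)) \<le> \<Theta> i u / 2"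
    and F: "\<And>t. F t = (INF i\<in>I. R i t)" and G: "\<And>t. G t = (SUP i\<in>I. \<Theta> i t)"
begin

lemma F_le: "i \<in> I \<Longrightarrow> 0 \<le> t \<Longrightarrow> F t \<le> R i t"
  unfolding F by (rule cINF_lower) (use R in \<open>auto intro!: bdd_belowI2\<close>)

lemma F_ge: "(\<And>i. i \<in> I \<Longrightarrow> c \<le> R i t) \<Longrightarrow> c \<le> F t"
  unfolding F using ne by (intro cINF_greatest)

lemma G_ge: "i \<in> I \<Longrightarrow> 0 \<le> t \<Longrightarrow> \<Theta> i t \<le> G t"
  unfolding G by (rule cSUP_upper) (use \<Theta> in \<open>auto intro!: bdd_aboveI2\<close>)

lemma G_le: "(\<And>i. i \<in> I \<Longrightarrow> \<Theta> i t \<le> c) \<Longrightarrow> G t \<le> c"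
  unfolding G using ne by (intro cSUP_least)

lemma F_range: "0 \<le> t \<Longrightarrow> 0 \<le> F t" "0 \<le> t \<Longrightarrow> F t \<le> t"
proof -
  assume t: "0 \<le> t"
  then show "0 \<le> F t" by (intro F_ge R)
  obtain i where "i \<in> I" using ne by blast
  then show "F t \<le> t" using F_le[of i t] R(2)[of i t] t by simp
qed

lemma G_range: "0 \<le> t \<Longrightarrow> 0 \<le> G t" "0 \<le> t \<Longrightarrow> G t \<le> t"
proof -
  assume t: "0 \<le> t"
  then show "G t \<le> t" by (intro G_le \<Theta>)
  obtain i where "i \<in> I" using ne by blast
  then show "0 \<le> G t" using G_ge[of i t] \<Theta>(1)[of i t] t by simp
qed

lemma F_scale:
  assumes "0 \<le> t" "0 < l" "l \<le> 1"
  shows "F (l * t) \<le> l * F t"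
proof -
  have "F (l * t) / l \<le> F t"
  proof (rule F_ge)
    fix i assume i: "i \<in> I"
    have "F (l * t) \<le> l * R i t" using F_le[OF i, of "l * t"] R_scale[OF i, of t l] assms by simp
    then show "F (l * t) / l \<le> R i t" using assms by (simp add: field_simps)
  qed
  then show ?thesis using assms by (simp add: field_simps)
qed

lemma G_scale:
  assumes "0 \<le> t" "0 < l" "l \<le> 1"
  shows "G (l * t) \<le> l * G t"
proof (rule G_le)
  fix i assume i: "i \<in> I"
  have "l * \<Theta> i t \<le> l * G t" using G_ge[OF i] assms by (intro mult_left_mono) auto
  then show "\<Theta> i (l * t) \<le> l * G t" using \<Theta>_scale[OF i assms] by linarith
qed

lemma mono_on_slopes: "mono_on {0<..<1} (\<lambda>t. F t / t)" "mono_on {0<..<1} (\<lambda>t. G t / t)"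
  using F_scale G_scale by (auto intro: mono_on_slope)

text \<open>The two moduli enter additively, so bounding \<open>\<Theta> i\<close> by
  \<open>G\<close> first frees the index, and the infimum over \<open>R i\<close> can then be
  taken.\<close>

lemma young_F_G:
  assumes "0 \<le> \<tau>" "\<tau> \<le> 1" "0 \<le> t" "t \<le> 1"
  shows "\<tau> * t / 4 \<le> F t + G \<tau>"
proof -
  have "\<tau> * t / 4 - G \<tau> \<le> F t"
  proof (rule F_ge)
    fix i assume "i \<in> I"
    then show "\<tau> * t / 4 - G \<tau> \<le> R i t" using young[of i \<tau> t] G_ge[of i \<tau>] assms by linarith
  qed
  then show ?thesis by simp
qed

lemma G_le_dual_young_F:
  assumes u: "0 \<le> u" "u \<le> 1"
  shows "G u \<le> dual_young F (4 * u)"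
proof (cases "u = 0")
  case True
  then show ?thesis using dual_young_ge[of F 0 0] F_range(1) F_range(2)[of 0] G_range(2)[of 0] by simp
next
  case False
  show ?thesis
  proof (rule G_le)
    fix i assume i: "i \<in> I"
    \<comment> \<open>At this \<open>t\<close> the linear term \<open>4 * u * t\<close> is twice
      \<open>\<Theta> i u\<close>, while \<open>slope\<close> limits the subtracted value to half of
      \<open>\<Theta> i u\<close>.\<close>
    define t where "t = \<Theta> i u / (2 * u)"
    have "0 \<le> \<Theta> i u" "\<Theta> i u \<le> u" using \<Theta> i u by auto
    then have t: "0 \<le> t" "t \<le> 1" "4 * u * t = 2 * \<Theta> i u" using False u by (auto simp: t_def field_simps)
    have "F t \<le> \<Theta> i u / 2" using F_le[OF i t(1)] slope[OF i, of u] False u by (simp add: t_def)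
    moreover have "4 * u * t - F t \<le> dual_young F (4 * u)"
      using F_range u t by (intro dual_young_ge) auto
    ultimately show "\<Theta> i u \<le> dual_young F (4 * u)" using t(3) \<open>0 \<le> \<Theta> i u\<close> by simp
  qed
qed

text \<open>Increasing slopes confine the supremum to arguments up to \<open>t\<close>: beyond
  \<open>t\<close>, \<open>F\<close> lies above the line through the origin of slope
  \<open>F t / t\<close>, so the difference is not positive there.\<close>

lemma dual_young_F_slope:
  assumes t: "0 < t"
  shows "dual_young F (F t / t) \<le> F t"
proof (rule dual_young_le)
  fix r :: real assume r: "0 \<le> r" "r \<le> 1"
  have v: "0 \<le> F t / t" using F_range t by simp
  show "F t / t * r - F r \<le> F t"
  proof (cases "r \<le> t")
    case True
    then have "F t / t * r \<le> F t / t * t" using v by (intro mult_left_mono)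
    then show ?thesis using F_range(1)[OF r(1)] t by simp
  next
    case False
    then have "F t \<le> t / r * F r" using F_scale[of r "t / r"] t by simp
    then have "F t / t * r \<le> F r" using t False by (simp add: field_simps)
    then show ?thesis using F_range(1)[of t] t by simp
  qed
qed

lemma equivalent_G_dual_F: "equivalent 4 G (dual_young F)"
  unfolding equivalent_def dominates_def
proof (intro conjI ballI)
  fix \<tau> :: real assume "\<tau> \<in> {0..1}"
  then have \<tau>: "0 \<le> \<tau>" "\<tau> \<le> 1" by auto
  show "dual_young F (\<tau> / 4) \<le> G \<tau>"
    by (rule dual_young_le) (use young_F_G[OF \<tau>] in \<open>simp add: algebra_simps\<close>)
  show "G (\<tau> / 4) \<le> dual_young F \<tau>" using G_le_dual_young_F[of "\<tau> / 4"] \<tau> by simp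
qed

lemma equivalent_F_dual_G: "equivalent 8 F (dual_young G)"
  unfolding equivalent_def dominates_def
proof (intro conjI ballI)
  fix \<tau> :: real assume "\<tau> \<in> {0..1}"
  then have \<tau>: "0 \<le> \<tau>" "\<tau> \<le> 1" by auto
  show "dual_young G (\<tau> / 8) \<le> F \<tau>"
  proof (rule dual_young_le)
    fix s :: real assume s: "0 \<le> s" "s \<le> 1"
    then show "\<tau> / 8 * s - G s \<le> F \<tau>"
      using young_F_G[OF s \<tau>] mult_nonneg_nonneg[OF s(1) \<tau>(1)] by (simp add: mult.commute)
  qed
  show "F (\<tau> / 8) \<le> dual_young G \<tau>"
  proof (cases "\<tau> = 0")
    case True
    then show ?thesis using dual_young_ge[of G 0 0] G_range(1) G_range(2)[of 0] F_range(2)[of 0] by simp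
  next
    case False
    define t where "t = \<tau> / 8"
    \<comment> \<open>The slope of \<open>F\<close> at \<open>t\<close> supplies the test point
      \<open>v / 4\<close>: there \<open>G (v / 4) \<le> dual_young F v \<le> F t\<close>, whereas
      \<open>\<tau> * (v / 4) = 2 * F t\<close> because \<open>\<tau> = 8 * t\<close>. One
      \<open>F t\<close> is left.\<close>
    define v where "v = F t / t"
    have t: "0 < t" "t \<le> 1" "\<tau> = 8 * t" using \<tau> False by (auto simp: t_def)
    have v: "0 \<le> v" "v \<le> 1" "t * v = F t" using F_range[of t] t by (auto simp: v_def field_simps)
    have "\<tau> * (v / 4) - G (v / 4) \<le> dual_young G \<tau>"
      using G_range \<tau> v by (intro dual_young_ge) auto
    moreover have "G (v / 4) \<le> F t"
      using G_le_dual_young_F[of "v / 4"] dual_young_F_slope[OF t(1)] v by (simp add: v_def)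
    moreover have "\<tau> * (v / 4) = 2 * F t" using t(3) v(3) by simp
    ultimately show ?thesis by (simp add: t_def)
  qed
qed

end

section \<open>The convex Szlenk index\<close>

lemma separable_norm_of_bounds:
  fixes M :: "'a::real_normed_vector \<Rightarrow> real"
  assumes "is_norm M" "\<And>x. norm x \<le> M x" "\<And>x. M x \<le> K * norm x"
    and "\<nexists>B :: 'a set. finite B \<and> span B = UNIV" "separable_space (euclidean :: 'a topology)"
  shows "separable_norm M"
proof unfold_locales
  show "\<exists>c>0. \<forall>x. c * norm x \<le> M x" using assms(2) by (intro exI[of _ 1]) simp
qed (use assms in auto)

text \<open>A surviving \<open>f\<close> is a weak* limit of points of \<open>S\<close> at distance
  more than \<open>t / 2\<close>; otherwise the triangle inequality through \<open>f\<close> gives a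
  neighbourhood of diameter at most \<open>t\<close>. Passing to the dual norm of \<open>N\<close>
  divides by \<open>K\<close>, whence \<open>t / (2 * K)\<close>.\<close>

lemma (in separable_norm) szlenk_deriv_subset:
  assumes bounds: "\<And>x. norm x \<le> N x" "\<And>x. N x \<le> K * norm x" and K: "0 < K"
    and t: "0 \<le> t" "t / (2 * K) \<le> 1" and r: "r \<le> 1"
    and S: "S \<subseteq> {f. bounded_linear f \<and> dual_norm N f \<le> r}"
  shows "szlenk_deriv norm t S \<subseteq> {f. bounded_linear f \<and> dual_norm N f \<le> r - theta N (t / (2 * K))}"
proof
  interpret n: separable_norm "norm :: 'a \<Rightarrow> real"
    by (rule separable_norm_of_bounds[of _ 1]) (use infinite_dim separable in \<open>auto simp: is_norm_norm\<close>)
  fix f assume f: "f \<in> szlenk_deriv norm t S"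
  then have fS: "f \<in> S" by (simp add: szlenk_deriv_def)
  with S have lin_f: "bounded_linear f" and f_le: "dual_norm N f \<le> r" by auto
  obtain d :: "nat \<Rightarrow> 'a" where d: "closure (range d) = UNIV" using dense_sequence by blast
  \<comment> \<open>Each stage controls finitely many points of the dense sequence; boundedness of
    \<open>S\<close> extends the convergence to the whole space.\<close>
  have "\<exists>g\<in>S. (\<forall>k\<le>n. \<bar>g (d k) - f (d k)\<bar> < inverse (real (Suc n))) \<and>
    t / 2 < dual_norm norm (\<lambda>x. g x - f x)" for n
  proof (rule ccontr)
    assume neg: "\<not> ?thesis"
    define U where "U = (\<Inter>k\<in>{..n}. {g. \<bar>g (d k) - f (d k)\<bar> < inverse (real (Suc n))})"
    define V where "V = dual norm \<inter> U"
    have "open U"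
      unfolding U_def by (intro open_INT ballI open_Collect_less continuous_intros) auto
    then have "openin (weak_star norm) V" by (auto simp: V_def weak_star_def openin_open)
    moreover have "\<forall>g\<in>V \<inter> S. \<forall>h\<in>V \<inter> S. dual_norm norm (\<lambda>x. g x - h x) \<le> t"
    proof (intro ballI)
      fix g h assume gh: "g \<in> V \<inter> S" "h \<in> V \<inter> S"
      have small: "dual_norm norm (\<lambda>x. g x - f x) \<le> t / 2" if "g \<in> V \<inter> S" for g
        using neg that by (force simp: V_def U_def not_less)
      have lin: "bounded_linear g" "bounded_linear h" using gh S by auto
      have "(\<lambda>x. g x - h x) = (\<lambda>x. (g x - f x) - (h x - f x))" by simp
      then have "dual_norm norm (\<lambda>x. g x - h x)
        \<le> dual_norm norm (\<lambda>x. g x - f x) + dual_norm norm (\<lambda>x. h x - f x)"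
        using n.dual_norm_triangle_diff[OF bounded_linear_sub[OF lin(1) lin_f] bounded_linear_sub[OF lin(2) lin_f]]
        by simp
      then show "dual_norm norm (\<lambda>x. g x - h x) \<le> t" using small[OF gh(1)] small[OF gh(2)] by linarith
    qed
    moreover have "f \<in> V" using lin_f by (auto simp: V_def U_def n.dual_eq)
    ultimately show False using f by (auto simp: szlenk_deriv_def)
  qed
  then obtain gs where gs: "\<And>n. gs n \<in> S" "\<And>n k. k \<le> n \<Longrightarrow> \<bar>gs n (d k) - f (d k)\<bar> < inverse (real (Suc n))"
    "\<And>n. t / 2 < dual_norm norm (\<lambda>x. gs n x - f x)"
    by metis
  have lin_gs: "bounded_linear (gs n)" and gs_le: "dual_norm N (gs n) \<le> r" for n using gs(1) S by auto
  define fs where "fs n = (\<lambda>x. gs n x - f x)" for n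
  have lin_fs: "bounded_linear (fs n)" for n unfolding fs_def using lin_gs lin_f by (rule bounded_linear_sub)
  have null: "weak_star_null N fs"
    unfolding weak_star_null_iff
  proof (intro conjI allI lin_fs)
    fix x
    show "(\<lambda>n. fs n x) \<longlonglongrightarrow> 0"
    proof (rule tendsto_0_from_dense[OF lin_fs _ d])
      fix n x
      have "dual_norm N (fs n) \<le> 2"
        unfolding fs_def using dual_norm_triangle_diff[OF lin_gs lin_f, of n] gs_le[of n] f_le r by linarith
      then have "dual_norm N (fs n) * N x \<le> 2 * (K * norm x)"
        using bounds(2)[of x] by (intro mult_mono) auto
      then show "\<bar>fs n x\<bar> \<le> 2 * K * norm x" using dual_norm_ge[OF lin_fs, of n x] by simp
    next
      fix v assume "v \<in> range d"
      then obtain k where k: "v = d k" by blast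
      have "\<forall>\<^sub>F n in sequentially. norm (fs n v) \<le> inverse (real (Suc n))"
        using eventually_ge_at_top[of k] by eventually_elim (use gs(2) in \<open>force simp: k fs_def\<close>)
      then show "(\<lambda>n. fs n v) \<longlonglongrightarrow> 0" by (rule Lim_null_comparison) (rule LIMSEQ_inverse_real_of_nat)
    qed
  qed
  have norm_fs: "t / (2 * K) < dual_norm N (fs n)" for n
  proof -
    have "\<bar>fs n x\<bar> \<le> K * dual_norm N (fs n) * norm x" for x
      using dual_norm_ge[OF lin_fs, of n x] mult_left_mono[OF bounds(2)[of x] dual_norm_nonneg[OF lin_fs, of n]]
      by (simp add: mult_ac)
    then have "dual_norm norm (fs n) \<le> K * dual_norm N (fs n)"
      using n.dual_norm_le_iff[OF lin_fs] dual_norm_nonneg[OF lin_fs] K by auto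
    then show ?thesis using gs(3)[of n] K by (simp add: fs_def field_simps)
  qed
  have "dual_norm N f + theta N (t / (2 * K)) \<le> r"
  proof (rule field_le_epsilon)
    fix e :: real assume e: "0 < e"
    have "\<forall>\<^sub>F n in sequentially. dual_norm N f + theta N (t / (2 * K)) - e < dual_norm N (\<lambda>x. f x + fs n x)"
    proof (rule theta_lower_subunit[OF _ t(2) lin_f _ null _ e])
      show "\<forall>\<^sub>F n in sequentially. t / (2 * K) - d < dual_norm N (fs n)" if "0 < d" for d
      proof (intro always_eventually allI)
        show "t / (2 * K) - d < dual_norm N (fs n)" for n using norm_fs[of n] that by linarith
      qed
    qed (use t K f_le r in auto)
    then obtain n where "dual_norm N f + theta N (t / (2 * K)) - e < dual_norm N (\<lambda>x. f x + fs n x)"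
      using eventually_happens'[OF sequentially_bot] by blast
    then show "dual_norm N f + theta N (t / (2 * K)) \<le> r + e" using gs_le[of n] by (simp add: fs_def)
  qed
  then show "f \<in> {f. bounded_linear f \<and> dual_norm N f \<le> r - theta N (t / (2 * K))}" using lin_f by simp
qed

text \<open>For \<open>0 \<le> r\<close> membership is a family of closed pointwise conditions.
  Negative \<open>r\<close> must be covered because the radii shrink with each derivation and drop
  below zero.\<close>

lemma (in equivalent_norm) closedin_weak_star_dual_ball:
  "closedin (top_of_set {f. bounded_linear f}) {f. bounded_linear f \<and> dual_norm N f \<le> r}"
proof (cases "0 \<le> r")
  case True
  have "closed {f :: 'a \<Rightarrow> real. \<forall>x. \<bar>f x\<bar> \<le> r * N x}"
    by (intro closed_Collect_all closed_Collect_le continuous_intros) auto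
  moreover have "{f. bounded_linear f \<and> dual_norm N f \<le> r}
    = {f. bounded_linear f} \<inter> {f. \<forall>x. \<bar>f x\<bar> \<le> r * N x}"
    using dual_norm_le_iff[OF _ True] by auto
  ultimately show ?thesis by (auto simp: closedin_closed)
next
  case False
  then have empty: "{f. bounded_linear f \<and> dual_norm N f \<le> r} = {}" using dual_norm_nonneg by fastforce
  show ?thesis unfolding empty by simp
qed

lemma (in equivalent_norm) fun_convex_dual_ball: "fun_convex {f. bounded_linear f \<and> dual_norm N f \<le> r}"
  unfolding fun_convex_def
proof (intro ballI allI impI CollectI conjI)
  fix f g and u v :: real
  assume fg: "f \<in> {f. bounded_linear f \<and> dual_norm N f \<le> r}" "g \<in> {f. bounded_linear f \<and> dual_norm N f \<le> r}"
    and uv: "0 \<le> u" "0 \<le> v" "u + v = 1"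
  then have lin: "bounded_linear (\<lambda>x. u * f x)" "bounded_linear (\<lambda>x. v * g x)"
    by (auto intro: bounded_linear_const_mult)
  then show "bounded_linear (\<lambda>x. u * f x + v * g x)" by (rule bounded_linear_add)
  have "dual_norm N (\<lambda>x. u * f x + v * g x) \<le> u * dual_norm N f + v * dual_norm N g"
    using dual_norm_triangle[OF lin] fg uv by (simp add: dual_norm_scale)
  also have "\<dots> \<le> u * r + v * r" using fg uv by (intro add_mono mult_left_mono) auto
  also have "\<dots> = r" using uv(3) by (simp flip: distrib_right)
  finally show "dual_norm N (\<lambda>x. u * f x + v * g x) \<le> r" .
qed

text \<open>Diameters are measured in the original dual norm, but the containing sets are dual balls
  of \<open>N\<close>. These are weak* closed and convex, so the hull stays inside them, and a
  negative radius leaves nothing.\<close>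

lemma (in separable_norm) convex_szlenk_deriv_iterate_empty:
  assumes bounds: "\<And>x. norm x \<le> N x" "\<And>x. N x \<le> K * norm x" and K: "0 < K"
    and t: "0 \<le> t" "t / (2 * K) \<le> 1" and n: "1 < real n * theta N (t / (2 * K))"
  shows "(convex_szlenk_deriv norm t ^^ n) (dual_ball (norm :: 'a \<Rightarrow> real)) = {}"
proof -
  interpret n: separable_norm "norm :: 'a \<Rightarrow> real"
    by (rule separable_norm_of_bounds[of _ 1]) (use infinite_dim separable in \<open>auto simp: is_norm_norm\<close>)
  define \<theta> where "\<theta> = theta N (t / (2 * K))"
  have \<theta>: "0 \<le> \<theta>" unfolding \<theta>_def using t K by (intro theta_nonneg) simp
  have "(convex_szlenk_deriv norm t ^^ k) (dual_ball (norm :: 'a \<Rightarrow> real))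
    \<subseteq> {f. bounded_linear f \<and> dual_norm N f \<le> 1 - real k * \<theta>}" for k
  proof (induction k)
    case 0
    \<comment> \<open>A larger norm on the space has a smaller dual norm, so the initial ball
      fits.\<close>
    have "dual_norm N f \<le> dual_norm norm f" if f: "bounded_linear f" for f
    proof -
      have "\<bar>f x\<bar> \<le> dual_norm norm f * N x" for x
        using n.dual_norm_ge[OF f, of x] mult_left_mono[OF bounds(1)[of x] n.dual_norm_nonneg[OF f]] by simp
      then show ?thesis using dual_norm_le_iff[OF f] n.dual_norm_nonneg[OF f] by auto
    qed
    then show ?case by (force simp: dual_ball_def n.dual_eq)
  next
    case (Suc k)
    define r where "r = 1 - real k * \<theta>"
    have "szlenk_deriv norm t ((convex_szlenk_deriv norm t ^^ k) (dual_ball norm))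
      \<subseteq> {f. bounded_linear f \<and> dual_norm N f \<le> r - \<theta>}"
      unfolding \<theta>_def
      by (rule szlenk_deriv_subset[OF bounds K t _ Suc[folded r_def]]) (use \<theta> in \<open>simp add: r_def\<close>)
    then have "(convex_szlenk_deriv norm t ^^ Suc k) (dual_ball norm)
      \<subseteq> {f. bounded_linear f \<and> dual_norm N f \<le> r - \<theta>}"
      unfolding funpow.simps o_def convex_szlenk_deriv_def[of norm t "(convex_szlenk_deriv norm t ^^ k) _"]
      by (rule hull_minimal)
        (use closedin_weak_star_dual_ball fun_convex_dual_ball in \<open>auto simp: weak_star_def n.dual_eq\<close>)
    then show ?case by (simp add: r_def algebra_simps)
  qed
  note subset = this[of n]
  have "\<not> (bounded_linear f \<and> dual_norm N f \<le> 1 - real n * \<theta>)" for f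
    using dual_norm_nonneg[of f] n by (auto simp: \<theta>_def)
  with subset show ?thesis by auto
qed

section \<open>Norms within distance 2 and the final assembly\<close>

lemma banach_norm_norm: "banach_norm (norm :: 'a::banach \<Rightarrow> real)"
proof -
  have "complete (UNIV :: 'a set)" by (rule complete_UNIV)
  then have "Metric_space.mcomplete (UNIV :: 'a set) dist" using mcomplete_iff_complete by blast
  then show ?thesis by (simp add: banach_norm_def is_norm_norm dist_norm[abs_def])
qed

text \<open>The identity has distortion at most 1. The bound puts the original norm into the family
  defining \<open>\<phi>\<close> and \<open>\<psi>\<close>, which is therefore nonempty.\<close>

lemma banach_mazur_norm_self: "banach_mazur (norm :: 'a::real_normed_vector \<Rightarrow> real) (norm :: 'a \<Rightarrow> real) \<le> 2"
proof -
  have id: "bounded_lin norm norm (id :: 'a \<Rightarrow> 'a)"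
    by (auto simp: bounded_lin_def linear_id[unfolded id_def] id_def intro!: exI[of _ 1])
  have "opnorm norm norm (id :: 'a \<Rightarrow> 'a) \<le> 1"
    unfolding opnorm_def by (intro cSUP_least) (auto intro: exI[of _ 0])
  moreover have "0 \<le> opnorm norm norm (id :: 'a \<Rightarrow> 'a)"
    unfolding opnorm_def by (rule cSUP_upper2[of _ _ 0]) (auto intro!: bdd_aboveI[of _ 1])
  ultimately have "opnorm norm norm (id :: 'a \<Rightarrow> 'a) * opnorm norm norm (id :: 'a \<Rightarrow> 'a) \<le> 2"
    using mult_mono[of "opnorm norm norm (id :: 'a \<Rightarrow> 'a)" 1 "opnorm norm norm (id :: 'a \<Rightarrow> 'a)" 1] by simp
  then have le: "ereal (opnorm norm norm (id :: 'a \<Rightarrow> 'a) * opnorm norm norm (inv (id :: 'a \<Rightarrow> 'a))) \<le> 2"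
    by simp
  show ?thesis
    unfolding banach_mazur_def by (rule INF_lower2[where i = id]) (use id le in simp_all)
qed

theorem proposition2p8:
  fixes \<rho> \<theta> \<phi> \<psi> :: "real \<Rightarrow> real"
  assumes separable: "separable_space (euclidean :: 'a::banach topology)"
    and infinite_dim: "\<nexists>B :: 'a set. finite B \<and> span B = UNIV"
    and no_ell1: "\<not> contains_ell1 (norm :: 'a \<Rightarrow> real)"
    and rho: "\<rho> = rho (norm :: 'a \<Rightarrow> real)"
    and theta: "\<theta> = theta (norm :: 'a \<Rightarrow> real)"
    and phi: "\<phi> = phi (norm :: 'a \<Rightarrow> real)"
    and psi: "\<psi> = psi (norm :: 'a \<Rightarrow> real)"
  shows
    "(mono_on {0<..<1} (\<lambda>t. \<rho> t / t) \<and> mono_on {0<..<1} (\<lambda>t. \<theta> t / t) \<and>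
      mono_on {0<..<1} (\<lambda>t. \<phi> t / t) \<and> mono_on {0<..<1} (\<lambda>t. \<psi> t / t)) \<and>
     (equivalent 4 \<theta> (dual_young \<rho>) \<and> equivalent 4 \<psi> (dual_young \<phi>)) \<and>
     (equivalent 8 \<rho> (dual_young \<theta>) \<and> equivalent 8 \<phi> (dual_young \<psi>)) \<and>
     (\<forall>t. 0 < t \<and> t \<le> 1 \<longrightarrow>
        ereal_of_enat (Cz (norm :: 'a \<Rightarrow> real) t) \<le> 1 + 1 / ereal (\<psi> (t / 4)))"
proof -
  define I where "I = {N :: 'a \<Rightarrow> real. banach_norm N \<and> banach_mazur (norm :: 'a \<Rightarrow> real) N \<le> 2}"
  have norm_I: "norm \<in> I" using banach_norm_norm banach_mazur_norm_self unfolding I_def by blast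
  then have ne: "I \<noteq> {}" by blast
  interpret n: separable_norm "norm :: 'a \<Rightarrow> real"
    by (rule separable_norm_of_bounds[of _ 1]) (use infinite_dim separable in \<open>auto simp: is_norm_norm\<close>)
  \<comment> \<open>Facts about \<open>rho\<close> and \<open>theta\<close> alone use
    \<open>K = 3\<close>; only the Szlenk bound needs \<open>K\<close> close to 2.\<close>
  have renorm: "\<exists>M :: 'a \<Rightarrow> real. separable_norm M \<and> (\<forall>x. norm x \<le> M x \<and> M x \<le> K * norm x) \<and>
    rho M = rho N \<and> theta M = theta N" if N: "N \<in> I" and K: "2 < K" for N and K :: real
  proof -
    have "\<exists>x :: 'a. x \<noteq> 0" using n.unit_vector_exists by (metis norm_zero zero_neq_one)
    moreover have "banach_mazur (norm :: 'a \<Rightarrow> real) N < ereal K"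
      using N K le_less_trans[of _ 2 "ereal K"] by (simp add: I_def)
    ultimately obtain M :: "'a \<Rightarrow> real" where M: "is_norm M" "\<And>x. norm x \<le> M x" "\<And>x. M x \<le> K * norm x"
      "rho M = rho N" "theta M = theta N"
      using equivalent_norm_of_banach_mazur[of N K] N by (auto simp: I_def banach_norm_def)
    with separable_norm_of_bounds[OF M(1-3) infinite_dim separable] show ?thesis by blast
  qed
  have R: "0 \<le> rho N t" "rho N t \<le> t" and Th: "0 \<le> theta N t" "theta N t \<le> t"
    if "N \<in> I" "0 \<le> t" for N t
  proof -
    obtain M :: "'a \<Rightarrow> real" where M: "separable_norm M" "rho M = rho N" "theta M = theta N"
      using renorm[OF \<open>N \<in> I\<close>, of 3] by auto
    then show "0 \<le> rho N t" "rho N t \<le> t" "0 \<le> theta N t" "theta N t \<le> t"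
      using separable_norm.rho_nonneg[OF M(1) that(2)] separable_norm.rho_le_self[OF M(1) that(2)]
        separable_norm.theta_nonneg[OF M(1) that(2)] separable_norm.theta_le_self[OF M(1) that(2)]
      by auto
  qed
  have R_scale: "rho N (l * t) \<le> l * rho N t" and Th_scale: "theta N (l * t) \<le> l * theta N t"
    if "N \<in> I" "0 \<le> t" "0 < l" "l \<le> 1" for N l t
  proof -
    obtain M :: "'a \<Rightarrow> real" where M: "separable_norm M" "rho M = rho N" "theta M = theta N"
      using renorm[OF \<open>N \<in> I\<close>, of 3] by auto
    then show "rho N (l * t) \<le> l * rho N t" "theta N (l * t) \<le> l * theta N t"
      using separable_norm.rho_scale[OF M(1) that(2-4)] separable_norm.theta_scale[OF M(1) that(2-4)]
      by auto
  qed
  have young: "\<tau> * t / 4 - rho N t \<le> theta N \<tau>"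
    if "N \<in> I" "0 \<le> \<tau>" "\<tau> \<le> 1" "0 \<le> t" "t \<le> 1" for N \<tau> t
  proof -
    obtain M :: "'a \<Rightarrow> real" where M: "separable_norm M" "rho M = rho N" "theta M = theta N"
      using renorm[OF \<open>N \<in> I\<close>, of 3] by auto
    then show ?thesis using theta_ge_young[OF M(1) no_ell1 that(2-5)] by simp
  qed
  have slope: "rho N (theta N u / (2 * u)) \<le> theta N u / 2" if "N \<in> I" "0 < u" "u \<le> 1" for N u
  proof -
    obtain M :: "'a \<Rightarrow> real" where M: "separable_norm M" "rho M = rho N" "theta M = theta N"
      using renorm[OF \<open>N \<in> I\<close>, of 3] by auto
    then show ?thesis using separable_norm.rho_theta_slope_le[OF M(1) that(2,3)] by simp
  qed
  have phi_eq: "\<phi> t = (INF N\<in>I. rho N t)" for t by (simp add: phi phi_def I_def)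
  have psi_eq: "\<psi> t = (SUP N\<in>I. theta N t)" for t by (simp add: psi psi_def I_def)
  interpret family: young_family I rho theta \<phi> \<psi>
    by unfold_locales (fact ne R Th R_scale Th_scale young slope phi_eq psi_eq)+
  have rho_eq: "\<rho> t = (INF N\<in>{norm :: 'a \<Rightarrow> real}. rho N t)"
    and theta_eq: "\<theta> t = (SUP N\<in>{norm :: 'a \<Rightarrow> real}. theta N t)" for t
    by (simp_all add: rho theta)
  have sub: "N \<in> I" if "N \<in> {norm}" for N :: "'a \<Rightarrow> real" using that norm_I by simp
  interpret single: young_family "{norm :: 'a \<Rightarrow> real}" rho theta \<rho> \<theta>
    by (unfold_locales, rule insert_not_empty)
      (fact R[OF sub] Th[OF sub] R_scale[OF sub] Th_scale[OF sub] young[OF sub] slope[OF sub]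
        rho_eq theta_eq)+
  have "ereal_of_enat (Cz (norm :: 'a \<Rightarrow> real) t) \<le> 1 + 1 / ereal (\<psi> (t / 4))" if t: "0 < t" "t \<le> 1" for t
  proof (cases "\<psi> (t / 4) = 0")
    case True
    \<comment> \<open>Here the right-hand side is infinite.\<close>
    then show ?thesis by (simp add: divide_ereal_def flip: zero_ereal_def)
  next
    case False
    have bdd: "bdd_above ((\<lambda>N. theta N (t / 4)) ` I)"
      by (rule bdd_aboveI2, rule Th(2)) (use t in simp_all)
    have "theta (norm :: 'a \<Rightarrow> real) (t / 4) \<le> \<psi> (t / 4)"
      unfolding psi_eq using norm_I bdd by (rule cSUP_upper)
    moreover have "0 \<le> theta (norm :: 'a \<Rightarrow> real) (t / 4)" using Th(1)[OF norm_I] t by simp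
    ultimately have "0 \<le> \<psi> (t / 4)" by linarith
    with False have pos: "0 < \<psi> (t / 4)" by simp
    \<comment> \<open>The least integer strictly above \<open>1 / \<psi> (t / 4)\<close>. Strictness
      makes the final radius negative, and \<open>n\<close> still does not exceed
      \<open>1 + 1 / \<psi> (t / 4)\<close>.\<close>
    define n where "n = nat \<lfloor>1 / \<psi> (t / 4)\<rfloor> + 1"
    have n: "real n \<le> 1 + 1 / \<psi> (t / 4)" "1 / \<psi> (t / 4) < real n" "0 < n"
      using pos by (auto simp: n_def) linarith+
    have "1 / real n < \<psi> (t / 4)" using n pos by (simp add: field_simps)
    then obtain N where N: "N \<in> I" "1 / real n < theta N (t / 4)"
      using less_cSUP_iff[OF ne bdd] unfolding psi_eq by blast
    \<comment> \<open>Half of the gap is spent on replacing \<open>t / 4\<close> by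
      \<open>l * (t / 4)\<close>: with \<open>1 / l - 1 = gap / 6\<close> the loss
      \<open>3 * (1 / l - 1)\<close> is \<open>gap / 2\<close>. This makes room for the renorming
      ratio \<open>2 / l > 2\<close>.\<close>
    define gap where "gap = theta N (t / 4) - 1 / real n"
    define l where "l = 1 / (1 + gap / 6)"
    have gap: "0 < gap" using N(2) by (simp add: gap_def)
    then have l: "0 < l" "l < 1" by (auto simp: l_def)
    obtain M0 :: "'a \<Rightarrow> real" where M0: "separable_norm M0" "theta M0 = theta N"
      using renorm[OF N(1), of 3] by auto
    have l_gap: "1 / l - 1 = gap / 6" by (simp add: l_def)
    have "theta N (t / 4) - 3 * (gap / 6) \<le> theta N (l * (t / 4))"
      using separable_norm.theta_left_continuous[OF M0(1), of "t / 4" l] M0(2) t l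
      unfolding l_gap by simp
    then have "1 / real n < theta N (l * (t / 4))" using gap gap_def by linarith
    have "2 < 2 / l" using l by (simp add: less_divide_eq)
    from renorm[OF N(1) this] obtain M :: "'a \<Rightarrow> real" where M: "separable_norm M" "\<And>x. norm x \<le> M x" "\<And>x. M x \<le> 2 / l * norm x"
      "theta M = theta N"
      by auto
    have "t / (2 * (2 / l)) = l * (t / 4)" by simp
    with \<open>1 / real n < theta N (l * (t / 4))\<close> M(4) have "1 < real n * theta M (t / (2 * (2 / l)))" using n(3) by (simp add: field_simps)
    then have "(convex_szlenk_deriv norm t ^^ n) (dual_ball (norm :: 'a \<Rightarrow> real)) = {}"
      using t l mult_le_one[of t l]
      by (intro separable_norm.convex_szlenk_deriv_iterate_empty[OF M(1-3)]) auto
    then have "Cz (norm :: 'a \<Rightarrow> real) t \<le> enat n"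
      by (auto simp: Cz_def intro: Least_le)
    then have "ereal_of_enat (Cz (norm :: 'a \<Rightarrow> real) t) \<le> ereal_of_enat (enat n)"
      by (simp only: ereal_of_enat_le_iff)
    also have "\<dots> \<le> ereal (1 + 1 / \<psi> (t / 4))" using n(1) by simp
    also have "\<dots> = 1 + 1 / ereal (\<psi> (t / 4))" using pos by (simp add: one_ereal_def)
    finally show ?thesis .
  qed
  then show ?thesis
    using family.mono_on_slopes single.mono_on_slopes family.equivalent_G_dual_F
      single.equivalent_G_dual_F family.equivalent_F_dual_G single.equivalent_F_dual_G
    by blast
qed

end
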